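(* Consider the class of third-order ODEs $y'''=f(x,y,y',y'')$ with $f_{4,4,4}\neq 0$ (and on the domain where $f_{4,4}\ne 0$, so that the expressions below are defined), where, with $p=y'$, $q=y''$, the subscripts $1,2,3,4$ on $f$ denote partial derivatives with respect to $x,y,p,q$, and $\dot D_x=\partial_x+p\,\partial_y+q\,\partial_p+f\,\partial_q$. Define $$\begin{aligned} \lambda_4={}&f_{4,4},\\ \lambda_5={}&\tfrac13\left(2f_{3,4}f_4-2f_3f_{4,4}-6f_{2,4}+3f_{3,3}\right),\\ \lambda_6={}&f_{4,4,4},\\ \lambda_7={}&\tfrac13\left(2f_4f_{4,4,4}+3f_{3,4,4}\right),\\ \lambda_8={}&\tfrac19\left(4f_{4,4,4}f_4^2+12f_4f_{3,4,4}+4f_4f_{4,4}^2+9f_{3,3,4}+6f_{3,4}f_{4,4}\right),\\ \lambda_9={}&\tfrac19\left(2f_{4,4,4}f_4^2+2f_4f_{4,4}^2+3f_4f_{3,4,4}+3f_{4,4,4}f_3+9f_{2,4,4}+3f_{3,4}f_{4,4}\right),\\ \lambda_{10}={}&\tfrac1{18}\big(-4f_4^2f_{3,4,4}+4f_4f_{4,4,4}f_3+12f_4f_{2,4,4}-12f_{3,3,4}f_4-4f_4f_{3,4}f_{4,4}-6f_{3,4}^2-9f_{3,3,3}\\ &+4f_{4,4}^2f_3+6f_3f_{3,4,4}+12f_{2,4}f_{4,4}+18f_{2,3,4}\big),\\ \lambda_{11}={}&\tfrac1{27}\big(-4f_4f_3f_{4,4}^2-6f_{4,4}f_{3,4}f_3-18f_{4,4}f_{2,3}-12f_{4,4}f_{2,4}f_4+4f_{4,4}f_{3,4}f_4^2-6f_{4,4,4}f_3^2-36f_3f_{2,4,4}\\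 &-4f_3f_{4,4,4}f_4^2+9f_3f_{3,3,4}+12f_{3,4}^2f_4+9f_{3,4}f_{3,3}+4f_4^3f_{3,4,4}-12f_4^2f_{2,4,4}+12f_{3,3,4}f_4^2\\ &+9f_4f_{3,3,3}-54f_{2,2,4}+27f_{2,3,3}\big),\\ \lambda_{12}={}&\tfrac13\left(-f_4^2-3f_3+3\dot D_xf_4\right),\\ \lambda_{13}={}&\tfrac19\left(-2f_4^3-9f_4f_3+6f_4\dot D_xf_4-27f_2+9\dot D_xf_3\right),\\ \lambda_{14}={}&\tfrac13\left(3\dot D_xf_{4,4}+f_{4,4}f_4\right),\\ \lambda_{15}={}&\tfrac19\left(2f_{4,4}f_4^2+3f_3f_{4,4}+6f_4\dot D_xf_{4,4}-9f_{2,4}+9\dot D_xf_{3,4}\right),\\ \lambda_{16}={}&\tfrac19\big(4f_4^2\dot D_xf_{4,4}-2f_4^2f_{3,4}-3f_4f_{3,3}+12f_4\dot D_xf_{3,4}+4f_4f_{4,4}\dot D_xf_4-12f_{2,4}f_4+6f_{3,4}\dot D_xf_4\\ &-18f_{2,3}+9\dot D_xf_{3,3}\big),\\ \lambda_{17}={}&\tfrac1{27}\big(2f_{4,4}f_4^3-6f_4^2f_{3,4}+6f_4^2\dot D_xf_{4,4}-9f_4f_{3,3}+12f_4f_3f_{4,4}+9f_4\dot D_xf_{3,4}-9f_{2,4}f_4+9f_3\dot D_xf_{4,4}\\ &-27f_{2,3}+27f_2f_{4,4}+27\dot D_xf_{2,4}\big),\\ \lambda_{18}={}&\tfrac1{27}\big(-9f_3^2f_{4,4}+9f_3\dot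 D_xf_{3,4}+6f_3f_4\dot D_xf_{4,4}+6f_3f_{4,4}\dot D_xf_4+6f_3f_{3,4}f_4-54f_3f_{2,4}+9f_3f_{3,3}\\ &+4f_{4,4}f_4^2\dot D_xf_4+6f_{3,4}f_4\dot D_xf_4+18f_{2,4}\dot D_xf_4+27f_2f_{3,4}-2f_{3,4}f_4^3-30f_4^2f_{2,4}+18f_4f_{4,4}f_2\\ &+4f_4^3\dot D_xf_{4,4}+12f_4^2\dot D_xf_{3,4}-3f_4^2f_{3,3}+9f_4\dot D_xf_{3,3}+18f_4\dot D_xf_{2,4}-45f_4f_{2,3}-81f_{2,2}+27\dot D_xf_{2,3}\big),\\ \lambda_{19}={}&\tfrac19\left(-2f_4^3-9f_4f_3-27f_2+9\dot D_x^2f_4\right),\\ \lambda_{20}={}&\tfrac1{27}\big(-2f_4^4-12f_4^2f_3-6f_4^2\dot D_xf_4+18f_4\dot D_x^2f_4-27f_4\dot D_xf_3-18f_3^2+9f_3\dot D_xf_4-81\dot D_xf_2+27\dot D_x^2f_3\big). \end{aligned}$$ Then all the third-order differential invariants of the class under the point transformations $\bar x=x,\ \bar y=\psi(x,y)$ are functions of the following seventeen differential invariants: $$\alpha_1=x,\quad \alpha_2=\frac{\lambda_5}{\lambda_4},\quad \alpha_3=\frac{\lambda_6}{\lambda_4^2},\quad \alpha_4=\frac{\lambda_7}{\lambda_4^2},\quad \alpha_5=\frac{\lambda_8}{\lambda_4^2},\quad \alpha_6=\frac{\lambda_9}{\lambda_4^2},\quad \alpha_7=\frac{\lambda_{10}}{\lambda_4^2},\quad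 \alpha_8=\frac{\lambda_{11}}{\lambda_4^2},\quad \alpha_9=\lambda_{12},$$ $$\alpha_{10}=\lambda_{13},\quad \alpha_{11}=\frac{\lambda_{14}}{\lambda_4},\quad \alpha_{12}=\frac{\lambda_{15}}{\lambda_4},\quad \alpha_{13}=\frac{\lambda_{16}}{\lambda_4},\quad \alpha_{14}=\frac{\lambda_{17}}{\lambda_4},\quad \alpha_{15}=\frac{\lambda_{18}}{\lambda_4},\quad \alpha_{16}=\lambda_{19},\quad \alpha_{17}=\lambda_{20},$$ where the $\lambda_i$, $4\le i\le 20$, are relative invariants. Moreover, the invariant differentiation operators are $$\mathcal D_1=\frac1{f_{4,4}}\tilde D_q,\qquad \mathcal D_2=\frac1{f_{4,4}}\left(3\tilde D_p+2f_4\tilde D_q\right),$$ $$\mathcal D_3=\frac1{f_{4,4}}\left(9\tilde D_y+3f_4\tilde D_p+(2f_4^2+3f_3)\tilde D_q\right),\qquad \mathcal D_4=\tilde D_x+p\tilde D_y+q\tilde D_p+f\tilde D_q.$$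
   Context: Notation: $p=y'$, $q=y''$; $f=f(x,y,p,q)$; $f_i$, $f_{i,j}$, $f_{i,j,k}$ with indices in $\{1,2,3,4\}$ are partial derivatives of $f$ with respect to $x,y,p,q$ (in this order). $\dot D_x=\partial_x+p\partial_y+q\partial_p+f\partial_q$ acts on functions of $(x,y,p,q)$, and $\dot D_x^2$ is its twofold iteration. Equivalence transformations: an invertible (local) point transformation $\bar x=\phi$, $\bar y=\psi$ maps each equation $y'''=f(x,y,y',y'')$ to an equation $\bar y'''=\bar f(\bar x,\bar y,\bar y',\bar y'')$ of the same class; it thereby acts (by prolongation) on the variables $x,y,p,q$, on $f$ and on all partial derivatives of $f$. Here the pseudo-group is $\bar x=x$, $\bar y=\psi(x,y)$, with $\psi$ arbitrary. Its infinitesimal generators are, for arbitrary $\eta(x,y)$, $$Y=\eta\,\partial_y+\dot D_x(\eta)\,\partial_p+\dot D_x^2(\eta)\,\partial_q+\dot D_x^3(\eta)\,\partial_f,$$ and $Y^{(s)}$ denotes the prolongation of $Y$ to the partial derivatives of $f$ up to order $s$, where $f$ is regarded as a dependent variable and $x,y,p,q$ as independent variables. A differential invariant of order $s$ is a function $J(x,y,p,q,f,f_{(1)},\dots,f_{(s)})$, with $f_{(k)}$ the collection of all $k$-th order partial derivatives of $f$, which is invariant under the equivalence transformations considered; these functions are determined by the infinitesimal criterion $Y^{(s)}J=0$ for all generators $Y$. "Third-order differential invariants" are those with $s=3$ (they may depend on derivatives of order up to 3). "Are functions of" refers to (local) functional dependence: the listed invariants form a complete set of functionally independent solutions. A relative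 invariant is a function $\lambda$ of the same variables whose vanishing is preserved, i.e. $Y^{(s)}\lambda$ is a multiple of $\lambda$. For $k\in\{x,y,p,q\}$, $\tilde D_k=\partial_k+f_k\partial_f+\sum_i f_{ki}\partial_{f_i}+\cdots$ is the operator of total differentiation with respect to the independent variable $k$, with $f$ the dependent variable. An invariant differentiation operator is an operator $\mathcal D=K\tilde D_x+L\tilde D_y+M\tilde D_p+N\tilde D_q$, with coefficients $K,L,M,N$ depending on $x,y,p,q,f$ and derivatives of $f$ up to order 3, such that $\mathcal D I$ is a differential invariant whenever $I$ is a differential invariant. The number of independent such operators equals the number of independent variables $x,y,p,q$, i.e. four; the assertion is that $\mathcal D_1,\dots,\mathcal D_4$ are four independent invariant differentiation operators. *)

theory Defs
  imports "HOL-Analysis.Analysis" "HOL-Library.Multiset"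
begin

section \<open>Smooth functions of coordinates\<close>

text \<open>
  A point is a coordinate vector of type \<^typ>\<open>'i \<Rightarrow> real\<close>, where the index type may be
  infinite (so that jets of every order live in one type). Function spaces carry the product
  topology.
\<close>

definition pd :: "'i \<Rightarrow> (('i \<Rightarrow> real) \<Rightarrow> real) \<Rightarrow> ('i \<Rightarrow> real) \<Rightarrow> real" where
  "pd c F z = deriv (\<lambda>t. F (z(c := t))) (z c)"

definition smooth_on :: "('i \<Rightarrow> real) set \<Rightarrow> (('i \<Rightarrow> real) \<Rightarrow> real) \<Rightarrow> bool" where
  "smooth_on U F \<longleftrightarrow>
     (\<forall>cs. continuous_on U (foldr pd cs F) \<and>
           (\<forall>c. \<forall>z\<in>U. (\<lambda>t. foldr pd cs F (z(c := t))) differentiable at (z c)))"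

text \<open>
  \<open>local_function C U F\<close>: \<open>F\<close> is a smooth function of the coordinates in \<open>C\<close> only, defined on an
  open set of values of these coordinates; \<open>U\<close> is the cylinder over that open set.
\<close>

definition local_function :: "'i set \<Rightarrow> ('i \<Rightarrow> real) set \<Rightarrow> (('i \<Rightarrow> real) \<Rightarrow> real) \<Rightarrow> bool" where
  "local_function C U F \<longleftrightarrow>
     open U \<and> smooth_on U F \<and>
     (\<forall>z\<in>U. \<forall>z'. (\<forall>c\<in>C. z' c = z c) \<longrightarrow> z' \<in> U \<and> F z' = F z)"


section \<open>Jets of functions \<open>f(x, y, p, q)\<close>\<close>

datatype var = Vx | Vy | Vp | Vq

lemma UNIV_var: "UNIV = {Vx, Vy, Vp, Vq}"
  by (auto intro: var.exhaust)

instance var :: finite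
  by standard (simp add: UNIV_var)

text \<open>
  The coordinate \<open>Dep J\<close> is the partial derivative of \<open>f\<close> with multi-index \<open>J\<close>, encoded as a
  multiset of independent variables; \<open>Dep {#}\<close> is \<open>f\<close> itself.
\<close>

datatype coord = Indep var | Dep "var multiset"

type_synonym jet = "coord \<Rightarrow> real"

definition jet_coords :: "nat \<Rightarrow> coord set" where
  "jet_coords s = range Indep \<union> Dep ` {J. size J \<le> s}"

definition differential_function :: "nat \<Rightarrow> jet set \<Rightarrow> (jet \<Rightarrow> real) \<Rightarrow> bool" where
  "differential_function s U F \<longleftrightarrow> local_function (jet_coords s) U F"

text \<open>
  Total derivative. The sum over all multi-indices is formally infinite; a function of finitely
  many coordinates contributes finitely many nonzero terms, and the sum is restricted to these.
\<close>

definition total_deriv :: "var \<Rightarrow> (jet \<Rightarrow> real) \<Rightarrow> jet \<Rightarrow> real" where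
  "total_deriv k F z =
     pd (Indep k) F z + (\<Sum>J | pd (Dep J) F z \<noteq> 0. z (Dep (add_mset k J)) * pd (Dep J) F z)"

text \<open>
  The operator \<open>\<partial>\<^sub>x + p \<partial>\<^sub>y + q \<partial>\<^sub>p + f \<partial>\<^sub>q\<close> applied to functions of \<open>(x, y, p, q)\<close>. The functions it is
  applied to here are built from \<open>f\<close> and its derivatives, so on jets the partial derivatives
  become total ones; on functions not involving \<open>f\<close> the two agree.
\<close>

definition Dx :: "(jet \<Rightarrow> real) \<Rightarrow> jet \<Rightarrow> real" where
  "Dx F z = total_deriv Vx F z + z (Indep Vp) * total_deriv Vy F z
          + z (Indep Vq) * total_deriv Vp F z + z (Dep {#}) * total_deriv Vq F z"


section \<open>Infinitesimal generators and invariants\<close>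

text \<open>
  The generators are parametrised by smooth functions \<open>\<eta>(x, y)\<close>, given on an open set of the
  \<open>(x, y)\<close>-plane.
\<close>

definition generator :: "jet set \<Rightarrow> (jet \<Rightarrow> real) \<Rightarrow> bool" where
  "generator V \<eta> \<longleftrightarrow> local_function {Indep Vx, Indep Vy} V \<eta>"

fun xi :: "(jet \<Rightarrow> real) \<Rightarrow> var \<Rightarrow> jet \<Rightarrow> real" where
  "xi \<eta> Vx = (\<lambda>z. 0)"
| "xi \<eta> Vy = \<eta>"
| "xi \<eta> Vp = Dx \<eta>"
| "xi \<eta> Vq = Dx (Dx \<eta>)"

text \<open>
  Prolongation: \<open>zeta \<eta> ks\<close> is the component of the prolonged generator along the derivative of
  \<open>f\<close> with respect to the variables in \<open>ks\<close>. Total derivatives commute, so the order of \<open>ks\<close> is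
  immaterial; \<open>index_list\<close> fixes one.
\<close>

fun zeta :: "(jet \<Rightarrow> real) \<Rightarrow> var list \<Rightarrow> jet \<Rightarrow> real" where
  "zeta \<eta> [] = Dx (Dx (Dx \<eta>))"
| "zeta \<eta> (k # ks) =
     (\<lambda>z. total_deriv k (zeta \<eta> ks) z
        - (\<Sum>i\<in>UNIV. z (Dep (add_mset i (mset ks))) * total_deriv k (xi \<eta> i) z))"

definition index_list :: "var multiset \<Rightarrow> var list" where
  "index_list J = concat (map (\<lambda>k. replicate (count J k) k) [Vx, Vy, Vp, Vq])"

lemma mset_index_list: "mset (index_list J) = J"
proof (rule multiset_eqI)
  fix k show "count (mset (index_list J)) k = count J k"
    by (cases k) (simp_all add: index_list_def)
qed

lemma finite_multi_indices: "finite {J :: var multiset. size J \<le> s}"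
proof (rule finite_subset)
  show "{J :: var multiset. size J \<le> s} \<subseteq> mset ` {ks. set ks \<subseteq> UNIV \<and> length ks \<le> s}"
  proof
    fix J :: "var multiset" assume "J \<in> {J. size J \<le> s}"
    then have "length (index_list J) \<le> s"
      by (metis mem_Collect_eq mset_index_list size_mset)
    then show "J \<in> mset ` {ks. set ks \<subseteq> UNIV \<and> length ks \<le> s}"
      by (metis (mono_tags, lifting) image_iff mem_Collect_eq mset_index_list subset_UNIV)
  qed
  show "finite (mset ` {ks :: var list. set ks \<subseteq> UNIV \<and> length ks \<le> s})"
    by (intro finite_imageI finite_lists_length_le) simp
qed

definition prolonged :: "nat \<Rightarrow> (jet \<Rightarrow> real) \<Rightarrow> (jet \<Rightarrow> real) \<Rightarrow> jet \<Rightarrow> real" where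
  "prolonged s \<eta> F z =
     (\<Sum>i\<in>UNIV. xi \<eta> i z * pd (Indep i) F z)
     + (\<Sum>J | size J \<le> s. zeta \<eta> (index_list J) z * pd (Dep J) F z)"

definition differential_invariant :: "nat \<Rightarrow> jet set \<Rightarrow> (jet \<Rightarrow> real) \<Rightarrow> bool" where
  "differential_invariant s U F \<longleftrightarrow>
     differential_function s U F \<and>
     (\<forall>V \<eta>. generator V \<eta> \<longrightarrow> (\<forall>z\<in>U \<inter> V. prolonged s \<eta> F z = 0))"

text \<open>
  The multiplier is required to be smooth: a merely pointwise factor would be no condition
  wherever \<open>F\<close> is nonzero.
\<close>

definition relative_invariant :: "nat \<Rightarrow> jet set \<Rightarrow> (jet \<Rightarrow> real) \<Rightarrow> bool" where
  "relative_invariant s U F \<longleftrightarrow>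
     differential_function s U F \<and>
     (\<forall>V \<eta>. generator V \<eta> \<longrightarrow>
        (\<exists>\<mu>. differential_function s (U \<inter> V) \<mu> \<and>
             (\<forall>z\<in>U \<inter> V. prolonged s \<eta> F z = \<mu> z * F z)))"

text \<open>Functional independence: the differentials are linearly independent at every point.\<close>

definition functionally_independent :: "jet set \<Rightarrow> (jet \<Rightarrow> real) list \<Rightarrow> bool" where
  "functionally_independent U Fs \<longleftrightarrow>
     (\<forall>z\<in>U. \<forall>c :: nat \<Rightarrow> real.
        (\<forall>k. (\<Sum>i<length Fs. c i * pd k (Fs ! i) z) = 0) \<longrightarrow> (\<forall>i<length Fs. c i = 0))"

text \<open>
  Local functional dependence. \<open>\<Phi>\<close> depends only on its first \<open>length Fs\<close> arguments, so the values
  of \<open>Fs ! i\<close> beyond the end of the list do not matter.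
\<close>

definition locally_function_of ::
    "jet set \<Rightarrow> (jet \<Rightarrow> real) list \<Rightarrow> (jet \<Rightarrow> real) \<Rightarrow> bool" where
  "locally_function_of U Fs F \<longleftrightarrow>
     (\<forall>z\<^sub>0\<in>U. \<exists>W V \<Phi>. open W \<and> z\<^sub>0 \<in> W \<and> W \<subseteq> U \<and> local_function {..<length Fs} V \<Phi> \<and>
        (\<forall>z\<in>W. (\<lambda>i. (Fs ! i) z) \<in> V \<and> F z = \<Phi> (\<lambda>i. (Fs ! i) z)))"


section \<open>Invariant differentiation operators\<close>

text \<open>An operator is given by its four coefficients.\<close>

type_synonym diff_op = "var \<Rightarrow> jet \<Rightarrow> real"

fun mk_op :: "(jet \<Rightarrow> real) \<Rightarrow> (jet \<Rightarrow> real) \<Rightarrow> (jet \<Rightarrow> real) \<Rightarrow> (jet \<Rightarrow> real) \<Rightarrow> diff_op" where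
  "mk_op K L M N Vx = K"
| "mk_op K L M N Vy = L"
| "mk_op K L M N Vp = M"
| "mk_op K L M N Vq = N"

definition apply_op :: "diff_op \<Rightarrow> (jet \<Rightarrow> real) \<Rightarrow> jet \<Rightarrow> real" where
  "apply_op D F z = (\<Sum>k\<in>UNIV. D k z * total_deriv k F z)"

definition invariant_diff_op :: "nat \<Rightarrow> jet set \<Rightarrow> diff_op \<Rightarrow> bool" where
  "invariant_diff_op r U D \<longleftrightarrow>
     (\<forall>k. differential_function r U (D k)) \<and>
     (\<forall>s W I. differential_invariant s W I \<longrightarrow>
        (\<exists>s'. differential_invariant s' (U \<inter> W) (apply_op D I)))"

definition independent_ops :: "jet set \<Rightarrow> diff_op list \<Rightarrow> bool" where
  "independent_ops U Ds \<longleftrightarrow>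
     (\<forall>z\<in>U. \<forall>c :: nat \<Rightarrow> real.
        (\<forall>k. (\<Sum>i<length Ds. c i * (Ds ! i) k z) = 0) \<longrightarrow> (\<forall>i<length Ds. c i = 0))"


section \<open>The invariants of the class\<close>

definition fder :: "var list \<Rightarrow> jet \<Rightarrow> real" where
  "fder ks z = z (Dep (mset ks))"

text \<open>In numeric suffixes, \<open>1, 2, 3, 4\<close> stand for \<open>x, y, p, q\<close>.\<close>

abbreviation "f2 \<equiv> fder [Vy]"
abbreviation "f3 \<equiv> fder [Vp]"
abbreviation "f4 \<equiv> fder [Vq]"
abbreviation "f22 \<equiv> fder [Vy, Vy]"
abbreviation "f23 \<equiv> fder [Vy, Vp]"
abbreviation "f24 \<equiv> fder [Vy, Vq]"
abbreviation "f33 \<equiv> fder [Vp, Vp]"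
abbreviation "f34 \<equiv> fder [Vp, Vq]"
abbreviation "f44 \<equiv> fder [Vq, Vq]"
abbreviation "f224 \<equiv> fder [Vy, Vy, Vq]"
abbreviation "f233 \<equiv> fder [Vy, Vp, Vp]"
abbreviation "f234 \<equiv> fder [Vy, Vp, Vq]"
abbreviation "f244 \<equiv> fder [Vy, Vq, Vq]"
abbreviation "f333 \<equiv> fder [Vp, Vp, Vp]"
abbreviation "f334 \<equiv> fder [Vp, Vp, Vq]"
abbreviation "f344 \<equiv> fder [Vp, Vq, Vq]"
abbreviation "f444 \<equiv> fder [Vq, Vq, Vq]"

definition lam4 :: "jet \<Rightarrow> real" where
  "lam4 z = f44 z"

definition lam5 :: "jet \<Rightarrow> real" where
  "lam5 z =
    (2 * f34 z * f4 z - 2 * f3 z * f44 z - 6 * f24 z + 3 * f33 z) / 3"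

definition lam6 :: "jet \<Rightarrow> real" where
  "lam6 z = f444 z"

definition lam7 :: "jet \<Rightarrow> real" where
  "lam7 z =
    (2 * f4 z * f444 z + 3 * f344 z) / 3"

definition lam8 :: "jet \<Rightarrow> real" where
  "lam8 z =
    (4 * f444 z * f4 z ^ 2 + 12 * f4 z * f344 z + 4 * f4 z * f44 z ^ 2 + 9 * f334 z
     + 6 * f34 z * f44 z) / 9"

definition lam9 :: "jet \<Rightarrow> real" where
  "lam9 z =
    (2 * f444 z * f4 z ^ 2 + 2 * f4 z * f44 z ^ 2 + 3 * f4 z * f344 z + 3 * f444 z * f3 z
     + 9 * f244 z + 3 * f34 z * f44 z) / 9"

definition lam10 :: "jet \<Rightarrow> real" where
  "lam10 z =
    (-4 * f4 z ^ 2 * f344 z + 4 * f4 z * f444 z * f3 z + 12 * f4 z * f244 z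
     - 12 * f334 z * f4 z - 4 * f4 z * f34 z * f44 z - 6 * f34 z ^ 2 - 9 * f333 z
     + 4 * f44 z ^ 2 * f3 z + 6 * f3 z * f344 z + 12 * f24 z * f44 z + 18 * f234 z) / 18"

definition lam11 :: "jet \<Rightarrow> real" where
  "lam11 z =
    (-4 * f4 z * f3 z * f44 z ^ 2 - 6 * f44 z * f34 z * f3 z - 18 * f44 z * f23 z
     - 12 * f44 z * f24 z * f4 z + 4 * f44 z * f34 z * f4 z ^ 2 - 6 * f444 z * f3 z ^ 2
     - 36 * f3 z * f244 z - 4 * f3 z * f444 z * f4 z ^ 2 + 9 * f3 z * f334 z
     + 12 * f34 z ^ 2 * f4 z + 9 * f34 z * f33 z + 4 * f4 z ^ 3 * f344 z
     - 12 * f4 z ^ 2 * f244 z + 12 * f334 z * f4 z ^ 2 + 9 * f4 z * f333 z - 54 * f224 z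
     + 27 * f233 z) / 27"

definition lam12 :: "jet \<Rightarrow> real" where
  "lam12 z =
    (- (f4 z ^ 2) - 3 * f3 z + 3 * Dx f4 z) / 3"

definition lam13 :: "jet \<Rightarrow> real" where
  "lam13 z =
    (-2 * f4 z ^ 3 - 9 * f4 z * f3 z + 6 * f4 z * Dx f4 z - 27 * f2 z + 9 * Dx f3 z) / 9"

definition lam14 :: "jet \<Rightarrow> real" where
  "lam14 z =
    (3 * Dx f44 z + f44 z * f4 z) / 3"

definition lam15 :: "jet \<Rightarrow> real" where
  "lam15 z =
    (2 * f44 z * f4 z ^ 2 + 3 * f3 z * f44 z + 6 * f4 z * Dx f44 z - 9 * f24 z + 9 * Dx f34 z) / 9"

definition lam16 :: "jet \<Rightarrow> real" where
  "lam16 z =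
    (4 * f4 z ^ 2 * Dx f44 z - 2 * f4 z ^ 2 * f34 z - 3 * f4 z * f33 z + 12 * f4 z * Dx f34 z
     + 4 * f4 z * f44 z * Dx f4 z - 12 * f24 z * f4 z + 6 * f34 z * Dx f4 z - 18 * f23 z
     + 9 * Dx f33 z) / 9"

definition lam17 :: "jet \<Rightarrow> real" where
  "lam17 z =
    (2 * f44 z * f4 z ^ 3 - 6 * f4 z ^ 2 * f34 z + 6 * f4 z ^ 2 * Dx f44 z - 9 * f4 z * f33 z
     + 12 * f4 z * f3 z * f44 z + 9 * f4 z * Dx f34 z - 9 * f24 z * f4 z
     + 9 * f3 z * Dx f44 z - 27 * f23 z + 27 * f2 z * f44 z + 27 * Dx f24 z) / 27"

definition lam18 :: "jet \<Rightarrow> real" where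
  "lam18 z =
    (-9 * f3 z ^ 2 * f44 z + 9 * f3 z * Dx f34 z + 6 * f3 z * f4 z * Dx f44 z
     + 6 * f3 z * f44 z * Dx f4 z + 6 * f3 z * f34 z * f4 z - 54 * f3 z * f24 z
     + 9 * f3 z * f33 z + 4 * f44 z * f4 z ^ 2 * Dx f4 z + 6 * f34 z * f4 z * Dx f4 z
     + 18 * f24 z * Dx f4 z + 27 * f2 z * f34 z - 2 * f34 z * f4 z ^ 3
     - 30 * f4 z ^ 2 * f24 z + 18 * f4 z * f44 z * f2 z + 4 * f4 z ^ 3 * Dx f44 z
     + 12 * f4 z ^ 2 * Dx f34 z - 3 * f4 z ^ 2 * f33 z + 9 * f4 z * Dx f33 z
     + 18 * f4 z * Dx f24 z - 45 * f4 z * f23 z - 81 * f22 z + 27 * Dx f23 z) / 27"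

definition lam19 :: "jet \<Rightarrow> real" where
  "lam19 z =
    (-2 * f4 z ^ 3 - 9 * f4 z * f3 z - 27 * f2 z + 9 * Dx (Dx f4) z) / 9"

definition lam20 :: "jet \<Rightarrow> real" where
  "lam20 z =
    (-2 * f4 z ^ 4 - 12 * f4 z ^ 2 * f3 z - 6 * f4 z ^ 2 * Dx f4 z + 18 * f4 z * Dx (Dx f4) z
     - 27 * f4 z * Dx f3 z - 18 * f3 z ^ 2 + 9 * f3 z * Dx f4 z - 81 * Dx f2 z
     + 27 * Dx (Dx f3) z) / 27"

definition lambdas :: "(jet \<Rightarrow> real) list" where
  "lambdas = [lam4, lam5, lam6, lam7, lam8, lam9, lam10, lam11, lam12, lam13, lam14, lam15,
              lam16, lam17, lam18, lam19, lam20]"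

definition alphas :: "(jet \<Rightarrow> real) list" where
  "alphas =
     [\<lambda>z. z (Indep Vx),
      \<lambda>z. lam5 z / lam4 z,
      \<lambda>z. lam6 z / (lam4 z)^2,
      \<lambda>z. lam7 z / (lam4 z)^2,
      \<lambda>z. lam8 z / (lam4 z)^2,
      \<lambda>z. lam9 z / (lam4 z)^2,
      \<lambda>z. lam10 z / (lam4 z)^2,
      \<lambda>z. lam11 z / (lam4 z)^2,
      lam12,
      lam13,
      \<lambda>z. lam14 z / lam4 z,
      \<lambda>z. lam15 z / lam4 z,
      \<lambda>z. lam16 z / lam4 z,
      \<lambda>z. lam17 z / lam4 z,
      \<lambda>z. lam18 z / lam4 z,
      lam19,
      lam20]"

definition inv_ops :: "diff_op list" where
  "inv_ops =
     [mk_op (\<lambda>z. 0) (\<lambda>z. 0) (\<lambda>z. 0) (\<lambda>z. 1 / f44 z),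
      mk_op (\<lambda>z. 0) (\<lambda>z. 0) (\<lambda>z. 1 / f44 z * 3) (\<lambda>z. 1 / f44 z * (2 * f4 z)),
      mk_op (\<lambda>z. 0) (\<lambda>z. 1 / f44 z * 9) (\<lambda>z. 1 / f44 z * (3 * f4 z))
            (\<lambda>z. 1 / f44 z * (2 * f4 z ^ 2 + 3 * f3 z)),
      mk_op (\<lambda>z. 1) (\<lambda>z. z (Indep Vp)) (\<lambda>z. z (Indep Vq)) (\<lambda>z. z (Dep {#}))]"

definition class_domain :: "jet set" where
  "class_domain = {z. f44 z \<noteq> 0 \<and> f444 z \<noteq> 0}"

end

theory Submission
  imports Defs
begin

text \<open>
  On functions of finitely many jet coordinates, total derivatives and prolonged generators are
  vector fields, and the commutator of two vector fields is determined by its components. This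
  gives \<open>[Y, D\<^sub>k] = - \<Sum>\<^sub>i D\<^sub>k(\<xi>\<^sup>i) D\<^sub>i\<close> for the prolonged generator \<open>Y\<close> of \<open>\<eta>\<close> and hence \<open>[Y, Dx] = 0\<close>. With
  \<open>e j b = Dx\<^sup>j \<partial>\<^sub>y\<^sup>b \<eta>\<close>, the operators \<open>D\<^sub>y\<close>, \<open>D\<^sub>p\<close>, \<open>D\<^sub>q\<close> act on the \<open>e j b\<close> with \<open>j \<le> 3\<close> by closed formulas
  that never mention \<open>D\<^sub>x\<close>. So \<open>Y\<close> is computed on all \<open>y, p, q\<close>-derivatives of \<open>f\<close>, and by \<open>[Y, Dx] = 0\<close> on
  their images under \<open>Dx\<close>; it turns out that \<open>Y \<lambda> = - w (e 0 1) \<lambda>\<close> with a weight \<open>w\<close> for each \<open>\<lambda>\<close>.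

  For completeness, the seventeen invariants and 22 further functions (\<open>y, p, q\<close>, some
  \<open>y, p, q\<close>-derivatives of \<open>f\<close> and some of their images under powers of \<open>Dx\<close>) form global coordinates
  on third-order jets with \<open>f\<^sub>4\<^sub>4 \<noteq> 0\<close>, because each is affine in a leading jet coordinate of its own,
  with coefficients in the earlier coordinates. The components of \<open>Y\<close> along the 22 functions
  are triangular in the \<open>e j b\<close>, \<open>j + b \<le> 6\<close>, and these can be prescribed at a point by
  \<open>\<eta> = X\<^sup>a W\<^sup>b / (a! b!)\<close>, where \<open>X\<close> is the increment of \<open>x\<close> and \<open>W\<close> is \<open>y\<close> minus the Taylor polynomial of
  the solution through the point. So an invariant has vanishing partial derivatives in the 22 directions.
\<close>

section \<open>Smooth functions of coordinates\<close>

text \<open>Jets of all orders form an infinite product of lines, which carries no norm, and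
  smoothness is a statement about iterated partial derivatives. Symmetry of second derivatives, the
  chain rule and closure under composition are therefore derived from one-dimensional mean values,
  for functions of finitely many coordinates. For the same reason the change of coordinates is
  inverted without an inverse function theorem: affine dependence on the leading coordinate allows
  division, one coordinate at a time, which also yields smoothness and the domain of the inverse.

  The count behind completeness is 39 = 17 + 22. Third-order jets have 4 + 35 coordinates, and the
  generators reach the 22 directions through exactly 22 values \<open>e j b\<close>, those with
  \<open>b <= 3\<close> and \<open>j + b <= 6\<close>.

  \<open>Dx\<close> differentiates along the solution through the chosen point. Plain monomials in
  \<open>x\<close> and \<open>y\<close> would therefore mix the values \<open>e j b\<close>, whereas
  the increment \<open>W\<close> vanishes along this solution to high order and makes the test
  generators a dual basis.\<close>

lemma open_contains_box:
  fixes U :: "('i \<Rightarrow> real) set"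
  assumes "open U" "z \<in> U"
  obtains K e where "finite K" "e > 0" "\<And>w. (\<And>c. c \<in> K \<Longrightarrow> \<bar>w c - z c\<bar> < e) \<Longrightarrow> w \<in> U"
proof -
  have "openin (product_topology (\<lambda>i. euclidean) UNIV) U"
    using assms(1) by (simp add: euclidean_product_topology)
  from product_topology_open_contains_basis[OF this assms(2)]
  obtain X where X: "z \<in> (\<Pi>\<^sub>E i\<in>UNIV. X i)" "\<And>i. open (X i)" "finite {i. X i \<noteq> UNIV}"
      "(\<Pi>\<^sub>E i\<in>UNIV. X i) \<subseteq> U"
    by auto
  define K where "K = {i. X i \<noteq> UNIV}"
  have "\<forall>i. \<exists>e>0. \<forall>t. \<bar>t - z i\<bar> < e \<longrightarrow> t \<in> X i"
  proof
    fix i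
    have "z i \<in> X i" using X(1) by auto
    with X(2)[of i] show "\<exists>e>0. \<forall>t. \<bar>t - z i\<bar> < e \<longrightarrow> t \<in> X i"
      by (simp add: open_dist dist_real_def)
  qed
  then obtain r where r: "\<And>i. r i > 0" "\<And>i t. \<bar>t - z i\<bar> < r i \<Longrightarrow> t \<in> X i"
    by metis
  \<comment> \<open>The element 1 gives the minimum a value when no coordinate is
    constrained.\<close>
  define e where "e = Min (insert 1 (r ` K))"
  have K: "finite K" using X(3) by (simp add: K_def)
  then have "e > 0" by (simp add: e_def r)
  moreover have "w \<in> U" if "\<And>c. c \<in> K \<Longrightarrow> \<bar>w c - z c\<bar> < e" for w
  proof -
    have "w i \<in> X i" for i
    proof (cases "i \<in> K")
      case True
      then have "e \<le> r i" using K by (simp add: e_def)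
      with that[OF True] show ?thesis by (intro r) simp
    qed (simp add: K_def)
    then show ?thesis using X(4) by auto
  qed
  ultimately show thesis using K that by blast
qed

lemma tendsto_coordinatewise:
  fixes g :: "'a \<Rightarrow> 'i \<Rightarrow> real"
  assumes "\<And>i. ((\<lambda>t. g t i) \<longlongrightarrow> l i) F"
  shows "(g \<longlongrightarrow> l) F"
proof (rule topological_tendstoI)
  fix S assume "open S" "l \<in> S"
  then obtain K e where K: "finite K" "e > 0" "\<And>w. (\<And>c. c \<in> K \<Longrightarrow> \<bar>w c - l c\<bar> < e) \<Longrightarrow> w \<in> S"
    by (rule open_contains_box) blast
  have "\<forall>\<^sub>F t in F. \<forall>c\<in>K. dist (g t c) (l c) < e"
    using assms K by (intro eventually_ball_finite ballI tendstoD) auto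
  then show "\<forall>\<^sub>F t in F. g t \<in> S"
    by eventually_elim (auto simp: dist_real_def intro: K(3))
qed

lemma continuous_on_open_tendsto_compose:
  assumes "open U" "continuous_on U f" "(g \<longlongrightarrow> l) F" "l \<in> U"
  shows "((\<lambda>x. f (g x)) \<longlongrightarrow> f l) F"
  using assms by (intro continuous_on_tendsto_compose[of U f g l F] topological_tendstoD)

lemma continuous_on_fun_upd: "continuous_on A (\<lambda>t::real. (z :: 'i \<Rightarrow> real)(c := t))"
proof (rule continuous_on_coordinatewise_then_product)
  show "continuous_on A (\<lambda>t. (z(c := t)) i)" for i
    by (cases "i = c") simp_all
qed

lemma eventually_fun_upd_mem:
  fixes z :: "'i \<Rightarrow> real"
  assumes "open U" "z \<in> U"
  shows "\<forall>\<^sub>F t in nhds (z c). z(c := t) \<in> U"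
proof -
  have "open ((\<lambda>t. z(c := t)) -` U)"
    using assms(1) by (intro open_vimage continuous_on_fun_upd)
  moreover have "z c \<in> (\<lambda>t. z(c := t)) -` U" using assms by simp
  ultimately show ?thesis
    unfolding eventually_nhds by (intro exI[of _ "(\<lambda>t. z(c := t)) -` U"]) auto
qed

section \<open>Partial derivatives and smoothness\<close>

lemma pd_cong:
  assumes "open U" "z \<in> U" "\<And>w. w \<in> U \<Longrightarrow> F w = G w"
  shows "pd c F z = pd c G z"
  unfolding pd_def
proof (rule deriv_cong_ev)
  show "\<forall>\<^sub>F t in nhds (z c). F (z(c := t)) = G (z(c := t))"
    using eventually_fun_upd_mem[OF assms(1,2)] by eventually_elim (simp add: assms)
qed simp

lemma has_derivative_fun_upd_cong:
  assumes "((\<lambda>t. F (z(c := t))) has_real_derivative D) (at (z c))"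
    and "open U" "z \<in> U" "\<And>w. w \<in> U \<Longrightarrow> F w = G w"
  shows "((\<lambda>t. G (z(c := t))) has_real_derivative D) (at (z c))"
proof (rule iffD1[OF DERIV_cong_ev[OF refl _ refl] assms(1)])
  show "\<forall>\<^sub>F t in nhds (z c). F (z(c := t)) = G (z(c := t))"
    using eventually_fun_upd_mem[OF assms(2,3)] by eventually_elim (simp add: assms)
qed

lemma pd_eqI:
  assumes "((\<lambda>t. F (z(c := t))) has_real_derivative D) (at (z c))"
  shows "pd c F z = D"
  unfolding pd_def using assms by (rule DERIV_imp_deriv)

lemma smooth_on_continuous: "smooth_on U F \<Longrightarrow> continuous_on U F"
  unfolding smooth_on_def by (metis foldr_Nil id_apply)

lemma smooth_on_pd: "smooth_on U F \<Longrightarrow> smooth_on U (pd c F)"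
proof -
  assume F: "smooth_on U F"
  have "foldr pd cs (pd c F) = foldr pd (cs @ [c]) F" for cs by simp
  then show ?thesis using F unfolding smooth_on_def by metis
qed

lemma smooth_on_has_derivative:
  assumes "smooth_on U F" "z \<in> U"
  shows "((\<lambda>t. F (z(c := t))) has_real_derivative pd c F z) (at (z c))"
proof -
  have "(\<lambda>t. F (z(c := t))) differentiable at (z c)"
    using assms unfolding smooth_on_def by (metis foldr_Nil id_apply)
  then show ?thesis
    unfolding pd_def using DERIV_deriv_iff_real_differentiable by blast
qed

lemma smooth_on_step:
  assumes "smooth_on U F" "\<And>c. P (pd c F)"
  shows "continuous_on U F \<and>
    (\<forall>c. \<exists>G. P G \<and> (\<forall>z\<in>U. ((\<lambda>t. F (z(c := t))) has_real_derivative G z) (at (z c))))"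
proof (intro conjI allI)
  show "\<exists>G. P G \<and> (\<forall>z\<in>U. ((\<lambda>t. F (z(c := t))) has_real_derivative G z) (at (z c)))" for c
    by (rule exI[of _ "pd c F"]) (intro conjI ballI assms smooth_on_has_derivative[OF assms(1)])
qed (rule smooth_on_continuous[OF assms(1)])

text \<open>Since all iterated partial derivatives are constrained at once, it is enough to exhibit
  a class of continuous functions closed under a single partial derivative. Equality with a member
  of \<open>P\<close> is carried along on \<open>U\<close> only; openness of \<open>U\<close> makes
  that enough for the next derivative.\<close>

lemma smooth_on_coinduct:
  assumes "open U" "P F"
    and step: "\<And>F. P F \<Longrightarrow> continuous_on U F \<and>
      (\<forall>c. \<exists>G. P G \<and> (\<forall>z\<in>U. ((\<lambda>t. F (z(c := t))) has_real_derivative G z) (at (z c))))"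
  shows "smooth_on U F"
proof -
  have ex: "\<exists>G. P G \<and> (\<forall>z\<in>U. foldr pd cs F z = G z)" for cs
  proof (induction cs)
    case Nil
    then show ?case using assms(2) by auto
  next
    case (Cons c cs)
    then obtain G where G: "P G" "\<And>z. z \<in> U \<Longrightarrow> foldr pd cs F z = G z" by blast
    from step[OF G(1)] obtain H where H: "P H"
      "\<And>z. z \<in> U \<Longrightarrow> ((\<lambda>t. G (z(c := t))) has_real_derivative H z) (at (z c))" by blast
    have "foldr pd (c # cs) F z = H z" if "z \<in> U" for z
      using pd_cong[OF assms(1) that G(2)] pd_eqI[OF H(2)[OF that]] by simp
    with H(1) show ?case by blast
  qed
  show ?thesis
    unfolding smooth_on_def
  proof (intro allI conjI ballI)
    fix cs
    obtain G where G: "P G" "\<And>z. z \<in> U \<Longrightarrow> foldr pd cs F z = G z" using ex by blast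
    have "continuous_on U G" using step[OF G(1)] by blast
    then show "continuous_on U (foldr pd cs F)"
      using G(2) by (simp cong: continuous_on_cong)
    fix c z assume z: "z \<in> U"
    from step[OF G(1)] obtain H where
      "((\<lambda>t. G (z(c := t))) has_real_derivative H z) (at (z c))" using z by blast
    then have "((\<lambda>t. foldr pd cs F (z(c := t))) has_real_derivative H z) (at (z c))"
      by (rule has_derivative_fun_upd_cong[OF _ assms(1) z]) (simp add: G(2))
    then show "(\<lambda>t. foldr pd cs F (z(c := t))) differentiable at (z c)"
      using real_differentiable_def by blast
  qed
qed

text \<open>
  The coinduction predicate for closure properties of smoothness; the class \<open>B\<close> is varied to
  include compositions with a fixed map.
\<close>

inductive smooth_alg :: "('i \<Rightarrow> real) set \<Rightarrow> ((('i \<Rightarrow> real) \<Rightarrow> real) \<Rightarrow> bool) \<Rightarrow> (('i \<Rightarrow> real) \<Rightarrow> real) \<Rightarrow> bool" for U B where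
  base: "B F \<Longrightarrow> smooth_alg U B F"
| add: "smooth_alg U B F \<Longrightarrow> smooth_alg U B G \<Longrightarrow> smooth_alg U B (\<lambda>z. F z + G z)"
| mult: "smooth_alg U B F \<Longrightarrow> smooth_alg U B G \<Longrightarrow> smooth_alg U B (\<lambda>z. F z * G z)"
| minus: "smooth_alg U B F \<Longrightarrow> smooth_alg U B (\<lambda>z. - F z)"
| inverse: "smooth_alg U B F \<Longrightarrow> (\<And>z. z \<in> U \<Longrightarrow> F z \<noteq> 0) \<Longrightarrow> smooth_alg U B (\<lambda>z. inverse (F z))"

text \<open>Derivatives of products and reciprocals may leave the class of base functions, but not
  the algebra generated by it, so the algebra is a valid coinduction predicate. Accordingly the
  derivatives of base functions only have to lie in the algebra.\<close>

lemma smooth_alg_smooth: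
  assumes "open U" "smooth_alg U B F"
    and B: "\<And>F. B F \<Longrightarrow> continuous_on U F \<and>
      (\<forall>c. \<exists>G. smooth_alg U B G \<and> (\<forall>z\<in>U. ((\<lambda>t. F (z(c := t))) has_real_derivative G z) (at (z c))))"
  shows "smooth_on U F"
  using assms(1,2)
proof (rule smooth_on_coinduct[where P = "smooth_alg U B"])
  fix F assume "smooth_alg U B F"
  then show "continuous_on U F \<and>
      (\<forall>c. \<exists>G. smooth_alg U B G \<and> (\<forall>z\<in>U. ((\<lambda>t. F (z(c := t))) has_real_derivative G z) (at (z c))))"
  proof induction
    case (base F)
    then show ?case by (rule B)
  next
    case (add F G)
    show ?case
    proof (intro conjI allI)
      fix c
      obtain F' G' where F': "smooth_alg U B F'" "\<forall>z\<in>U. ((\<lambda>t. F (z(c := t))) has_real_derivative F' z) (at (z c))"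
        and G': "smooth_alg U B G'" "\<forall>z\<in>U. ((\<lambda>t. G (z(c := t))) has_real_derivative G' z) (at (z c))"
        using add.IH by blast
      show "\<exists>H. smooth_alg U B H \<and> (\<forall>z\<in>U. ((\<lambda>t. F (z(c := t)) + G (z(c := t))) has_real_derivative H z) (at (z c)))"
        using F' G' by (intro exI[of _ "\<lambda>z. F' z + G' z"]) (auto intro!: DERIV_add smooth_alg.add)
    qed (use add in \<open>auto intro: continuous_intros\<close>)
  next
    case (mult F G)
    show ?case
    proof (intro conjI allI)
      fix c
      obtain F' G' where F': "smooth_alg U B F'" "\<forall>z\<in>U. ((\<lambda>t. F (z(c := t))) has_real_derivative F' z) (at (z c))"
        and G': "smooth_alg U B G'" "\<forall>z\<in>U. ((\<lambda>t. G (z(c := t))) has_real_derivative G' z) (at (z c))"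
        using mult.IH by blast
      show "\<exists>H. smooth_alg U B H \<and> (\<forall>z\<in>U. ((\<lambda>t. F (z(c := t)) * G (z(c := t))) has_real_derivative H z) (at (z c)))"
      proof (intro exI[of _ "\<lambda>z. F' z * G z + G' z * F z"] conjI ballI)
        fix z assume "z \<in> U"
        with F'(2) G'(2) have "((\<lambda>t. F (z(c := t))) has_real_derivative F' z) (at (z c))"
          "((\<lambda>t. G (z(c := t))) has_real_derivative G' z) (at (z c))" by auto
        from DERIV_mult[OF this]
        show "((\<lambda>t. F (z(c := t)) * G (z(c := t))) has_real_derivative F' z * G z + G' z * F z) (at (z c))"
          by simp
      qed (use F' G' mult in \<open>auto intro!: smooth_alg.add smooth_alg.mult\<close>)
    qed (use mult in \<open>auto intro: continuous_intros\<close>)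
  next
    case (minus F)
    show ?case
    proof (intro conjI allI)
      fix c
      obtain F' where F': "smooth_alg U B F'" "\<forall>z\<in>U. ((\<lambda>t. F (z(c := t))) has_real_derivative F' z) (at (z c))"
        using minus.IH by blast
      show "\<exists>H. smooth_alg U B H \<and> (\<forall>z\<in>U. ((\<lambda>t. - F (z(c := t))) has_real_derivative H z) (at (z c)))"
        using F' by (intro exI[of _ "\<lambda>z. - F' z"]) (auto intro!: DERIV_minus smooth_alg.minus)
    qed (use minus in \<open>auto intro: continuous_intros\<close>)
  next
    case (inverse F)
    show ?case
    proof (intro conjI allI)
      fix c
      obtain F' where F': "smooth_alg U B F'" "\<forall>z\<in>U. ((\<lambda>t. F (z(c := t))) has_real_derivative F' z) (at (z c))"
        using inverse.IH by blast
      show "\<exists>H. smooth_alg U B H \<and> (\<forall>z\<in>U. ((\<lambda>t. inverse (F (z(c := t)))) has_real_derivative H z) (at (z c)))"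
      \<comment> \<open>Written as a product, so that the closure rules of \<open>smooth_alg\<close>
        apply.\<close>
      proof (intro exI[of _ "\<lambda>z. - (inverse (F z) * F' z * inverse (F z))"] conjI ballI)
        fix z assume z: "z \<in> U"
        then show "((\<lambda>t. inverse (F (z(c := t)))) has_real_derivative - (inverse (F z) * F' z * inverse (F z))) (at (z c))"
          using DERIV_inverse'[OF F'(2)[rule_format, OF z]] inverse.hyps(2)[OF z] by simp
      qed (use F' inverse in \<open>auto intro!: smooth_alg.minus smooth_alg.mult smooth_alg.inverse\<close>)
    qed (use inverse in \<open>auto intro: continuous_intros\<close>)
  qed
qed

lemma smooth_on_cong:
  assumes "open U" "\<And>z. z \<in> U \<Longrightarrow> F z = G z"
  shows "smooth_on U F \<longleftrightarrow> smooth_on U G"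
proof -
  have *: "smooth_on U G" if "smooth_on U F" "\<And>z. z \<in> U \<Longrightarrow> F z = G z" for F G
  proof (rule smooth_on_coinduct[where P = "\<lambda>G. \<exists>F. smooth_on U F \<and> (\<forall>z\<in>U. F z = G z)"])
    fix G assume "\<exists>F. smooth_on U F \<and> (\<forall>z\<in>U. F z = G z)"
    then obtain F where F: "smooth_on U F" "\<And>z. z \<in> U \<Longrightarrow> F z = G z" by blast
    have "((\<lambda>t. G (z(c := t))) has_real_derivative pd c F z) (at (z c))" if "z \<in> U" for c z
      by (rule has_derivative_fun_upd_cong[OF smooth_on_has_derivative[OF F(1) that] assms(1) that F(2)])
    moreover have "continuous_on U G"
      using smooth_on_continuous[OF F(1)] F(2) by (simp cong: continuous_on_cong)
    moreover note smooth_on_pd[OF F(1)]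
    ultimately show "continuous_on U G \<and> (\<forall>c. \<exists>H. (\<exists>F. smooth_on U F \<and> (\<forall>z\<in>U. F z = H z)) \<and>
       (\<forall>z\<in>U. ((\<lambda>t. G (z(c := t))) has_real_derivative H z) (at (z c))))"
      by (intro conjI allI exI[of _ "pd _ F"]) auto
  qed (use that assms in auto)
  show ?thesis using *[of F G] *[of G F] assms by auto
qed

lemma smooth_on_subset: "smooth_on U F \<Longrightarrow> V \<subseteq> U \<Longrightarrow> smooth_on V F"
  unfolding smooth_on_def using continuous_on_subset by blast

lemma smooth_on_const: "open U \<Longrightarrow> smooth_on U (\<lambda>_. a)"
proof (rule smooth_on_coinduct[where P = "\<lambda>F. \<exists>a. F = (\<lambda>_. a)"])
  fix F :: "('a \<Rightarrow> real) \<Rightarrow> real" assume "\<exists>a. F = (\<lambda>_. a)"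
  then show "continuous_on U F \<and> (\<forall>c. \<exists>G. (\<exists>a. G = (\<lambda>_. a)) \<and>
      (\<forall>z\<in>U. ((\<lambda>t. F (z(c := t))) has_real_derivative G z) (at (z c))))"
    by (auto intro!: exI[of _ "\<lambda>_. 0"])
qed auto

lemma smooth_on_coord: "open U \<Longrightarrow> smooth_on U (\<lambda>z. z c)"
\<comment> \<open>The disjunct \<open>smooth_on U F\<close> absorbs the derivatives of a coordinate,
  which are constants.\<close>
proof (rule smooth_on_coinduct[where P = "\<lambda>F. smooth_on U F \<or> F = (\<lambda>z. z c)"])
  fix F :: "('a \<Rightarrow> real) \<Rightarrow> real" assume "open U" and F: "smooth_on U F \<or> F = (\<lambda>z. z c)"
  have "((\<lambda>t. (z(d := t)) c) has_real_derivative (if c = d then 1 else 0)) (at (z d))" for d and z :: "'a \<Rightarrow> real"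
    by (cases "c = d") simp_all
  then have "\<exists>G. smooth_on U G \<and> (\<forall>z\<in>U. ((\<lambda>t. (z(d := t)) c) has_real_derivative G z) (at (z d)))" for d
    using smooth_on_const[OF \<open>open U\<close>] by blast
  moreover have "continuous_on U (\<lambda>z. z c)"
    by (rule continuous_on_subset[OF continuous_on_product_coordinates subset_UNIV])
  ultimately show "continuous_on U F \<and> (\<forall>d. \<exists>G. (smooth_on U G \<or> G = (\<lambda>z. z c)) \<and>
      (\<forall>z\<in>U. ((\<lambda>t. F (z(d := t))) has_real_derivative G z) (at (z d))))"
    using F
  proof (elim disjE)
    assume "smooth_on U F"
    then show ?thesis by (rule smooth_on_step[of U F "\<lambda>G. smooth_on U G \<or> G = (\<lambda>z. z c)"]) (simp add: smooth_on_pd \<open>smooth_on U F\<close>)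
  qed blast
qed auto

lemma smooth_alg_smooth_on:
  assumes "open U" "smooth_alg U (smooth_on U) F"
  shows "smooth_on U F"
  using assms
proof (rule smooth_alg_smooth)
  fix F assume F: "smooth_on U F"
  show "continuous_on U F \<and> (\<forall>c. \<exists>G. smooth_alg U (smooth_on U) G \<and>
      (\<forall>z\<in>U. ((\<lambda>t. F (z(c := t))) has_real_derivative G z) (at (z c))))"
    by (rule smooth_on_step[OF F, of "smooth_alg U (smooth_on U)"]) (intro smooth_alg.base smooth_on_pd F)
qed

lemma smooth_on_add: "open U \<Longrightarrow> smooth_on U F \<Longrightarrow> smooth_on U G \<Longrightarrow> smooth_on U (\<lambda>z. F z + G z)"
  and smooth_on_mult: "open U \<Longrightarrow> smooth_on U F \<Longrightarrow> smooth_on U G \<Longrightarrow> smooth_on U (\<lambda>z. F z * G z)"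
  and smooth_on_minus: "open U \<Longrightarrow> smooth_on U F \<Longrightarrow> smooth_on U (\<lambda>z. - F z)"
  and smooth_on_inverse: "open U \<Longrightarrow> smooth_on U F \<Longrightarrow> (\<And>z. z \<in> U \<Longrightarrow> F z \<noteq> 0) \<Longrightarrow> smooth_on U (\<lambda>z. inverse (F z))"
     apply (erule smooth_alg_smooth_on, rule smooth_alg.add; erule smooth_alg.base)
    apply (erule smooth_alg_smooth_on, rule smooth_alg.mult; erule smooth_alg.base)
   apply (erule smooth_alg_smooth_on, rule smooth_alg.minus, erule smooth_alg.base)
  apply (erule smooth_alg_smooth_on, rule smooth_alg.inverse, erule smooth_alg.base, blast)
  done

text \<open>Stated with absolute values so that \<open>b < a\<close> and \<open>a = b\<close> are allowed.\<close>

lemma mean_value_abs: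
  fixes f :: "real \<Rightarrow> real"
  assumes "\<And>x. \<bar>x - a\<bar> \<le> \<bar>b - a\<bar> \<Longrightarrow> (f has_real_derivative f' x) (at x)"
  obtains x where "\<bar>x - a\<bar> \<le> \<bar>b - a\<bar>" "f b - f a = (b - a) * f' x"
proof (cases a b rule: linorder_cases)
  case less
  with MVT2[of a b f f'] assms obtain x where "a < x" "x < b" "f b - f a = (b - a) * f' x" by auto
  then show thesis by (intro that[of x]) auto
next
  case greater
  with MVT2[of b a f f'] assms obtain x where x: "b < x" "x < a" "f a - f b = (a - b) * f' x" by auto
  then have "f b - f a = (b - a) * f' x" by algebra
  with x show thesis by (intro that[of x]) auto
qed (use that[of a] in auto)

text \<open>Mean value theorem twice: in direction \<open>c\<close> for the difference between the
  two ends in direction \<open>d\<close>, then in direction \<open>d\<close> for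
  \<open>pd c F\<close>. The whole square has to lie in \<open>U\<close>.\<close>

lemma mixed_difference:
  assumes F: "smooth_on U F" and "c \<noteq> d"
    and box: "\<And>s t. \<bar>s - z c\<bar> \<le> \<bar>h\<bar> \<Longrightarrow> \<bar>t - z d\<bar> \<le> \<bar>h\<bar> \<Longrightarrow> z(c := s, d := t) \<in> U"
  obtains s t where "\<bar>s - z c\<bar> \<le> \<bar>h\<bar>" "\<bar>t - z d\<bar> \<le> \<bar>h\<bar>"
    "F (z(c := z c + h, d := z d + h)) - F (z(c := z c + h, d := z d)) -
     (F (z(c := z c, d := z d + h)) - F (z(c := z c, d := z d))) =
     h * (h * pd d (pd c F) (z(c := s, d := t)))"
proof -
  have D: "((\<lambda>s. F (z(c := s, d := t))) has_real_derivative pd c F (z(c := s, d := t))) (at s)"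
    if "\<bar>s - z c\<bar> \<le> \<bar>h\<bar>" "\<bar>t - z d\<bar> \<le> \<bar>h\<bar>" for s t
    using smooth_on_has_derivative[OF F box[OF that], of c] \<open>c \<noteq> d\<close>
    by (simp add: fun_upd_twist[of d c])
  obtain s where s: "\<bar>s - z c\<bar> \<le> \<bar>h\<bar>"
    "F (z(c := z c + h, d := z d + h)) - F (z(c := z c + h, d := z d)) -
     (F (z(c := z c, d := z d + h)) - F (z(c := z c, d := z d)))
     = h * (pd c F (z(c := s, d := z d + h)) - pd c F (z(c := s, d := z d)))"
  proof (rule mean_value_abs[of "z c" "z c + h" "\<lambda>s. F (z(c := s, d := z d + h)) - F (z(c := s, d := z d))"
        "\<lambda>s. pd c F (z(c := s, d := z d + h)) - pd c F (z(c := s, d := z d))"])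
    fix s assume "\<bar>s - z c\<bar> \<le> \<bar>z c + h - z c\<bar>"
    then show "((\<lambda>s. F (z(c := s, d := z d + h)) - F (z(c := s, d := z d))) has_real_derivative
        pd c F (z(c := s, d := z d + h)) - pd c F (z(c := s, d := z d))) (at s)"
      by (intro DERIV_diff D) auto
  qed auto
  have "((\<lambda>t. pd c F (z(c := s, d := t))) has_real_derivative pd d (pd c F) (z(c := s, d := t))) (at t)"
    if "\<bar>t - z d\<bar> \<le> \<bar>h\<bar>" for t
    using smooth_on_has_derivative[OF smooth_on_pd[OF F] box[OF s(1) that], of c d] by simp
  then obtain t where "\<bar>t - z d\<bar> \<le> \<bar>h\<bar>"
    "pd c F (z(c := s, d := z d + h)) - pd c F (z(c := s, d := z d)) = h * pd d (pd c F) (z(c := s, d := t))"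
    using mean_value_abs[of "z d" "z d + h" "\<lambda>t. pd c F (z(c := s, d := t))"
        "\<lambda>t. pd d (pd c F) (z(c := s, d := t))"] by auto
  with s that show thesis by metis
qed

text \<open>The second difference over a square of side \<open>h\<close> is symmetric in the two
  directions and equals \<open>h^2\<close> times either mixed derivative at some point of the
  square. Divide, and let \<open>h\<close> tend to 0 using continuity of both mixed
  derivatives.\<close>

lemma pd_commute:
  assumes "open U" "smooth_on U F" "z \<in> U"
  shows "pd c (pd d F) z = pd d (pd c F) z"
proof (cases "c = d")
  case False
  obtain K e where K: "e > 0" "\<And>w. (\<And>i. i \<in> K \<Longrightarrow> \<bar>w i - z i\<bar> < e) \<Longrightarrow> w \<in> U"
    using open_contains_box[OF assms(1,3)] by metis
  have box: "z(c := s, d := t) \<in> U" if "\<bar>s - z c\<bar> \<le> \<bar>h\<bar>" "\<bar>t - z d\<bar> \<le> \<bar>h\<bar>" "\<bar>h\<bar> < e" for s t h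
    using that K(1) by (intro K(2)) auto
  have "\<exists>s t s' t'. \<bar>s - z c\<bar> \<le> \<bar>h\<bar> \<and> \<bar>t - z d\<bar> \<le> \<bar>h\<bar> \<and> \<bar>s' - z c\<bar> \<le> \<bar>h\<bar> \<and> \<bar>t' - z d\<bar> \<le> \<bar>h\<bar> \<and>
      pd d (pd c F) (z(c := s, d := t)) = pd c (pd d F) (z(c := s', d := t'))"
    if h: "0 < \<bar>h\<bar>" "\<bar>h\<bar> < e" for h
  proof -
    obtain s t where 1: "\<bar>s - z c\<bar> \<le> \<bar>h\<bar>" "\<bar>t - z d\<bar> \<le> \<bar>h\<bar>"
      "F (z(c := z c + h, d := z d + h)) - F (z(c := z c + h, d := z d)) -
       (F (z(c := z c, d := z d + h)) - F (z(c := z c, d := z d))) =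
       h * (h * pd d (pd c F) (z(c := s, d := t)))"
      using mixed_difference[OF assms(2) False, of z h] box h by blast
    obtain t' s' where 2: "\<bar>t' - z d\<bar> \<le> \<bar>h\<bar>" "\<bar>s' - z c\<bar> \<le> \<bar>h\<bar>"
      "F (z(d := z d + h, c := z c + h)) - F (z(d := z d + h, c := z c)) -
       (F (z(d := z d, c := z c + h)) - F (z(d := z d, c := z c))) =
       h * (h * pd c (pd d F) (z(d := t', c := s')))"
      using mixed_difference[OF assms(2) False[symmetric], of z h]
        box[THEN back_subst[of "\<lambda>w. w \<in> U", OF _ fun_upd_twist[OF False, of z]]] h by blast
    have "h * (h * pd d (pd c F) (z(c := s, d := t))) = h * (h * pd c (pd d F) (z(c := s', d := t')))"
      using 1(3) 2(3)[unfolded fun_upd_twist[OF False[symmetric], of z]] by linarith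
    then have "pd d (pd c F) (z(c := s, d := t)) = pd c (pd d F) (z(c := s', d := t'))"
      using h by simp
    with 1 2 show ?thesis by blast
  qed
  then obtain s t s' t' where st: "\<And>h. 0 < \<bar>h\<bar> \<Longrightarrow> \<bar>h\<bar> < e \<Longrightarrow>
      \<bar>s h - z c\<bar> \<le> \<bar>h\<bar> \<and> \<bar>t h - z d\<bar> \<le> \<bar>h\<bar> \<and> \<bar>s' h - z c\<bar> \<le> \<bar>h\<bar> \<and> \<bar>t' h - z d\<bar> \<le> \<bar>h\<bar> \<and>
      pd d (pd c F) (z(c := s h, d := t h)) = pd c (pd d F) (z(c := s' h, d := t' h))"
    by metis
  have near: "\<forall>\<^sub>F h::real in at 0. 0 < \<bar>h\<bar> \<and> \<bar>h\<bar> < e"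
    using K(1) eventually_at[of _ "0::real" UNIV] by (auto simp: dist_real_def)
  have squeeze: "(u \<longlongrightarrow> a) (at 0)" if "\<And>h. 0 < \<bar>h\<bar> \<Longrightarrow> \<bar>h\<bar> < e \<Longrightarrow> \<bar>u h - a\<bar> \<le> \<bar>h\<bar>" for u :: "real \<Rightarrow> real" and a
  proof (rule LIM_zero_cancel, rule Lim_null_comparison)
    show "\<forall>\<^sub>F h in at 0. norm (u h - a) \<le> \<bar>h\<bar>"
      using near by eventually_elim (use that in auto)
  qed (auto intro!: tendsto_eq_intros)
  have lim: "((\<lambda>h. H (z(c := u h, d := v h))) \<longlongrightarrow> H z) (at 0)"
    if "continuous_on U H" "(u \<longlongrightarrow> z c) (at 0)" "(v \<longlongrightarrow> z d) (at 0)" for H :: "('a \<Rightarrow> real) \<Rightarrow> real" and u v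
  proof -
    have "((\<lambda>h. z(c := u h, d := v h)) \<longlongrightarrow> z) (at 0)"
    proof (rule tendsto_coordinatewise)
      show "((\<lambda>h. (z(c := u h, d := v h)) i) \<longlongrightarrow> z i) (at 0)" for i
        using that False by (cases "i = d"; cases "i = c") auto
    qed
    then show ?thesis
      by (rule continuous_on_open_tendsto_compose[OF assms(1) that(1)]) (fact assms)
  qed
  have lim'': "((\<lambda>h. pd d (pd c F) (z(c := s h, d := t h))) \<longlongrightarrow> pd d (pd c F) z) (at 0)"
    using st by (intro lim smooth_on_continuous smooth_on_pd assms squeeze) blast+
  have lim': "((\<lambda>h. pd c (pd d F) (z(c := s' h, d := t' h))) \<longlongrightarrow> pd c (pd d F) z) (at 0)"
    using st by (intro lim smooth_on_continuous smooth_on_pd assms squeeze) blast+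
  have "\<forall>\<^sub>F h in at 0. pd d (pd c F) (z(c := s h, d := t h)) = pd c (pd d F) (z(c := s' h, d := t' h))"
    using near by eventually_elim (use st in blast)
  with lim'' have "((\<lambda>h. pd c (pd d F) (z(c := s' h, d := t' h))) \<longlongrightarrow> pd d (pd c F) z) (at 0)"
    by (rule Lim_transform_eventually)
  then show ?thesis by (rule LIM_unique[OF lim'])
qed simp

text \<open>Continuous partial derivatives suffice, without a total differential: the coordinates in
  \<open>C\<close> are moved one at a time, and each move is governed by a mean value of one partial
  derivative, taken at a point that tends to \<open>\<gamma> t\<^sub>0\<close>.\<close>

lemma chain_rule_curve:
  fixes \<gamma> :: "real \<Rightarrow> 'i \<Rightarrow> real"
  assumes F: "local_function C U F" and "finite C" and z0: "\<gamma> t\<^sub>0 \<in> U"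
    and \<gamma>: "\<And>c. c \<in> C \<Longrightarrow> ((\<lambda>t. \<gamma> t c) has_real_derivative v c) (at t\<^sub>0)"
  shows "((\<lambda>t. F (\<gamma> t)) has_real_derivative (\<Sum>c\<in>C. pd c F (\<gamma> t\<^sub>0) * v c)) (at t\<^sub>0)"
proof -
  have U: "open U" "smooth_on U F" using F by (auto simp: local_function_def)
  \<comment> \<open>\<open>\<zeta> A\<close> moves only the coordinates in \<open>A\<close>.
    Freezing the others is essential, because outside \<open>C\<close> the curve need not even be
    continuous.\<close>
  define \<zeta> where "\<zeta> A t = (\<lambda>i. if i \<in> A then \<gamma> t i else \<gamma> t\<^sub>0 i)" for A t
  have \<gamma>_lim: "((\<lambda>t. \<gamma> t c) \<longlongrightarrow> \<gamma> t\<^sub>0 c) (at t\<^sub>0)" if "c \<in> C" for c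
    using DERIV_isCont[OF \<gamma>[OF that]] by (simp add: isCont_def)
  have part: "((\<lambda>t. F (\<zeta> A t)) has_real_derivative (\<Sum>c\<in>A. pd c F (\<gamma> t\<^sub>0) * v c)) (at t\<^sub>0)"
    if "A \<subseteq> C" for A
    using finite_subset[OF that \<open>finite C\<close>] that
  proof (induction A rule: finite_induct)
    case empty
    then show ?case by (simp add: \<zeta>_def)
  next
    case (insert c A)
    have c: "c \<in> C" "c \<notin> A" using insert by auto
    let ?a = "\<gamma> t\<^sub>0 c"
    have upd: "\<zeta> (insert c A) t = (\<zeta> A t)(c := \<gamma> t c)" "\<zeta> A t = (\<zeta> A t)(c := ?a)" for t
      using c by (auto simp: \<zeta>_def)
    have lim0: "((\<lambda>t. (\<zeta> A t)(c := u t)) \<longlongrightarrow> \<gamma> t\<^sub>0) (at t\<^sub>0)" if "(u \<longlongrightarrow> ?a) (at t\<^sub>0)" for u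
    proof (rule tendsto_coordinatewise)
      fix i show "((\<lambda>t. ((\<zeta> A t)(c := u t)) i) \<longlongrightarrow> \<gamma> t\<^sub>0 i) (at t\<^sub>0)"
        using that \<gamma>_lim[of i] insert.prems by (cases "i = c"; cases "i \<in> A") (auto simp: \<zeta>_def)
    qed
    obtain K e where K: "finite K" "e > 0" "\<And>w. (\<And>i. i \<in> K \<Longrightarrow> \<bar>w i - \<gamma> t\<^sub>0 i\<bar> < e) \<Longrightarrow> w \<in> U"
      using open_contains_box[OF U(1) z0] by metis
    define N where "N t \<longleftrightarrow> (\<forall>i\<in>C. \<bar>\<gamma> t i - \<gamma> t\<^sub>0 i\<bar> < e)" for t
    have N: "\<forall>\<^sub>F t in at t\<^sub>0. N t"
      unfolding N_def using \<gamma>_lim K(2) \<open>finite C\<close>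
      by (intro eventually_ball_finite) (auto simp: dist_real_def[symmetric] intro!: tendstoD)
    have "\<exists>s. \<bar>s - ?a\<bar> \<le> \<bar>\<gamma> t c - ?a\<bar> \<and>
        F (\<zeta> (insert c A) t) - F (\<zeta> A t) = (\<gamma> t c - ?a) * pd c F ((\<zeta> A t)(c := s))" if "N t" for t
    proof -
      have "((\<lambda>s. F ((\<zeta> A t)(c := s))) has_real_derivative pd c F ((\<zeta> A t)(c := s))) (at s)"
        if s: "\<bar>s - ?a\<bar> \<le> \<bar>\<gamma> t c - ?a\<bar>" for s
      proof -
        have *: "\<bar>s - ?a\<bar> < e" using s \<open>N t\<close> c by (auto simp: N_def)
        have "(\<zeta> A t)(c := s) \<in> U"
          using \<open>N t\<close> insert.prems K(2) * by (intro K(3)) (auto simp: \<zeta>_def N_def)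
        from smooth_on_has_derivative[OF U(2) this, of c] show ?thesis by simp
      qed
      then obtain s where "\<bar>s - ?a\<bar> \<le> \<bar>\<gamma> t c - ?a\<bar>"
        "F ((\<zeta> A t)(c := \<gamma> t c)) - F ((\<zeta> A t)(c := ?a)) = (\<gamma> t c - ?a) * pd c F ((\<zeta> A t)(c := s))"
        using mean_value_abs[of ?a "\<gamma> t c" "\<lambda>s. F ((\<zeta> A t)(c := s))" "\<lambda>s. pd c F ((\<zeta> A t)(c := s))"] by blast
      then show ?thesis using upd by metis
    qed
    then obtain s where s: "\<And>t. N t \<Longrightarrow> \<bar>s t - ?a\<bar> \<le> \<bar>\<gamma> t c - ?a\<bar> \<and>
        F (\<zeta> (insert c A) t) - F (\<zeta> A t) = (\<gamma> t c - ?a) * pd c F ((\<zeta> A t)(c := s t))"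
      by metis
    have "(s \<longlongrightarrow> ?a) (at t\<^sub>0)"
    proof (rule LIM_zero_cancel, rule Lim_null_comparison)
      show "\<forall>\<^sub>F t in at t\<^sub>0. norm (s t - ?a) \<le> \<bar>\<gamma> t c - ?a\<bar>"
        using N by eventually_elim (use s in auto)
      show "((\<lambda>t. \<bar>\<gamma> t c - ?a\<bar>) \<longlongrightarrow> 0) (at t\<^sub>0)"
        using \<gamma>_lim[OF c(1)] LIM_zero tendsto_rabs_zero by blast
    qed
    then have "((\<lambda>t. pd c F ((\<zeta> A t)(c := s t))) \<longlongrightarrow> pd c F (\<gamma> t\<^sub>0)) (at t\<^sub>0)"
      by (rule continuous_on_open_tendsto_compose[OF U(1) smooth_on_continuous[OF smooth_on_pd[OF U(2)]] lim0 z0])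
    then have lim: "((\<lambda>t. (\<gamma> t c - ?a) / (t - t\<^sub>0) * pd c F ((\<zeta> A t)(c := s t))) \<longlongrightarrow> v c * pd c F (\<gamma> t\<^sub>0)) (at t\<^sub>0)"
      using \<gamma>[OF c(1)] by (intro tendsto_mult) (simp_all add: has_field_derivative_iff)
    have "((\<lambda>t. F (\<zeta> (insert c A) t) - F (\<zeta> A t)) has_real_derivative v c * pd c F (\<gamma> t\<^sub>0)) (at t\<^sub>0)"
      unfolding has_field_derivative_iff
    proof (rule Lim_transform_eventually[OF lim])
      show "\<forall>\<^sub>F t in at t\<^sub>0. (\<gamma> t c - ?a) / (t - t\<^sub>0) * pd c F ((\<zeta> A t)(c := s t)) =
          (F (\<zeta> (insert c A) t) - F (\<zeta> A t) - (F (\<zeta> (insert c A) t\<^sub>0) - F (\<zeta> A t\<^sub>0))) / (t - t\<^sub>0)"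
        using N
      proof eventually_elim
        case (elim t)
        have "\<zeta> (insert c A) t\<^sub>0 = \<zeta> A t\<^sub>0" by (auto simp: \<zeta>_def)
        then show ?case using s[OF elim] by simp
      qed
    qed
    from DERIV_add[OF this insert.IH] insert.prems insert.hyps show ?case
      by (simp add: mult.commute)
  qed
  have "((\<lambda>t. \<zeta> C t) \<longlongrightarrow> \<gamma> t\<^sub>0) (at t\<^sub>0)"
  proof (rule tendsto_coordinatewise)
    show "((\<lambda>t. \<zeta> C t i) \<longlongrightarrow> \<gamma> t\<^sub>0 i) (at t\<^sub>0)" for i
      using \<gamma>_lim[of i] by (cases "i \<in> C") (auto simp: \<zeta>_def)
  qed
  then have "\<forall>\<^sub>F t in at t\<^sub>0. \<zeta> C t \<in> U"
    using U(1) z0 topological_tendstoD by fastforce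
  moreover have "\<zeta> C t\<^sub>0 = \<gamma> t\<^sub>0" by (simp add: \<zeta>_def)
  ultimately have "\<forall>\<^sub>F t in nhds t\<^sub>0. \<zeta> C t \<in> U"
    using z0 by (simp add: eventually_nhds_conv_at)
  then have "\<forall>\<^sub>F t in nhds t\<^sub>0. F (\<zeta> C t) = F (\<gamma> t)"
  proof eventually_elim
    case (elim t)
    have "\<forall>c\<in>C. \<gamma> t c = \<zeta> C t c" by (simp add: \<zeta>_def)
    with F elim show ?case unfolding local_function_def by metis
  qed
  then show ?thesis
    by (rule iffD1[OF DERIV_cong_ev[OF refl _ refl] part[OF order_refl]])
qed

section \<open>Functions of finitely many coordinates\<close>

definition cylinder :: "'i set \<Rightarrow> ('i \<Rightarrow> real) set \<Rightarrow> bool" where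
  "cylinder C U \<longleftrightarrow> open U \<and> (\<forall>z\<in>U. \<forall>z'. (\<forall>c\<in>C. z' c = z c) \<longrightarrow> z' \<in> U)"

lemma local_function_iff:
  "local_function C U F \<longleftrightarrow> cylinder C U \<and> smooth_on U F \<and>
     (\<forall>z\<in>U. \<forall>z'. (\<forall>c\<in>C. z' c = z c) \<longrightarrow> F z' = F z)"
  unfolding local_function_def cylinder_def by blast

lemma cylinder_open: "cylinder C U \<Longrightarrow> open U"
  by (simp add: cylinder_def)

lemma cylinder_UNIV [simp]: "cylinder C UNIV"
  by (simp add: cylinder_def)

lemma cylinder_Int: "cylinder C U \<Longrightarrow> cylinder C V \<Longrightarrow> cylinder C (U \<inter> V)"
  unfolding cylinder_def by (metis Int_iff open_Int)

lemma cylinder_mono: "cylinder C U \<Longrightarrow> C \<subseteq> C' \<Longrightarrow> cylinder C' U"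
  unfolding cylinder_def by (meson subsetD)

lemma local_function_cylinder: "local_function C U F \<Longrightarrow> cylinder C U"
  and local_function_smooth: "local_function C U F \<Longrightarrow> smooth_on U F"
  and local_function_open: "local_function C U F \<Longrightarrow> open U"
  by (simp_all add: local_function_iff cylinder_def)

lemma local_function_agree:
  "local_function C U F \<Longrightarrow> z \<in> U \<Longrightarrow> (\<And>c. c \<in> C \<Longrightarrow> z' c = z c) \<Longrightarrow> F z' = F z"
  unfolding local_function_def by blast

lemma local_function_mono: "local_function C U F \<Longrightarrow> C \<subseteq> C' \<Longrightarrow> local_function C' U F"
  unfolding local_function_def by (meson subsetD)

lemma local_function_restrict:
  "local_function C U F \<Longrightarrow> cylinder C V \<Longrightarrow> V \<subseteq> U \<Longrightarrow> local_function C V F"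
  unfolding local_function_iff by (meson smooth_on_subset subsetD)

lemma local_function_cong:
  assumes "local_function C U F" "\<And>z. z \<in> U \<Longrightarrow> F z = G z"
  shows "local_function C U G"
proof -
  have "smooth_on U G"
    using assms smooth_on_cong[of U F G] by (auto simp: local_function_iff cylinder_def)
  moreover have "G z' = G z" if z: "z \<in> U" "\<forall>c\<in>C. z' c = z c" for z z'
  proof -
    from assms(1) z have "z' \<in> U" "F z' = F z" unfolding local_function_def by blast+
    with assms(2) z(1) show ?thesis by metis
  qed
  ultimately show ?thesis
    using local_function_cylinder[OF assms(1)] unfolding local_function_iff by blast
qed

lemma local_functionI:
  assumes "cylinder C U" "smooth_on U F"
    and "\<And>z z'. z \<in> U \<Longrightarrow> (\<And>c. c \<in> C \<Longrightarrow> z' c = z c) \<Longrightarrow> F z' = F z"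
  shows "local_function C U F"
  using assms unfolding local_function_iff by blast

lemma local_function_const:
  assumes "cylinder C U" shows "local_function C U (\<lambda>_. a)"
  using assms by (intro local_functionI smooth_on_const) (auto intro: cylinder_open)

lemma local_function_coord:
  assumes "cylinder C U" "c \<in> C" shows "local_function C U (\<lambda>z. z c)"
  using assms by (intro local_functionI smooth_on_coord) (auto intro: cylinder_open)

lemma local_function_combine:
  assumes F: "local_function C U F" and G: "local_function C U G" and "smooth_on U (\<lambda>z. h (F z) (G z))"
  shows "local_function C U (\<lambda>z. h (F z) (G z))"
proof (rule local_functionI[OF local_function_cylinder[OF F] assms(3)])
  fix z z' assume z: "z \<in> U" "\<And>c. c \<in> C \<Longrightarrow> z' c = z c"
  show "h (F z') (G z') = h (F z) (G z)"
    by (simp only: local_function_agree[OF F z] local_function_agree[OF G z])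
qed

lemma local_function_add:
  "local_function C U F \<Longrightarrow> local_function C U G \<Longrightarrow> local_function C U (\<lambda>z. F z + G z)"
  by (rule local_function_combine[where h = "(+)"])
    (simp_all add: smooth_on_add local_function_smooth local_function_open)

lemma local_function_mult:
  "local_function C U F \<Longrightarrow> local_function C U G \<Longrightarrow> local_function C U (\<lambda>z. F z * G z)"
  by (rule local_function_combine[where h = "(*)"])
    (simp_all add: smooth_on_mult local_function_smooth local_function_open)

lemma local_function_minus:
  "local_function C U F \<Longrightarrow> local_function C U (\<lambda>z. - F z)"
  by (rule local_function_combine[where h = "\<lambda>a b. - a" and G = F])
    (simp_all add: smooth_on_minus local_function_smooth local_function_open)

lemma local_function_inverse:
  "local_function C U F \<Longrightarrow> (\<And>z. z \<in> U \<Longrightarrow> F z \<noteq> 0) \<Longrightarrow> local_function C U (\<lambda>z. inverse (F z))"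
  by (rule local_function_combine[where h = "\<lambda>a b. inverse a" and G = F])
    (simp_all add: smooth_on_inverse local_function_smooth local_function_open)

lemma local_function_diff:
  "local_function C U F \<Longrightarrow> local_function C U G \<Longrightarrow> local_function C U (\<lambda>z. F z - G z)"
  using local_function_add[OF _ local_function_minus] by fastforce

lemma local_function_divide:
  "local_function C U F \<Longrightarrow> local_function C U G \<Longrightarrow> (\<And>z. z \<in> U \<Longrightarrow> G z \<noteq> 0) \<Longrightarrow>
    local_function C U (\<lambda>z. F z / G z)"
  unfolding divide_inverse by (intro local_function_mult local_function_inverse)

lemma local_function_power: "local_function C U F \<Longrightarrow> local_function C U (\<lambda>z. F z ^ n)"
  by (induction n) (auto intro: local_function_const local_function_mult local_function_cylinder)

lemma local_function_sum:
  assumes "cylinder C U" "\<And>a. a \<in> A \<Longrightarrow> local_function C U (F a)"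
  shows "local_function C U (\<lambda>z. \<Sum>a\<in>A. F a z)"
  using assms(2)
  by (induction A rule: infinite_finite_induct)
    (auto intro: local_function_const assms(1) local_function_add)

lemma local_function_pd_eq_0:
  assumes "local_function C U F" "z \<in> U" "c \<notin> C"
  shows "pd c F z = 0"
proof -
  have "F (z(c := t)) = F z" for t
    using assms by (intro local_function_agree[OF assms(1)]) auto
  then show ?thesis by (simp add: pd_def)
qed

lemma local_function_pd:
  assumes F: "local_function C U F"
  shows "local_function C U (pd c F)"
proof -
  have *: "pd c F z' = pd c F z" if z: "z \<in> U" "\<forall>i\<in>C. z' i = z i" for z z'
  proof (cases "c \<in> C")
    case True
    have "\<forall>\<^sub>F t in nhds (z' c). F (z'(c := t)) = F (z(c := t))"
      using eventually_fun_upd_mem[OF local_function_open[OF F] z(1), of c]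
      unfolding z(2)[rule_format, OF True]
    proof eventually_elim
      case (elim t)
      then show ?case
        by (rule local_function_agree[OF F]) (use z in auto)
    qed
    then show ?thesis
      unfolding pd_def by (rule deriv_cong_ev) (use True z in blast)
  next
    case False
    moreover have "z' \<in> U" using F z by (auto simp: local_function_def)
    ultimately show ?thesis
      using local_function_pd_eq_0[OF F] z(1) by metis
  qed
  show ?thesis
  proof (rule local_functionI)
    show "pd c F z' = pd c F z" if "z \<in> U" "\<And>i. i \<in> C \<Longrightarrow> z' i = z i" for z z'
      using that by (intro *) blast+
  qed (rule local_function_cylinder[OF F], rule smooth_on_pd[OF local_function_smooth[OF F]])
qed

section \<open>Composition with smooth maps\<close>

lemma comp_has_derivative:
  assumes F: "local_function C U F" "finite C"
    and G: "\<And>c. c \<in> C \<Longrightarrow> smooth_on V (\<lambda>w. G w c)" "\<And>w. w \<in> V \<Longrightarrow> G w \<in> U"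
    and w: "w \<in> V"
  shows "((\<lambda>t. F (G (w(j := t)))) has_real_derivative
    (\<Sum>c\<in>C. pd c F (G w) * pd j (\<lambda>w. G w c) w)) (at (w j))"
proof -
  have "((\<lambda>t. F (G (w(j := t)))) has_real_derivative
    (\<Sum>c\<in>C. pd c F (G (w(j := w j))) * pd j (\<lambda>w. G w c) w)) (at (w j))"
  proof (rule chain_rule_curve[OF F])
    show "((\<lambda>t. G (w(j := t)) c) has_real_derivative pd j (\<lambda>w. G w c) w) (at (w j))" if "c \<in> C" for c
      by (rule smooth_on_has_derivative[OF G(1)[OF that] w])
  qed (simp add: G w)
  then show ?thesis by simp
qed

lemma pd_comp:
  assumes "local_function C U F" "finite C"
    and "\<And>c. c \<in> C \<Longrightarrow> smooth_on V (\<lambda>w. G w c)" "\<And>w. w \<in> V \<Longrightarrow> G w \<in> U" "w \<in> V"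
  shows "pd j (\<lambda>w. F (G w)) w = (\<Sum>c\<in>C. pd c F (G w) * pd j (\<lambda>w. G w c) w)"
  by (rule pd_eqI, rule comp_has_derivative) (use assms in auto)

text \<open>By the chain rule a derivative of \<open>F\<close> composed with \<open>G\<close> is a
  sum of products of \<open>pd c F\<close> composed with \<open>G\<close> and derivatives of
  \<open>G\<close>. The base class therefore has to contain the compositions of all local functions
  with the same \<open>G\<close>, together with the smooth functions on \<open>V\<close>.\<close>

lemma smooth_on_comp:
  assumes F: "local_function C U F" "finite C" and "open V"
    and G: "\<And>c. c \<in> C \<Longrightarrow> smooth_on V (\<lambda>w. G w c)" "\<And>w. w \<in> V \<Longrightarrow> G w \<in> U"
  shows "smooth_on V (\<lambda>w. F (G w))"
proof -
  define B where "B H \<longleftrightarrow> smooth_on V H \<or> (\<exists>F. local_function C U F \<and> H = (\<lambda>w. F (G w)))" for H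
  show ?thesis
  proof (rule smooth_alg_smooth[OF \<open>open V\<close>, of B])
    show "smooth_alg V B (\<lambda>w. F (G w))"
      using F by (intro smooth_alg.base) (auto simp: B_def)
    fix H assume "B H"
    then show "continuous_on V H \<and> (\<forall>c. \<exists>G. smooth_alg V B G \<and>
      (\<forall>z\<in>V. ((\<lambda>t. H (z(c := t))) has_real_derivative G z) (at (z c))))"
    proof (subst (asm) B_def, elim disjE exE conjE)
      assume H: "smooth_on V H"
      then have "smooth_alg V B (pd c H)" for c
        by (intro smooth_alg.base) (simp add: B_def smooth_on_pd)
      then show ?thesis by (rule smooth_on_step[OF H, of "smooth_alg V B"])
    next
      fix F assume F: "local_function C U F" and H: "H = (\<lambda>w. F (G w))"
      have sum: "smooth_alg V B (\<lambda>w. \<Sum>c\<in>A. pd c F (G w) * pd j (\<lambda>w. G w c) w)" if "A \<subseteq> C" for j A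
        using finite_subset[OF that \<open>finite C\<close>] that
      proof induction
        case empty
        show ?case
          using smooth_on_const[OF \<open>open V\<close>, of 0] by (auto intro!: smooth_alg.base simp: B_def)
      next
        case (insert c A)
        have "smooth_alg V B (\<lambda>w. pd c F (G w))"
          using local_function_pd[OF F] by (intro smooth_alg.base) (auto simp: B_def)
        moreover have "smooth_alg V B (pd j (\<lambda>w. G w c))"
          using insert.prems G(1) by (intro smooth_alg.base) (auto simp: B_def intro: smooth_on_pd)
        ultimately show ?case
          using insert by (auto intro!: smooth_alg.add smooth_alg.mult)
      qed
      have "continuous_on V H"
        unfolding continuous_on_def
      proof
        fix w assume w: "w \<in> V"
        \<comment> \<open>Components of \<open>G\<close> outside \<open>C\<close> need not be
          continuous. Freezing them at \<open>w\<close> makes the map continuous at \<open>w\<close>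
          and leaves the values of \<open>F\<close> unchanged.\<close>
        define G' where "G' v = (\<lambda>c. if c \<in> C then G v c else G w c)" for v
        have G': "G' v \<in> U" "F (G' v) = F (G v)" if "v \<in> V" for v
        proof -
          have "\<forall>c\<in>C. G' v c = G v c" by (simp add: G'_def)
          then show "G' v \<in> U" "F (G' v) = F (G v)"
            using F G(2)[OF that] unfolding local_function_def by blast+
        qed
        have "(G' \<longlongrightarrow> G' w) (at w within V)"
        proof (rule tendsto_coordinatewise)
          show "((\<lambda>v. G' v c) \<longlongrightarrow> G' w c) (at w within V)" for c
            using smooth_on_continuous[OF G(1)] w
            by (cases "c \<in> C") (auto simp: G'_def continuous_on_def)
        qed
        then have "((\<lambda>v. F (G' v)) \<longlongrightarrow> F (G' w)) (at w within V)"
          by (rule continuous_on_open_tendsto_compose[OF local_function_open[OF F]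
                smooth_on_continuous[OF local_function_smooth[OF F]]]) (rule G'(1)[OF w])
        moreover have "\<forall>\<^sub>F v in at w within V. F (G' v) = F (G v)"
          using G'(2) by (auto simp: eventually_at_topological)
        ultimately show "(H \<longlongrightarrow> H w) (at w within V)"
          using Lim_transform_eventually G'(2)[OF w] by (fastforce simp: H)
      qed
      moreover have "\<exists>G'. smooth_alg V B G' \<and>
          (\<forall>z\<in>V. ((\<lambda>t. H (z(j := t))) has_real_derivative G' z) (at (z j)))" for j
        unfolding H using sum[OF order_refl, of j] comp_has_derivative[OF F \<open>finite C\<close> G]
        by (intro exI[of _ "\<lambda>w. \<Sum>c\<in>C. pd c F (G w) * pd j (\<lambda>w. G w c) w"] conjI ballI)
      ultimately show ?thesis by blast
    qed
  qed
qed

text \<open>Leaving the finite set of coordinates unspecified makes the class stable under total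
  differentiation, which brings in jet coordinates of higher order.\<close>

definition finitary_on :: "('i \<Rightarrow> real) set \<Rightarrow> (('i \<Rightarrow> real) \<Rightarrow> real) \<Rightarrow> bool" where
  "finitary_on U F \<longleftrightarrow> (\<exists>C. finite C \<and> local_function C U F)"

lemma finitary_onI: "finite C \<Longrightarrow> local_function C U F \<Longrightarrow> finitary_on U F"
  by (auto simp: finitary_on_def)

lemma finitary_onE:
  assumes "finitary_on U F"
  obtains C where "finite C" "local_function C U F"
  using assms by (auto simp: finitary_on_def)

lemma finitary_on_open: "finitary_on U F \<Longrightarrow> open U"
  by (auto elim!: finitary_onE intro: local_function_open)

lemma finitary_on_smooth: "finitary_on U F \<Longrightarrow> smooth_on U F"
  by (auto elim!: finitary_onE intro: local_function_smooth)

lemma finitary_onE2: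
  assumes "finitary_on U F" "finitary_on U G"
  obtains C where "finite C" "local_function C U F" "local_function C U G"
proof -
  from assms obtain C D where "finite C" "local_function C U F" "finite D" "local_function D U G"
    by (auto elim!: finitary_onE)
  then show thesis
    by (intro that[of "C \<union> D"]) (auto intro: local_function_mono)
qed

text \<open>The function \<open>F\<close> serves as a witness that \<open>U\<close> is a cylinder
  over finitely many coordinates.\<close>

lemma finitary_on_const:
  assumes "finitary_on U F" shows "finitary_on U (\<lambda>_. a)"
proof -
  from assms obtain C where C: "finite C" "local_function C U F" by (rule finitary_onE)
  from C(1) local_function_const[OF local_function_cylinder[OF C(2)]] show ?thesis
    by (rule finitary_onI)
qed

lemma finitary_on_coord:
  assumes "finitary_on U F" shows "finitary_on U (\<lambda>z. z c)"
proof -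
  from assms obtain C where C: "finite C" "local_function C U F" by (rule finitary_onE)
  from C(2) have "cylinder (insert c C) U"
    using cylinder_mono[OF local_function_cylinder] by (metis subset_insertI)
  then have "local_function (insert c C) U (\<lambda>z. z c)" by (rule local_function_coord) simp
  then show ?thesis using C by (auto simp: finitary_on_def)
qed

lemma finitary_on_cong: "finitary_on U F \<Longrightarrow> (\<And>z. z \<in> U \<Longrightarrow> F z = G z) \<Longrightarrow> finitary_on U G"
  by (meson finitary_on_def local_function_cong)

lemma finitary_on_add:
  assumes "finitary_on U F" "finitary_on U G"
  shows "finitary_on U (\<lambda>z. F z + G z)"
  using assms by (rule finitary_onE2) (rule finitary_onI, assumption, rule local_function_add)

lemma finitary_on_diff:
  assumes "finitary_on U F" "finitary_on U G"
  shows "finitary_on U (\<lambda>z. F z - G z)"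
  using assms by (rule finitary_onE2) (rule finitary_onI, assumption, rule local_function_diff)

lemma finitary_on_mult:
  assumes "finitary_on U F" "finitary_on U G"
  shows "finitary_on U (\<lambda>z. F z * G z)"
  using assms by (rule finitary_onE2) (rule finitary_onI, assumption, rule local_function_mult)

lemma finitary_on_minus:
  assumes "finitary_on U F"
  shows "finitary_on U (\<lambda>z. - F z)"
  using assms(1) by (rule finitary_onE) (rule finitary_onI, assumption, rule local_function_minus)

lemma finitary_on_pd:
  assumes "finitary_on U F"
  shows "finitary_on U (pd c F)"
  using assms(1) by (rule finitary_onE) (rule finitary_onI, assumption, rule local_function_pd)

lemma finitary_on_inverse:
  assumes "finitary_on U F" "\<And>z. z \<in> U \<Longrightarrow> F z \<noteq> 0"
  shows "finitary_on U (\<lambda>z. inverse (F z))"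
  using assms(1) by (rule finitary_onE) (rule finitary_onI, assumption, erule local_function_inverse, rule assms(2))

lemma finitary_on_sum:
  assumes "finitary_on U G" "\<And>a. a \<in> A \<Longrightarrow> finitary_on U (F a)"
  shows "finitary_on U (\<lambda>z. \<Sum>a\<in>A. F a z)"
  using assms(2)
  by (induction A rule: infinite_finite_induct)
    (auto intro: finitary_on_const[OF assms(1)] finitary_on_add)

text \<open>Infinitely many components may be nonzero, as for total derivatives on jets. The sum
  runs over the support of the differential of \<open>F\<close>, which is finite for functions of
  finitely many coordinates.\<close>

definition vfield :: "('i \<Rightarrow> ('i \<Rightarrow> real) \<Rightarrow> real) \<Rightarrow> (('i \<Rightarrow> real) \<Rightarrow> real) \<Rightarrow> ('i \<Rightarrow> real) \<Rightarrow> real" where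
  "vfield v F z = (\<Sum>c | pd c F z \<noteq> 0. v c z * pd c F z)"

lemma vfield_eq_sum:
  assumes "local_function C U F" "finite C" "z \<in> U"
  shows "vfield v F z = (\<Sum>c\<in>C. v c z * pd c F z)"
proof -
  have "{c. pd c F z \<noteq> 0} \<subseteq> C"
    using local_function_pd_eq_0[OF assms(1,3)] by blast
  then show ?thesis
    unfolding vfield_def using assms(2) by (intro sum.mono_neutral_left) auto
qed

lemma vfield_cong:
  assumes "open U" "z \<in> U" "\<And>w. w \<in> U \<Longrightarrow> F w = G w"
  shows "vfield v F z = vfield v G z"
  unfolding vfield_def using pd_cong[OF assms] by simp

lemma finitary_on_vfield:
  assumes F: "finitary_on U F" and v: "\<And>c. finitary_on U (v c)"
  shows "finitary_on U (vfield v F)"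
proof -
  from F obtain C where C: "finite C" "local_function C U F" by (rule finitary_onE)
  have "finitary_on U (\<lambda>z. \<Sum>c\<in>C. v c z * pd c F z)"
    by (intro finitary_on_sum[OF F] finitary_on_mult v finitary_on_pd F)
  then show ?thesis
    by (rule finitary_on_cong) (simp add: vfield_eq_sum[OF C(2,1)])
qed

section \<open>Partial derivatives and vector fields on sums and products\<close>

lemma pd_const: "pd c (\<lambda>_. a) z = 0"
  by (simp add: pd_def)

lemma pd_coord: "pd c (\<lambda>z. z d) z = (if c = d then 1 else 0)"
proof (rule pd_eqI)
  show "((\<lambda>t. (z(c := t)) d) has_real_derivative (if c = d then 1 else 0)) (at (z c))"
    by (cases "c = d") auto
qed

lemma pd_add:
  assumes "smooth_on U F" "smooth_on U G" "z \<in> U"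
  shows "pd c (\<lambda>z. F z + G z) z = pd c F z + pd c G z"
  by (rule pd_eqI) (intro DERIV_add smooth_on_has_derivative[OF assms(1,3)] smooth_on_has_derivative[OF assms(2,3)])

lemma pd_minus:
  assumes "smooth_on U F" "z \<in> U"
  shows "pd c (\<lambda>z. - F z) z = - pd c F z"
  by (rule pd_eqI) (intro DERIV_minus smooth_on_has_derivative[OF assms])

lemma pd_mult:
  assumes "smooth_on U F" "smooth_on U G" "z \<in> U"
  shows "pd c (\<lambda>z. F z * G z) z = pd c F z * G z + F z * pd c G z"
  using DERIV_mult[OF smooth_on_has_derivative[OF assms(1,3), of c] smooth_on_has_derivative[OF assms(2,3), of c]]
  by (intro pd_eqI) (simp add: mult.commute)

lemma vfield_const: "vfield v (\<lambda>_. a) z = 0"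
  by (simp add: vfield_def pd_const)

lemma vfield_coord: "vfield v (\<lambda>z. z c) z = v c z"
proof -
  have "{d. pd d (\<lambda>z. z c) z \<noteq> 0} = {c}" by (auto simp: pd_coord)
  then show ?thesis by (simp add: vfield_def pd_coord)
qed

lemma vfield_add:
  assumes "finitary_on U F" "finitary_on U G" "z \<in> U"
  shows "vfield v (\<lambda>z. F z + G z) z = vfield v F z + vfield v G z"
proof -
  obtain C where C: "finite C" "local_function C U F" "local_function C U G"
    using assms(1,2) by (rule finitary_onE2)
  show ?thesis
    using assms by (simp add: vfield_eq_sum[OF _ C(1) assms(3)] local_function_add C(2,3) pd_add[of U]
      finitary_on_smooth distrib_left sum.distrib)
qed

lemma vfield_minus:
  assumes "finitary_on U F" "z \<in> U"
  shows "vfield v (\<lambda>z. - F z) z = - vfield v F z"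
proof -
  obtain C where C: "finite C" "local_function C U F"
    using assms(1) by (rule finitary_onE)
  show ?thesis
    using assms by (simp add: vfield_eq_sum[OF _ C(1) assms(2)] local_function_minus C(2) pd_minus[of U]
      finitary_on_smooth sum_negf)
qed

lemma vfield_mult:
  assumes "finitary_on U F" "finitary_on U G" "z \<in> U"
  shows "vfield v (\<lambda>z. F z * G z) z = vfield v F z * G z + F z * vfield v G z"
proof -
  obtain C where C: "finite C" "local_function C U F" "local_function C U G"
    using assms(1,2) by (rule finitary_onE2)
  show ?thesis
    using assms
    by (simp add: vfield_eq_sum[OF _ C(1) assms(3)] local_function_mult C(2,3) pd_mult[of U] finitary_on_smooth
      sum.distrib sum_distrib_left sum_distrib_right algebra_simps)
qed

lemma vfield_sum:
  assumes "finite A" "\<And>a. a \<in> A \<Longrightarrow> finitary_on U (F a)" "z \<in> U"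
  shows "vfield v (\<lambda>z. \<Sum>a\<in>A. F a z) z = (\<Sum>a\<in>A. vfield v (F a) z)"
  using assms(1,2)
proof (induction A)
  case (insert a A)
  then have "finitary_on U (\<lambda>z. \<Sum>a\<in>A. F a z)"
    by (intro finitary_on_sum[of U "F a"]) auto
  with insert assms(3) show ?case by (simp add: vfield_add[of U])
qed (simp add: vfield_const)

text \<open>The second-order terms cancel by symmetry of second derivatives; what is left is again
  of first order and is known once each field is applied to the components of the other.\<close>

lemma vfield_commutator:
  assumes F: "local_function C U F" "finite C" and z: "z \<in> U"
    and u: "\<And>c. finitary_on U (u c)" and v: "\<And>c. finitary_on U (v c)"
  shows "vfield u (vfield v F) z - vfield v (vfield u F) z =
    (\<Sum>c\<in>C. (vfield u (v c) z - vfield v (u c) z) * pd c F z)"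
proof -
  have U: "open U" "smooth_on U F" "finitary_on U F" "finitary_on U (pd c F)" for c
    using local_function_open[OF F(1)] local_function_smooth[OF F(1)] finitary_onI[OF F(2,1)]
      finitary_on_pd by auto
  have expand: "vfield u (vfield v F) z =
      (\<Sum>c\<in>C. vfield u (v c) z * pd c F z) + (\<Sum>c\<in>C. \<Sum>d\<in>C. v c z * (u d z * pd d (pd c F) z))"
    if v: "\<And>c. finitary_on U (v c)" for u v
  proof -
    have "vfield u (vfield v F) z = vfield u (\<lambda>z. \<Sum>c\<in>C. v c z * pd c F z) z"
      by (rule vfield_cong[OF U(1) z]) (simp add: vfield_eq_sum[OF F])
    also have "\<dots> = (\<Sum>c\<in>C. vfield u (\<lambda>z. v c z * pd c F z) z)"
      by (rule vfield_sum) (auto intro: F z v U finitary_on_mult)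
    also have "\<dots> = (\<Sum>c\<in>C. vfield u (v c) z * pd c F z + v c z * vfield u (pd c F) z)"
      by (rule sum.cong[OF refl]) (rule vfield_mult[OF v U(4) z])
    also have "\<dots> = (\<Sum>c\<in>C. vfield u (v c) z * pd c F z + (\<Sum>d\<in>C. v c z * (u d z * pd d (pd c F) z)))"
      by (simp add: vfield_eq_sum[OF local_function_pd[OF F(1)] F(2) z] sum_distrib_left)
    finally show ?thesis by (simp add: sum.distrib)
  qed
  have "(\<Sum>c\<in>C. \<Sum>d\<in>C. v c z * (u d z * pd d (pd c F) z)) = (\<Sum>c\<in>C. \<Sum>d\<in>C. u c z * (v d z * pd d (pd c F) z))"
    by (subst sum.swap) (simp add: pd_commute[OF U(1,2) z] algebra_simps)
  with expand[OF v, of u] expand[OF u, of v] show ?thesis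
    by (simp add: sum_subtractf left_diff_distrib)
qed

section \<open>Derivations\<close>

text \<open>A common interface for total derivatives, \<open>Dx\<close> and prolonged generators,
  which are given by different formulas and agree with vector fields on functions of finitely many
  coordinates. Components of that same kind allow derivations to be composed.\<close>

definition derivation_on :: "('i \<Rightarrow> real) set \<Rightarrow> ((('i \<Rightarrow> real) \<Rightarrow> real) \<Rightarrow> ('i \<Rightarrow> real) \<Rightarrow> real) \<Rightarrow>
    ('i \<Rightarrow> ('i \<Rightarrow> real) \<Rightarrow> real) \<Rightarrow> bool" where
  "derivation_on U X v \<longleftrightarrow> (\<forall>c. finitary_on U (v c)) \<and>
     (\<forall>F z. finitary_on U F \<longrightarrow> z \<in> U \<longrightarrow> X F z = vfield v F z)"

text \<open>The analogue of \<^const>\<open>has_field_derivative\<close>: values matter on \<open>U\<close> only, and rules compose.\<close>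

definition derives :: "('i \<Rightarrow> real) set \<Rightarrow> ((('i \<Rightarrow> real) \<Rightarrow> real) \<Rightarrow> ('i \<Rightarrow> real) \<Rightarrow> real) \<Rightarrow>
    (('i \<Rightarrow> real) \<Rightarrow> real) \<Rightarrow> (('i \<Rightarrow> real) \<Rightarrow> real) \<Rightarrow> bool" where
  "derives U X F G \<longleftrightarrow> (\<exists>v. derivation_on U X v) \<and> finitary_on U F \<and> finitary_on U G \<and> (\<forall>z\<in>U. X F z = G z)"

lemma derivation_onD:
  assumes "derivation_on U X v"
  shows "finitary_on U (v c)" "finitary_on U F \<Longrightarrow> z \<in> U \<Longrightarrow> X F z = vfield v F z"
  using assms by (auto simp: derivation_on_def)

lemma derivation_on_finitary:
  assumes "derivation_on U X v" "finitary_on U F"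
  shows "finitary_on U (X F)"
  by (rule finitary_on_cong[OF finitary_on_vfield[of U F v]])
    (simp_all add: assms derivation_onD[OF assms(1)])

lemma derivation_on_cong:
  assumes "derivation_on U X v" "finitary_on U F" "z \<in> U" "\<And>w. w \<in> U \<Longrightarrow> F w = G w"
  shows "X F z = X G z"
  using vfield_cong[OF finitary_on_open[OF assms(2)] assms(3,4)]
    finitary_on_cong[OF assms(2,4)] assms by (simp add: derivation_onD)

lemma derivation_on_commutator:
  assumes X: "derivation_on U X u" and X': "derivation_on U X' v"
    and F: "local_function C U F" "finite C" and z: "z \<in> U"
  shows "X (X' F) z - X' (X F) z = (\<Sum>c\<in>C. (X (v c) z - X' (u c) z) * pd c F z)"
proof -
  note fin = finitary_onI[OF F(2,1)]
  have "X (X' F) z = vfield u (vfield v F) z"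
    using derivation_onD(2)[OF X derivation_on_finitary[OF X' fin] z]
      vfield_cong[OF finitary_on_open[OF fin] z derivation_onD(2)[OF X' fin]] by simp
  moreover have "X' (X F) z = vfield v (vfield u F) z"
    using derivation_onD(2)[OF X' derivation_on_finitary[OF X fin] z]
      vfield_cong[OF finitary_on_open[OF fin] z derivation_onD(2)[OF X fin]] by simp
  ultimately show ?thesis
    using vfield_commutator[OF F z derivation_onD(1)[OF X] derivation_onD(1)[OF X']]
      derivation_onD(2)[OF X derivation_onD(1)[OF X'] z] derivation_onD(2)[OF X' derivation_onD(1)[OF X] z]
    by simp
qed

section \<open>Calculus rules for derivations\<close>

lemma derivesD:
  assumes "derives U X F G"
  shows "finitary_on U F" "finitary_on U G" "z \<in> U \<Longrightarrow> X F z = G z"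
  using assms by (auto simp: derives_def)

lemma derivesI:
  assumes "derivation_on U X v" "finitary_on U F" "\<And>z. z \<in> U \<Longrightarrow> vfield v F z = G z"
  shows "derives U X F G"
proof -
  have "X F z = G z" if "z \<in> U" for z using assms that by (simp add: derivation_onD)
  moreover have "finitary_on U G"
    by (rule finitary_on_cong[OF finitary_on_vfield[OF assms(2) derivation_onD(1)[OF assms(1)]] assms(3)])
  ultimately show ?thesis using assms by (auto simp: derives_def)
qed

lemma derivesE:
  assumes "derives U X F G"
  obtains v where "derivation_on U X v" "finitary_on U F" "\<And>z. z \<in> U \<Longrightarrow> vfield v F z = G z"
proof -
  from assms obtain v where v: "derivation_on U X v" by (auto simp: derives_def)
  show thesis
    by (rule that[OF v]) (use assms derivation_onD(2)[OF v] in \<open>auto simp: derives_def\<close>)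
qed

lemma derives_self: "derivation_on U X v \<Longrightarrow> finitary_on U F \<Longrightarrow> derives U X F (X F)"
  using derivation_on_finitary[of U X v F] by (auto simp: derives_def)

lemma derives_cong:
  assumes "derives U X F G" "\<And>z. z \<in> U \<Longrightarrow> G z = G' z"
  shows "derives U X F G'"
  using assms finitary_on_cong[OF derivesD(2)[OF assms(1)] assms(2)] by (auto simp: derives_def)

lemma derives_const:
  assumes "derivation_on U X v" shows "derives U X (\<lambda>_. a) (\<lambda>_. 0)"
  by (rule derivesI[OF assms finitary_on_const[OF derivation_onD(1)[OF assms]]]) (rule vfield_const)

lemma derives_coord:
  assumes "derivation_on U X v" shows "derives U X (\<lambda>z. z c) (v c)"
  by (rule derivesI[OF assms finitary_on_coord[OF derivation_onD(1)[OF assms]]]) (rule vfield_coord)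

lemma derives_add:
  assumes "derives U X F F'" "derives U X G G'"
  shows "derives U X (\<lambda>z. F z + G z) (\<lambda>z. F' z + G' z)"
proof -
  from assms(1) obtain v where v: "derivation_on U X v" by (rule derivesE)
  note * = derivesD(1)[OF assms(1)] derivesD(1)[OF assms(2)]
  show ?thesis
    by (rule derivesI[OF v finitary_on_add[OF *]])
      (simp add: vfield_add[OF *] derivation_onD(2)[OF v, symmetric] * assms[THEN derivesD(3)])
qed

lemma derives_minus:
  assumes "derives U X F F'"
  shows "derives U X (\<lambda>z. - F z) (\<lambda>z. - F' z)"
proof -
  from assms obtain v where v: "derivation_on U X v" by (rule derivesE)
  note * = derivesD(1)[OF assms]
  show ?thesis
    by (rule derivesI[OF v finitary_on_minus[OF *]])
      (simp add: vfield_minus[OF *] derivation_onD(2)[OF v, symmetric] * derivesD(3)[OF assms])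
qed

lemma derives_diff:
  assumes "derives U X F F'" "derives U X G G'"
  shows "derives U X (\<lambda>z. F z - G z) (\<lambda>z. F' z - G' z)"
  using derives_add[OF assms(1) derives_minus[OF assms(2)]] by simp

lemma derives_mult:
  assumes "derives U X F F'" "derives U X G G'"
  shows "derives U X (\<lambda>z. F z * G z) (\<lambda>z. F' z * G z + F z * G' z)"
proof -
  from assms(1) obtain v where v: "derivation_on U X v" by (rule derivesE)
  note * = derivesD(1)[OF assms(1)] derivesD(1)[OF assms(2)]
  show ?thesis
    by (rule derivesI[OF v finitary_on_mult[OF *]])
      (simp add: vfield_mult[OF *] derivation_onD(2)[OF v, symmetric] * assms[THEN derivesD(3)])
qed

lemma derives_power:
  assumes "derives U X F F'"
  shows "derives U X (\<lambda>z. F z ^ n) (\<lambda>z. of_nat n * F z ^ (n - 1) * F' z)"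
proof (induction n)
  case 0
  from assms obtain v where v: "derivation_on U X v" by (rule derivesE)
  show ?case using derives_const[OF v, of 1] by simp
next
  case (Suc n)
  show ?case
    using derives_mult[OF assms Suc] by simp (rule derives_cong, assumption, cases n, auto simp: algebra_simps)
qed

lemma derives_cdivide:
  assumes "derives U X F F'"
  shows "derives U X (\<lambda>z. F z / a) (\<lambda>z. F' z / a)"
proof -
  from assms obtain v where v: "derivation_on U X v" by (rule derivesE)
  from derives_mult[OF assms derives_const[OF v, of "inverse a"]] show ?thesis
    by (simp add: divide_inverse)
qed

lemma derives_inverse:
  assumes F: "derives U X F F'" and nz: "\<And>z. z \<in> U \<Longrightarrow> F z \<noteq> 0"
  shows "derives U X (\<lambda>z. inverse (F z)) (\<lambda>z. - (F' z * inverse (F z) ^ 2))"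
proof -
  from F obtain v where v: "derivation_on U X v" by (rule derivesE)
  note fin = derivesD(1)[OF F]
  note fin' = finitary_on_inverse[OF fin nz]
  show ?thesis
  proof (rule derivesI[OF v fin'])
    fix z assume z: "z \<in> U"
    \<comment> \<open>Differentiate the constant function \<open>F z * inverse (F z)\<close> and
      solve for the unknown term.\<close>
    have "vfield v (\<lambda>z. F z * inverse (F z)) z = vfield v (\<lambda>_. 1) z"
      by (rule vfield_cong[OF finitary_on_open[OF fin] z]) (simp add: nz)
    then have "vfield v F z * inverse (F z) + F z * vfield v (\<lambda>z. inverse (F z)) z = 0"
      by (simp add: vfield_const vfield_mult[OF fin fin' z])
    moreover have "vfield v F z = F' z"
      using derivation_onD(2)[OF v fin z] derivesD(3)[OF F z] by simp
    ultimately show "vfield v (\<lambda>z. inverse (F z)) z = - (F' z * inverse (F z) ^ 2)"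
      using nz[OF z] by (simp add: field_simps power2_eq_square)
  qed
qed

lemma derives_divide:
  assumes F: "derives U X F F'" and G: "derives U X G G'" and "\<And>z. z \<in> U \<Longrightarrow> G z \<noteq> 0"
  shows "derives U X (\<lambda>z. F z / G z) (\<lambda>z. (F' z * G z - F z * G' z) / G z ^ 2)"
  unfolding divide_inverse
  by (rule derives_cong[OF derives_mult[OF F derives_inverse[OF G assms(3)]]])
    (use assms(3) in \<open>auto simp: field_simps power2_eq_square\<close>)

text \<open>
  Components of the total derivatives, of \<^const>\<open>Dx\<close>, and of the prolonged generator.
\<close>

fun tfield :: "var \<Rightarrow> coord \<Rightarrow> jet \<Rightarrow> real" where
  "tfield k (Indep i) = (\<lambda>z. if i = k then 1 else 0)"
| "tfield k (Dep J) = (\<lambda>z. z (Dep (add_mset k J)))"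

definition dfield :: "coord \<Rightarrow> jet \<Rightarrow> real" where
  "dfield c z = tfield Vx c z + z (Indep Vp) * tfield Vy c z
     + z (Indep Vq) * tfield Vp c z + z (Dep {#}) * tfield Vq c z"

fun gfield :: "(jet \<Rightarrow> real) \<Rightarrow> coord \<Rightarrow> jet \<Rightarrow> real" where
  "gfield \<eta> (Indep i) = xi \<eta> i"
| "gfield \<eta> (Dep J) = zeta \<eta> (index_list J)"

section \<open>Total derivatives and prolonged generators as vector fields\<close>

lemma finite_jet_coords: "finite (jet_coords s)"
  by (simp add: jet_coords_def finite_multi_indices)

lemma sum_coord_split:
  assumes "finite A"
  shows "(\<Sum>c\<in>A. g c) = (\<Sum>i | Indep i \<in> A. g (Indep i)) + (\<Sum>J | Dep J \<in> A. g (Dep J))"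
proof -
  have A: "A = Indep ` {i. Indep i \<in> A} \<union> Dep ` {J. Dep J \<in> A}"
  proof (intro equalityI subsetI)
    show "c \<in> Indep ` {i. Indep i \<in> A} \<union> Dep ` {J. Dep J \<in> A}" if "c \<in> A" for c
      using that by (cases c) auto
  qed auto
  have fin: "finite (Indep ` {i. Indep i \<in> A})" "finite (Dep ` {J. Dep J \<in> A})"
    using assms by (metis A finite_Un)+
  have "(\<Sum>c\<in>A. g c) = (\<Sum>c\<in>Indep ` {i. Indep i \<in> A} \<union> Dep ` {J. Dep J \<in> A}. g c)"
    using A by simp
  also have "\<dots> = (\<Sum>c\<in>Indep ` {i. Indep i \<in> A}. g c) + (\<Sum>c\<in>Dep ` {J. Dep J \<in> A}. g c)"
    by (rule sum.union_disjoint) (use fin in auto)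
  finally show ?thesis by (simp add: sum.reindex inj_on_def)
qed

lemma finite_pd_support:
  assumes "finitary_on U F" "z \<in> U" shows "finite {c. pd c F z \<noteq> 0}"
proof -
  from assms obtain C where C: "finite C" "local_function C U F" by (auto elim: finitary_onE)
  show ?thesis
    by (rule finite_subset[OF _ C(1)]) (use local_function_pd_eq_0[OF C(2) assms(2)] in blast)
qed

lemma total_deriv_vfield:
  assumes "finitary_on U F" "z \<in> U"
  shows "total_deriv k F z = vfield (tfield k) F z"
proof -
  have "(\<Sum>i | pd (Indep i) F z \<noteq> 0. (if i = k then 1 else 0) * pd (Indep i) F z) = pd (Indep k) F z"
    by (cases "pd (Indep k) F z = 0") (auto simp: sum.delta if_distrib[of "\<lambda>a. a * _"] cong: if_cong intro!: sum.neutral)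
  then show ?thesis
    unfolding vfield_def sum_coord_split[OF finite_pd_support[OF assms]]
    by (simp add: total_deriv_def)
qed

lemma finitary_on_tfield: "finitary_on U F \<Longrightarrow> finitary_on U (tfield k c)"
  by (cases c) (auto intro: finitary_on_const finitary_on_coord)

lemma derivation_on_total_deriv: "finitary_on U F \<Longrightarrow> derivation_on U (total_deriv k) (tfield k)"
  by (auto simp: derivation_on_def total_deriv_vfield intro: finitary_on_tfield)

lemma derivation_on_Dx: "finitary_on U F \<Longrightarrow> derivation_on U Dx dfield"
  unfolding derivation_on_def
proof (intro conjI allI impI)
  show "finitary_on U (dfield c)" if "finitary_on U F" for c
    unfolding dfield_def[abs_def]
    by (intro finitary_on_add finitary_on_mult finitary_on_tfield[OF that] finitary_on_coord[OF that])
  show "Dx F z = vfield dfield F z" if "finitary_on U F" "z \<in> U" for F z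
    unfolding Dx_def total_deriv_vfield[OF that] unfolding vfield_def dfield_def
    by (simp add: sum_distrib_left sum.distrib algebra_simps)
qed

text \<open>\<open>prolonged s\<close> is cut off at order \<open>s\<close>. For functions of that
  order the terms beyond vanish, so a single vector field without cutoff serves all orders.\<close>

lemma prolonged_vfield:
  assumes F: "local_function (jet_coords s) U F" and "z \<in> U"
  shows "prolonged s \<eta> F z = vfield (gfield \<eta>) F z"
proof -
  have "{i. Indep i \<in> jet_coords s} = UNIV" "{J. Dep J \<in> jet_coords s} = {J. size J \<le> s}"
    by (auto simp: jet_coords_def)
  then show ?thesis
    unfolding vfield_eq_sum[OF F finite_jet_coords \<open>z \<in> U\<close>] sum_coord_split[OF finite_jet_coords]
    by (simp add: prolonged_def)
qed

lemma derives_fder: "derivation_on U X v \<Longrightarrow> derives U X (fder ks) (v (Dep (mset ks)))"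
  using derives_coord[of U X v "Dep (mset ks)"] by (simp add: fder_def[abs_def])

lemma derives_total_deriv_fder: "finitary_on U F \<Longrightarrow> derives U (total_deriv k) (fder ks) (fder (k # ks))"
  using derives_fder[OF derivation_on_total_deriv, of U F k ks] by (simp add: fder_def[abs_def])

text \<open>The commutator has zero components: those along independent variables are constants, and
  those along derivatives of \<open>f\<close> agree because adding two indices to a multiset is
  independent of their order.\<close>

lemma total_deriv_commute:
  assumes "finitary_on U F" "z \<in> U"
  shows "total_deriv k (total_deriv l F) z = total_deriv l (total_deriv k F) z"
proof -
  from assms obtain C where C: "finite C" "local_function C U F" by (auto elim: finitary_onE)
  have *: "total_deriv k (tfield l c) z = total_deriv l (tfield k c) z" for c
  proof (cases c)
    case (Indep i)
    have "total_deriv m (\<lambda>z. if i = n then 1 else 0) z = 0" for m n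
      by (simp add: total_deriv_def pd_const)
    then show ?thesis using Indep by simp
  next
    case (Dep J)
    have "total_deriv m (\<lambda>z. z (Dep K)) z = z (Dep (add_mset m K))" for m K
      using derivesD(3)[OF derives_coord[OF derivation_on_total_deriv[OF assms(1)]] assms(2)] by simp
    then show ?thesis using Dep by (simp add: add_mset_commute)
  qed
  show ?thesis
    using derivation_on_commutator[OF derivation_on_total_deriv[OF assms(1)] derivation_on_total_deriv[OF assms(1)] C(2,1) assms(2), of k l]
    by (simp add: *)
qed

text \<open>This encodes \<open>[D_k, Dx]\<close>. Differentiating the coefficients
  \<open>p\<close>, \<open>q\<close> and \<open>f\<close> of \<open>Dx\<close> yields
  \<open>D_y\<close> if \<open>k = Vp\<close>, \<open>D_p\<close> if \<open>k = Vq\<close>, and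
  \<open>f_k D_q\<close> in every case.\<close>

lemma derives_total_deriv_Dx:
  assumes F: "derives U (total_deriv k) F G" and G: "derives U Dx G G'"
    and "derives U (total_deriv Vy) F Fy" "derives U (total_deriv Vp) F Fp" "derives U (total_deriv Vq) F Fq"
  shows "derives U (total_deriv k) (Dx F) (\<lambda>z. G' z + (if k = Vp then Fy z else 0)
    + (if k = Vq then Fp z else 0) + fder [k] z * Fq z)"
proof -
  note fin = derivesD(1)[OF F]
  note T = derivation_on_total_deriv[OF fin]
  note TT = derives_self[OF T derivation_on_finitary[OF T fin]]
  note C = derives_coord[OF T]
  have Dx: "Dx F = (\<lambda>z. total_deriv Vx F z + z (Indep Vp) * total_deriv Vy F z
          + z (Indep Vq) * total_deriv Vp F z + z (Dep {#}) * total_deriv Vq F z)"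
    by (simp add: Dx_def fun_eq_iff)
  show ?thesis
    unfolding Dx
  proof (rule derives_cong[OF derives_add[OF derives_add[OF derives_add[OF TT derives_mult[OF C TT]] derives_mult[OF C TT]] derives_mult[OF C TT]]])
    fix z assume z: "z \<in> U"
    have "G' z = Dx (total_deriv k F) z"
      using derivation_on_cong[OF derivation_on_Dx[OF fin] derivesD(2)[OF F] z, of "total_deriv k F"]
        derivesD(3)[OF F] derivesD(3)[OF G z] by simp
    then have "G' z = total_deriv k (total_deriv Vx F) z + z (Indep Vp) * total_deriv k (total_deriv Vy F) z
        + z (Indep Vq) * total_deriv k (total_deriv Vp F) z + z (Dep {#}) * total_deriv k (total_deriv Vq F) z"
      by (simp add: Dx_def total_deriv_commute[OF fin z, of k])
    then show "total_deriv k (total_deriv Vx F) z +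
         (tfield k (Indep Vp) z * total_deriv Vy F z + z (Indep Vp) * total_deriv k (total_deriv Vy F) z) +
         (tfield k (Indep Vq) z * total_deriv Vp F z + z (Indep Vq) * total_deriv k (total_deriv Vp F) z) +
         (tfield k (Dep {#}) z * total_deriv Vq F z + z (Dep {#}) * total_deriv k (total_deriv Vq F) z) =
         G' z + (if k = Vp then Fy z else 0) + (if k = Vq then Fp z else 0) + fder [k] z * Fq z"
      using assms(3-5)[THEN derivesD(3), OF z] by (auto simp: fder_def)
  qed
qed

section \<open>The action of the generators\<close>

lemmas lam_defs = lam4_def[abs_def] lam5_def[abs_def] lam6_def[abs_def] lam7_def[abs_def] lam8_def[abs_def]
  lam9_def[abs_def] lam10_def[abs_def] lam11_def[abs_def] lam12_def[abs_def] lam13_def[abs_def] lam14_def[abs_def]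
  lam15_def[abs_def] lam16_def[abs_def] lam17_def[abs_def] lam18_def[abs_def] lam19_def[abs_def] lam20_def[abs_def]

lemma fder_sort:
  "fder (Vp # Vy # ks) = fder (Vy # Vp # ks)"
  "fder (Vq # Vy # ks) = fder (Vy # Vq # ks)"
  "fder (Vq # Vp # ks) = fder (Vp # Vq # ks)"
  "fder (k # Vp # Vy # ks) = fder (k # Vy # Vp # ks)"
  "fder (k # Vq # Vy # ks) = fder (k # Vy # Vq # ks)"
  "fder (k # Vq # Vp # ks) = fder (k # Vp # Vq # ks)"
  by (simp_all add: fder_def[abs_def] add_mset_commute)

definition eta_deriv :: "(jet \<Rightarrow> real) \<Rightarrow> nat \<Rightarrow> nat \<Rightarrow> jet \<Rightarrow> real" where
  "eta_deriv \<eta> j b = (Dx ^^ j) ((total_deriv Vy ^^ b) \<eta>)"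

text \<open>The domain will be the intersection of the domain of an invariant with that of
  \<open>\<eta>\<close>, which is in general not a cylinder over \<open>x\<close> and
  \<open>y\<close> alone. Dependence on \<open>x\<close> and \<open>y\<close> only is therefore
  stated through vanishing partial derivatives.\<close>

locale prolongation =
  fixes W :: "jet set" and \<eta> :: "jet \<Rightarrow> real"
  assumes finitary_eta: "finitary_on W \<eta>"
    and pd_eta: "z \<in> W \<Longrightarrow> c \<noteq> Indep Vx \<Longrightarrow> c \<noteq> Indep Vy \<Longrightarrow> pd c \<eta> z = 0"
begin

abbreviation "Y \<equiv> vfield (gfield \<eta>)"

abbreviation "e \<equiv> eta_deriv \<eta>"

lemmas deriv_TD = derivation_on_total_deriv[OF finitary_eta]
lemmas deriv_Dx = derivation_on_Dx[OF finitary_eta]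

lemma finitary_TD: "finitary_on W F \<Longrightarrow> finitary_on W (total_deriv k F)"
  by (rule derivation_on_finitary[OF deriv_TD])

lemma finitary_Dx: "finitary_on W F \<Longrightarrow> finitary_on W (Dx F)"
  by (rule derivation_on_finitary[OF deriv_Dx])

lemma finitary_xi: "finitary_on W (xi \<eta> i)"
  by (cases i) (auto intro!: finitary_Dx finitary_on_const[OF finitary_eta] finitary_eta)

lemma finitary_fder: "finitary_on W (fder ks)"
  using finitary_on_coord[OF finitary_eta] by (simp add: fder_def[abs_def])

lemma finitary_zeta: "finitary_on W (zeta \<eta> ks)"
proof (induction ks)
  case Nil
  then show ?case by (auto intro!: finitary_Dx finitary_eta)
next
  case (Cons k ks)
  show ?case
    unfolding zeta.simps
    by (intro finitary_on_diff finitary_on_sum[OF finitary_eta] finitary_on_mult finitary_TD Cons finitary_xi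
        finitary_on_coord[OF finitary_eta])
qed

lemma finitary_gfield: "finitary_on W (gfield \<eta> c)"
  by (cases c) (auto intro: finitary_xi finitary_zeta)

lemma deriv_Y: "derivation_on W Y (gfield \<eta>)"
  by (simp add: derivation_on_def finitary_gfield)

section \<open>Independence of the order of indices, and commutators with the generator\<close>

lemma zeta_Cons:
  "zeta \<eta> (k # ks) z = total_deriv k (zeta \<eta> ks) z
     - (fder (Vx # ks) z * total_deriv k (xi \<eta> Vx) z + fder (Vy # ks) z * total_deriv k (xi \<eta> Vy) z
       + fder (Vp # ks) z * total_deriv k (xi \<eta> Vp) z + fder (Vq # ks) z * total_deriv k (xi \<eta> Vq) z)"
  by (simp add: UNIV_var fder_def)

text \<open>The recursion runs over a list and is not visibly symmetric. Expanded twice, it consists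
  of second total derivatives, which commute, and two first-order sums that are exchanged along with
  \<open>k\<close> and \<open>l\<close>.\<close>

lemma zeta_swap:
  assumes z: "z \<in> W"
  shows "zeta \<eta> (k # l # ks) z = zeta \<eta> (l # k # ks) z"
proof -
  have *: "zeta \<eta> (k # l # ks) z = total_deriv k (total_deriv l (zeta \<eta> ks)) z
     - (\<Sum>i\<in>UNIV. fder (k # i # ks) z * total_deriv l (xi \<eta> i) z
         + fder (i # ks) z * total_deriv k (total_deriv l (xi \<eta> i)) z + fder (i # l # ks) z * total_deriv k (xi \<eta> i) z)" for k l
  proof -
    have "derives W (total_deriv k) (zeta \<eta> (l # ks)) (\<lambda>z. total_deriv k (total_deriv l (zeta \<eta> ks)) z
     - ((fder (k # Vx # ks) z * total_deriv l (xi \<eta> Vx) z + fder (Vx # ks) z * total_deriv k (total_deriv l (xi \<eta> Vx)) z)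
      + (fder (k # Vy # ks) z * total_deriv l (xi \<eta> Vy) z + fder (Vy # ks) z * total_deriv k (total_deriv l (xi \<eta> Vy)) z)
      + (fder (k # Vp # ks) z * total_deriv l (xi \<eta> Vp) z + fder (Vp # ks) z * total_deriv k (total_deriv l (xi \<eta> Vp)) z)
      + (fder (k # Vq # ks) z * total_deriv l (xi \<eta> Vq) z + fder (Vq # ks) z * total_deriv k (total_deriv l (xi \<eta> Vq)) z)))"
      unfolding zeta_Cons[abs_def]
      by (intro derives_diff derives_add derives_mult derives_self[OF deriv_TD]
          finitary_TD finitary_zeta finitary_xi derives_total_deriv_fder[OF finitary_eta])
    from derivesD(3)[OF this z] show ?thesis
      unfolding zeta_Cons[of k "l # ks"] by (simp add: UNIV_var algebra_simps)
  qed
  have "fder (k # l # ms) = fder (l # k # ms)" for k l ms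
    by (simp add: fder_def[abs_def] add_mset_commute)
  then show ?thesis
    unfolding * total_deriv_commute[OF finitary_zeta z, of k l] total_deriv_commute[OF finitary_xi z, of k l]
    by (simp add: algebra_simps)
qed

lemma zeta_Cons_cong:
  assumes "\<And>z. z \<in> W \<Longrightarrow> zeta \<eta> ks z = zeta \<eta> ls z" "mset ks = mset ls" "z \<in> W"
  shows "zeta \<eta> (k # ks) z = zeta \<eta> (k # ls) z"
  using derivation_on_cong[OF deriv_TD finitary_zeta assms(3,1)] by (simp add: assms(2))

lemma zeta_move_to_front:
  "l \<in> set ks \<Longrightarrow> z \<in> W \<Longrightarrow> zeta \<eta> ks z = zeta \<eta> (l # remove1 l ks) z"
proof (induction ks arbitrary: z)
  case (Cons k ks)
  show ?case
  proof (cases "k = l")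
    case False
    then have l: "l \<in> set ks" using Cons.prems by simp
    have "zeta \<eta> (k # ks) z = zeta \<eta> (k # l # remove1 l ks) z"
      by (rule zeta_Cons_cong[OF Cons.IH[OF l]]) (use Cons.prems l in auto)
    then show ?thesis using zeta_swap[OF \<open>z \<in> W\<close>] False by (simp del: zeta.simps)
  qed simp
qed simp

text \<open>\<open>gfield\<close> uses the index order chosen by \<open>index_list\<close>, whereas
  computations prepend indices one at a time; this reconciles the two.\<close>

lemma zeta_perm:
  "mset ks = mset ls \<Longrightarrow> z \<in> W \<Longrightarrow> zeta \<eta> ks z = zeta \<eta> ls z"
proof (induction ls arbitrary: ks z)
  case (Cons l ls)
  have l: "l \<in> set ks" "mset (remove1 l ks) = mset ls"
    using Cons.prems(1) by (auto simp: set_mset_mset[symmetric] simp del: set_mset_mset)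
  have "zeta \<eta> (l # remove1 l ks) z = zeta \<eta> (l # ls) z"
    by (rule zeta_Cons_cong[OF _ l(2) Cons.prems(2)]) (rule Cons.IH[OF l(2)])
  then show ?case using zeta_move_to_front[OF l(1) Cons.prems(2)] by (simp del: zeta.simps)
qed simp

lemma Y_fder: "derives W Y (fder ks) (zeta \<eta> ks)"
  by (rule derives_cong[OF derives_fder[OF deriv_Y]]) (simp add: zeta_perm[of "index_list (mset ks)" ks] mset_index_list)

text \<open>It suffices to compare components. Along an independent variable only the total
  derivative of \<open>xi\<close> is left; along a derivative of \<open>f\<close> the claim is the
  recursion for \<open>zeta\<close>.\<close>

lemma Y_total_deriv:
  assumes F: "finitary_on W F" and z: "z \<in> W"
  shows "Y (total_deriv k F) z = total_deriv k (Y F) z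
    - (\<Sum>i\<in>UNIV. total_deriv k (xi \<eta> i) z * total_deriv i F z)"
proof -
  obtain C where C: "finite C" "local_function C W F" using F by (rule finitary_onE)
  have comp: "Y (tfield k c) z - total_deriv k (gfield \<eta> c) z =
      - (\<Sum>i\<in>UNIV. total_deriv k (xi \<eta> i) z * tfield i c z)" for c
  proof (cases c)
    case (Indep j)
    have "Y (\<lambda>z. if j = k then 1 else 0) z = 0" by (simp add: vfield_const)
    moreover have "(\<Sum>i\<in>UNIV. total_deriv k (xi \<eta> i) z * (if j = i then 1 else 0)) = total_deriv k (xi \<eta> j) z"
      by (simp add: if_distrib[of "\<lambda>a. _ * a"] cong: if_cong)
    ultimately show ?thesis using Indep by simp
  next
    case (Dep J)
    have "Y (\<lambda>z. z (Dep (add_mset k J))) z = zeta \<eta> (index_list (add_mset k J)) z"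
      using derivesD(3)[OF derives_coord[OF deriv_Y] z, of "Dep (add_mset k J)"] by simp
    also have "\<dots> = zeta \<eta> (k # index_list J) z"
      by (rule zeta_perm) (simp_all add: mset_index_list z)
    finally show ?thesis using Dep by (simp add: mset_index_list mult.commute)
  qed
  have "Y (total_deriv k F) z - total_deriv k (Y F) z =
      (\<Sum>c\<in>C. - (\<Sum>i\<in>UNIV. total_deriv k (xi \<eta> i) z * tfield i c z) * pd c F z)"
    unfolding derivation_on_commutator[OF deriv_Y deriv_TD C(2,1) z] comp ..
  also have "\<dots> = - (\<Sum>i\<in>UNIV. total_deriv k (xi \<eta> i) z * (\<Sum>c\<in>C. tfield i c z * pd c F z))"
    by (simp add: sum_negf sum_distrib_right sum_distrib_left mult.assoc sum.swap[of _ C])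
  finally show ?thesis
    by (simp add: total_deriv_vfield[OF F z] vfield_eq_sum[OF C(2,1) z])
qed

lemma Dx_xi: "z \<in> W \<Longrightarrow> Dx (xi \<eta> i) z = (case i of Vx \<Rightarrow> 0 | Vy \<Rightarrow> xi \<eta> Vp z | Vp \<Rightarrow> xi \<eta> Vq z | Vq \<Rightarrow> zeta \<eta> [] z)"
  using derivesD(3)[OF derives_const[OF deriv_Dx]] by (cases i) auto

text \<open>The commutators with the four total derivatives contribute
  \<open>- Dx (xi \<eta> i)\<close> along \<open>D_i\<close>, and the action of \<open>Y\<close> on
  the coefficients \<open>p\<close>, \<open>q\<close>, \<open>f\<close> of \<open>Dx\<close>
  contributes its own components there. These cancel by \<open>Dx_xi\<close>, as each component is
  \<open>Dx\<close> of the preceding one.\<close>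

lemma Y_Dx:
  assumes F: "derives W Y F G" and G: "derives W Dx G G'"
  shows "derives W Y (Dx F) G'"
proof -
  note fin = derivesD(1)[OF F]
  have Dx: "Dx F = (\<lambda>z. total_deriv Vx F z + z (Indep Vp) * total_deriv Vy F z
          + z (Indep Vq) * total_deriv Vp F z + z (Dep {#}) * total_deriv Vq F z)"
    by (simp add: Dx_def fun_eq_iff)
  note S = derives_self[OF deriv_Y finitary_TD[OF fin]]
  note C = derives_coord[OF deriv_Y]
  show ?thesis
    unfolding Dx
  proof (rule derives_cong[OF derives_add[OF derives_add[OF derives_add[OF S derives_mult[OF C S]] derives_mult[OF C S]] derives_mult[OF C S]]])
    fix z assume z: "z \<in> W"
    have "G' z = Dx (Y F) z"
      using derivation_on_cong[OF deriv_Dx derivesD(2)[OF F] z, of "Y F"]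
        derivesD(3)[OF F] derivesD(3)[OF G z] by simp
    moreover have "index_list {#} = []" by (simp add: index_list_def)
    ultimately show "Y (total_deriv Vx F) z +
         (gfield \<eta> (Indep Vp) z * total_deriv Vy F z + z (Indep Vp) * Y (total_deriv Vy F) z) +
         (gfield \<eta> (Indep Vq) z * total_deriv Vp F z + z (Indep Vq) * Y (total_deriv Vp F) z) +
         (gfield \<eta> (Dep {#}) z * total_deriv Vq F z + z (Dep {#}) * Y (total_deriv Vq F) z) = G' z"
      unfolding Y_total_deriv[OF fin z]
      using arg_cong[OF Dx_xi[OF z, of Vx], of "\<lambda>a. a * total_deriv Vx F z"]
        arg_cong[OF Dx_xi[OF z, of Vy], of "\<lambda>a. a * total_deriv Vy F z"]
        arg_cong[OF Dx_xi[OF z, of Vp], of "\<lambda>a. a * total_deriv Vp F z"]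
        arg_cong[OF Dx_xi[OF z, of Vq], of "\<lambda>a. a * total_deriv Vq F z"]
      by (simp add: UNIV_var Dx_def[of "xi _ _"] Dx_def[of "Y F"] algebra_simps del: xi.simps zeta.simps)
  qed
qed

section \<open>Total derivatives of the functions \<open>e j b\<close>\<close>

lemma finitary_e: "finitary_on W (e j b)"
proof -
  have "finitary_on W ((total_deriv Vy ^^ b) \<eta>)" by (induction b) (auto intro: finitary_TD finitary_eta)
  then show ?thesis unfolding eta_deriv_def by (induction j) (auto intro: finitary_Dx)
qed

lemma Dx_e: "derives W Dx (e j b) (e (Suc j) b)"
  using derives_self[OF deriv_Dx finitary_e, of j b] by (simp add: eta_deriv_def)

lemma TD_e_0:
  "derives W (total_deriv Vq) (e 0 b) (\<lambda>z. 0)"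
  "derives W (total_deriv Vp) (e 0 b) (\<lambda>z. 0)"
  "derives W (total_deriv Vy) (e 0 b) (e 0 (Suc b))"
proof -
  have *: "derives W (total_deriv k) (e 0 b) (\<lambda>z. 0)" if k: "k \<noteq> Vx" "k \<noteq> Vy" for k
  proof (induction b)
    case 0
    have "total_deriv k \<eta> z = 0" if "z \<in> W" for z
      using k pd_eta[OF that] by (simp add: total_deriv_def)
    then show ?case
      using derives_cong[OF derives_self[OF deriv_TD finitary_eta]] by (simp add: eta_deriv_def)
  next
    case (Suc b)
    have "total_deriv k (e 0 (Suc b)) z = 0" if z: "z \<in> W" for z
    proof -
      have "total_deriv k (e 0 (Suc b)) z = total_deriv Vy (total_deriv k (e 0 b)) z"
        using total_deriv_commute[OF finitary_e z, of k Vy 0 b] by (simp add: eta_deriv_def)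
      also have "\<dots> = total_deriv Vy (\<lambda>_. 0) z"
        by (rule derivation_on_cong[OF deriv_TD finitary_TD[OF finitary_e] z derivesD(3)[OF Suc]])
      also have "\<dots> = 0" by (simp add: total_deriv_def pd_const)
      finally show ?thesis .
    qed
    then show ?case by (rule derives_cong[OF derives_self[OF deriv_TD finitary_e]])
  qed
  show "derives W (total_deriv Vq) (e 0 b) (\<lambda>z. 0)" "derives W (total_deriv Vp) (e 0 b) (\<lambda>z. 0)"
    by (auto intro: *)
  show "derives W (total_deriv Vy) (e 0 b) (e 0 (Suc b))"
    using derives_self[OF deriv_TD finitary_e, of Vy 0 b] by (simp add: eta_deriv_def)
qed

lemma TD_e_Suc:
  assumes "derives W (total_deriv k) (e j b) G" "derives W Dx G G'"
    "derives W (total_deriv Vy) (e j b) Fy" "derives W (total_deriv Vp) (e j b) Fp"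
    "derives W (total_deriv Vq) (e j b) Fq"
  shows "derives W (total_deriv k) (e (Suc j) b) (\<lambda>z. G' z + (if k = Vp then Fy z else 0)
    + (if k = Vq then Fp z else 0) + fder [k] z * Fq z)"
  using derives_total_deriv_Dx[OF assms] by (simp add: eta_deriv_def)

lemmas Dx_0 = derives_const[OF deriv_Dx, of 0]

lemma TD_e_1:
  "derives W (total_deriv Vq) (e 1 b) (\<lambda>z. 0)"
  "derives W (total_deriv Vp) (e 1 b) (e 0 (Suc b))"
  "derives W (total_deriv Vy) (e 1 b) (e 1 (Suc b))"
  using TD_e_Suc[OF TD_e_0(1) Dx_0 TD_e_0(3,2,1), of b]
    TD_e_Suc[OF TD_e_0(2) Dx_0 TD_e_0(3,2,1), of b] TD_e_Suc[OF TD_e_0(3) Dx_e TD_e_0(3,2,1), of b]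
  by simp_all

lemma TD_e_2:
  "derives W (total_deriv Vq) (e 2 b) (e 0 (Suc b))"
  "derives W (total_deriv Vp) (e 2 b) (\<lambda>z. 2 * e 1 (Suc b) z)"
  "derives W (total_deriv Vy) (e 2 b) (e 2 (Suc b))"
proof -
  show "derives W (total_deriv Vp) (e 2 b) (\<lambda>z. 2 * e 1 (Suc b) z)"
    using TD_e_Suc[OF TD_e_1(2) Dx_e TD_e_1(3,2,1), of b] by (simp add: numeral_2_eq_2)
  show "derives W (total_deriv Vq) (e 2 b) (e 0 (Suc b))" "derives W (total_deriv Vy) (e 2 b) (e 2 (Suc b))"
    using TD_e_Suc[OF TD_e_1(1) Dx_0 TD_e_1(3,2,1), of b] TD_e_Suc[OF TD_e_1(3) Dx_e TD_e_1(3,2,1), of b]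
    by (simp_all add: numeral_2_eq_2)
qed

text \<open>The commutator term \<open>f_k D_q\<close> first contributes here, because
  \<open>e 2 b\<close> is the first of these functions with a nonzero \<open>q\<close>-derivative.
  The formulas for \<open>j <= 3\<close> are closed under \<open>D_y\<close>, \<open>D_p\<close>,
  \<open>D_q\<close>, and the component along \<open>f\<close> is \<open>e 3 0\<close>, so no
  further ones are called for.\<close>

lemma TD_e_3:
  "derives W (total_deriv Vq) (e 3 b) (\<lambda>z. 3 * e 1 (Suc b) z + fder [Vq] z * e 0 (Suc b) z)"
  "derives W (total_deriv Vp) (e 3 b) (\<lambda>z. 3 * e 2 (Suc b) z + fder [Vp] z * e 0 (Suc b) z)"
  "derives W (total_deriv Vy) (e 3 b) (\<lambda>z. e 3 (Suc b) z + fder [Vy] z * e 0 (Suc b) z)"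
proof -
  have D2: "derives W Dx (\<lambda>z. 2 * e 1 (Suc b) z) (\<lambda>z. 2 * e 2 (Suc b) z)"
    using derives_mult[OF derives_const[OF deriv_Dx, of 2] Dx_e[of 1 "Suc b"]] by (simp add: numeral_2_eq_2)
  show "derives W (total_deriv Vq) (e 3 b) (\<lambda>z. 3 * e 1 (Suc b) z + fder [Vq] z * e 0 (Suc b) z)"
    "derives W (total_deriv Vp) (e 3 b) (\<lambda>z. 3 * e 2 (Suc b) z + fder [Vp] z * e 0 (Suc b) z)"
    "derives W (total_deriv Vy) (e 3 b) (\<lambda>z. e 3 (Suc b) z + fder [Vy] z * e 0 (Suc b) z)"
    using TD_e_Suc[OF TD_e_2(1) Dx_e TD_e_2(3,2,1), of b]
      TD_e_Suc[OF TD_e_2(2) D2 TD_e_2(3,2,1)] TD_e_Suc[OF TD_e_2(3) Dx_e TD_e_2(3,2,1), of b]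
    by (simp_all add: eval_nat_numeral)
qed

lemma xi_e: "xi \<eta> Vy = e 0 0" "xi \<eta> Vp = e 1 0" "xi \<eta> Vq = e 2 0" and zeta_e: "zeta \<eta> [] = e 3 0"
  by (simp_all add: eta_deriv_def eval_nat_numeral)

text \<open>The summand of \<open>Vx\<close> in the recursion for \<open>zeta\<close> drops out
  because the generators fix \<open>x\<close>.\<close>

lemma derives_Y_fder_Cons:
  assumes "derives W Y (fder ks) G" "derives W (total_deriv k) G G'"
    "derives W (total_deriv k) (e 0 0) A" "derives W (total_deriv k) (e 1 0) B" "derives W (total_deriv k) (e 2 0) C"
  shows "derives W Y (fder (k # ks)) (\<lambda>z. G' z - fder (Vy # ks) z * A z - fder (Vp # ks) z * B z - fder (Vq # ks) z * C z)"
proof (rule derives_cong[OF Y_fder])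
  fix z assume z: "z \<in> W"
  have "zeta \<eta> ks w = G w" if "w \<in> W" for w
    using derivesD(3)[OF Y_fder that] derivesD(3)[OF assms(1) that] by simp
  then have "total_deriv k (zeta \<eta> ks) z = G' z"
    using derivation_on_cong[OF deriv_TD finitary_zeta z, of ks G] derivesD(3)[OF assms(2) z] by simp
  then show "zeta \<eta> (k # ks) z = G' z - fder (Vy # ks) z * A z - fder (Vp # ks) z * B z - fder (Vq # ks) z * C z"
    using assms(3-5)[THEN derivesD(3), OF z]
    unfolding zeta_Cons xi_e by (simp add: total_deriv_def pd_const)
qed

lemma derives_Y_fder_q:
  assumes "derives W Y (fder ks) G" "derives W (total_deriv Vq) G G'"
  shows "derives W Y (fder (Vq # ks)) (\<lambda>z. G' z - fder (Vq # ks) z * e 0 1 z)"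
  using derives_Y_fder_Cons[OF assms TD_e_0(1) TD_e_1(1) TD_e_2(1)] by simp

lemma derives_Y_fder_p:
  assumes "derives W Y (fder ks) G" "derives W (total_deriv Vp) G G'"
  shows "derives W Y (fder (Vp # ks)) (\<lambda>z. G' z - fder (Vp # ks) z * e 0 1 z - fder (Vq # ks) z * (2 * e 1 1 z))"
  using derives_Y_fder_Cons[OF assms TD_e_0(2) TD_e_1(2) TD_e_2(2)] by simp

lemma derives_Y_fder_y:
  assumes "derives W Y (fder ks) G" "derives W (total_deriv Vy) G G'"
  shows "derives W Y (fder (Vy # ks)) (\<lambda>z. G' z - fder (Vy # ks) z * e 0 1 z - fder (Vp # ks) z * e 1 1 z - fder (Vq # ks) z * e 2 1 z)"
  using derives_Y_fder_Cons[OF assms TD_e_0(3) TD_e_1(3) TD_e_2(3)] by simp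

lemmas derives_arith = derives_cdivide derives_const[OF deriv_Y] derives_const[OF deriv_Dx]
  derives_const[OF deriv_TD] derives_add derives_diff derives_minus derives_mult derives_power

lemmas derives_TD_intros = TD_e_0 TD_e_1 TD_e_2 TD_e_3 derives_total_deriv_fder[OF finitary_eta] derives_arith

lemmas Y_fder_simps = fder_sort algebra_simps numeral_2_eq_2 numeral_3_eq_3

section \<open>Components of the generator along the \<open>y\<close>, \<open>p\<close>,
  \<open>q\<close>-derivatives of \<open>f\<close>\<close>

lemma Y_f: "derives W Y (fder []) (e 3 0)"
  using Y_fder[of "[]"] by (simp only: zeta_e)

lemma Y_fq: "derives W Y (fder [Vq])
    (\<lambda>z. 3 * e 1 1 z)"
  by (rule derives_cong[OF derives_Y_fder_q[OF Y_f]], (rule derives_TD_intros)+)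
    (simp add: Y_fder_simps)

lemma Y_fp: "derives W Y (fder [Vp])
    (\<lambda>z. - 2 * e 1 1 z * fder [Vq] z + 3 * e 2 1 z)"
  by (rule derives_cong[OF derives_Y_fder_p[OF Y_f]], (rule derives_TD_intros)+)
    (simp add: Y_fder_simps)

lemma Y_fy: "derives W Y (fder [Vy])
    (\<lambda>z. - e 1 1 z * fder [Vp] z - e 2 1 z * fder [Vq] z + e 3 1 z)"
  by (rule derives_cong[OF derives_Y_fder_y[OF Y_f]], (rule derives_TD_intros)+)
    (simp add: Y_fder_simps)

text \<open>As \<open>e 1 1\<close> does not depend on \<open>q\<close>, the second derivative
  \<open>f44\<close> is merely rescaled. This makes it the relative invariant of weight one by which
  the others are normalised.\<close>

lemma Y_fqq: "derives W Y (fder [Vq, Vq])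
    (\<lambda>z. - e 0 1 z * fder [Vq, Vq] z)"
  by (rule derives_cong[OF derives_Y_fder_q[OF Y_fq]], (rule derives_TD_intros)+)
    (simp add: Y_fder_simps)

lemma Y_fpq: "derives W Y (fder [Vp, Vq])
    (\<lambda>z. - e 0 1 z * fder [Vp, Vq] z + 3 * e 0 2 z - 2 * e 1 1 z * fder [Vq, Vq] z)"
  by (rule derives_cong[OF derives_Y_fder_p[OF Y_fq]], (rule derives_TD_intros)+)
    (simp add: Y_fder_simps)

lemma Y_fyq: "derives W Y (fder [Vy, Vq])
    (\<lambda>z. - e 0 1 z * fder [Vy, Vq] z - e 1 1 z * fder [Vp, Vq] z + 3 * e 1 2 z - e 2 1 z * fder [Vq, Vq] z)"
  by (rule derives_cong[OF derives_Y_fder_y[OF Y_fq]], (rule derives_TD_intros)+)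
    (simp add: Y_fder_simps)

lemma Y_fpp: "derives W Y (fder [Vp, Vp])
    (\<lambda>z. - e 0 1 z * fder [Vp, Vp] z - 2 * e 0 2 z * fder [Vq] z - 4 * e 1 1 z * fder [Vp, Vq] z + 6 * e 1 2 z)"
  by (rule derives_cong[OF derives_Y_fder_p[OF Y_fp]], (rule derives_TD_intros)+)
    (simp add: Y_fder_simps)

lemma Y_fyp: "derives W Y (fder [Vy, Vp])
    (\<lambda>z. - e 0 1 z * fder [Vy, Vp] z - e 1 1 z * fder [Vp, Vp] z - 2 * e 1 1 z * fder [Vy, Vq] z - 2 * e 1 2 z * fder [Vq] z - e 2 1 z * fder [Vp, Vq] z + 3 * e 2 2 z)"
  by (rule derives_cong[OF derives_Y_fder_y[OF Y_fp]], (rule derives_TD_intros)+)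
    (simp add: Y_fder_simps)

lemma Y_fyy: "derives W Y (fder [Vy, Vy])
    (\<lambda>z. - e 0 1 z * fder [Vy, Vy] z + e 0 2 z * fder [Vy] z - 2 * e 1 1 z * fder [Vy, Vp] z - e 1 2 z * fder [Vp] z - 2 * e 2 1 z * fder [Vy, Vq] z - e 2 2 z * fder [Vq] z + e 3 2 z)"
  by (rule derives_cong[OF derives_Y_fder_y[OF Y_fy]], (rule derives_TD_intros)+)
    (simp add: Y_fder_simps)

lemma Y_fqqq: "derives W Y (fder [Vq, Vq, Vq])
    (\<lambda>z. - 2 * e 0 1 z * fder [Vq, Vq, Vq] z)"
  by (rule derives_cong[OF derives_Y_fder_q[OF Y_fqq]], (rule derives_TD_intros)+)
    (simp add: Y_fder_simps)

lemma Y_fpqq: "derives W Y (fder [Vp, Vq, Vq])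
    (\<lambda>z. - 2 * e 0 1 z * fder [Vp, Vq, Vq] z - 2 * e 1 1 z * fder [Vq, Vq, Vq] z)"
  by (rule derives_cong[OF derives_Y_fder_p[OF Y_fqq]], (rule derives_TD_intros)+)
    (simp add: Y_fder_simps)

lemma Y_fppq: "derives W Y (fder [Vp, Vp, Vq])
    (\<lambda>z. - 2 * e 0 1 z * fder [Vp, Vp, Vq] z - 2 * e 0 2 z * fder [Vq, Vq] z - 4 * e 1 1 z * fder [Vp, Vq, Vq] z)"
  by (rule derives_cong[OF derives_Y_fder_p[OF Y_fpq]], (rule derives_TD_intros)+)
    (simp add: Y_fder_simps)

lemma Y_fppp: "derives W Y (fder [Vp, Vp, Vp])
    (\<lambda>z. - 2 * e 0 1 z * fder [Vp, Vp, Vp] z - 6 * e 0 2 z * fder [Vp, Vq] z + 6 * e 0 3 z - 6 * e 1 1 z * fder [Vp, Vp, Vq] z)"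
  by (rule derives_cong[OF derives_Y_fder_p[OF Y_fpp]], (rule derives_TD_intros)+)
    (simp add: Y_fder_simps)

lemma Y_fyqq: "derives W Y (fder [Vy, Vq, Vq])
    (\<lambda>z. - 2 * e 0 1 z * fder [Vy, Vq, Vq] z - e 0 2 z * fder [Vq, Vq] z - e 1 1 z * fder [Vp, Vq, Vq] z - e 2 1 z * fder [Vq, Vq, Vq] z)"
  by (rule derives_cong[OF derives_Y_fder_y[OF Y_fqq]], (rule derives_TD_intros)+)
    (simp add: Y_fder_simps)

lemma Y_fypq: "derives W Y (fder [Vy, Vp, Vq])
    (\<lambda>z. - 2 * e 0 1 z * fder [Vy, Vp, Vq] z - e 0 2 z * fder [Vp, Vq] z + 3 * e 0 3 z - e 1 1 z * fder [Vp, Vp, Vq] z - 2 * e 1 1 z * fder [Vy, Vq, Vq] z - 2 * e 1 2 z * fder [Vq, Vq] z - e 2 1 z * fder [Vp, Vq, Vq] z)"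
  by (rule derives_cong[OF derives_Y_fder_y[OF Y_fpq]], (rule derives_TD_intros)+)
    (simp add: Y_fder_simps)

lemma Y_fypp: "derives W Y (fder [Vy, Vp, Vp])
    (\<lambda>z. - 2 * e 0 1 z * fder [Vy, Vp, Vp] z - e 0 2 z * fder [Vp, Vp] z - 2 * e 0 2 z * fder [Vy, Vq] z - 2 * e 0 3 z * fder [Vq] z - e 1 1 z * fder [Vp, Vp, Vp] z - 4 * e 1 1 z * fder [Vy, Vp, Vq] z - 4 * e 1 2 z * fder [Vp, Vq] z + 6 * e 1 3 z - e 2 1 z * fder [Vp, Vp, Vq] z)"
  by (rule derives_cong[OF derives_Y_fder_y[OF Y_fpp]], (rule derives_TD_intros)+)
    (simp add: Y_fder_simps)

lemma Y_fyyq: "derives W Y (fder [Vy, Vy, Vq])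
    (\<lambda>z. - 2 * e 0 1 z * fder [Vy, Vy, Vq] z - e 0 2 z * fder [Vy, Vq] z - 2 * e 1 1 z * fder [Vy, Vp, Vq] z - e 1 2 z * fder [Vp, Vq] z + 3 * e 1 3 z - 2 * e 2 1 z * fder [Vy, Vq, Vq] z - e 2 2 z * fder [Vq, Vq] z)"
  by (rule derives_cong[OF derives_Y_fder_y[OF Y_fyq]], (rule derives_TD_intros)+)
    (simp add: Y_fder_simps)

lemma Y_fyyp: "derives W Y (fder [Vy, Vy, Vp])
    (\<lambda>z. - 2 * e 0 1 z * fder [Vy, Vy, Vp] z - e 0 2 z * fder [Vy, Vp] z - 2 * e 1 1 z * fder [Vy, Vp, Vp] z - 2 * e 1 1 z * fder [Vy, Vy, Vq] z - e 1 2 z * fder [Vp, Vp] z - 4 * e 1 2 z * fder [Vy, Vq] z - 2 * e 1 3 z * fder [Vq] z - 2 * e 2 1 z * fder [Vy, Vp, Vq] z - e 2 2 z * fder [Vp, Vq] z + 3 * e 2 3 z)"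
  by (rule derives_cong[OF derives_Y_fder_y[OF Y_fyp]], (rule derives_TD_intros)+)
    (simp add: Y_fder_simps)

lemma Y_fyyy: "derives W Y (fder [Vy, Vy, Vy])
    (\<lambda>z. - 2 * e 0 1 z * fder [Vy, Vy, Vy] z + 2 * e 0 3 z * fder [Vy] z - 3 * e 1 1 z * fder [Vy, Vy, Vp] z - 3 * e 1 2 z * fder [Vy, Vp] z - e 1 3 z * fder [Vp] z - 3 * e 2 1 z * fder [Vy, Vy, Vq] z - 3 * e 2 2 z * fder [Vy, Vq] z - e 2 3 z * fder [Vq] z + e 3 3 z)"
  by (rule derives_cong[OF derives_Y_fder_y[OF Y_fyy]], (rule derives_TD_intros)+)
    (simp add: Y_fder_simps)

lemmas Y_fder_rules = Y_fq Y_fp Y_fy Y_fqq Y_fpq Y_fyq Y_fpp Y_fyp Y_fyy Y_fqqq Y_fpqq Y_fppq Y_fppp Y_fyqq Y_fypq Y_fypp Y_fyyq Y_fyyp Y_fyyy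

lemmas derives_Y_intros = Y_Dx Y_fder_rules Dx_e derives_self[OF deriv_Dx finitary_fder]
  derives_self[OF deriv_Dx finitary_Dx[OF finitary_fder]] derives_arith

text \<open>The factor \<open>real w\<close> is kept even for weights 0 and 1, so that the results
  match the form required by \<open>has_weight\<close>.\<close>

lemma Y_lam:
  "derives W Y lam4 (\<lambda>z. - (real 1 * e 0 1 z * lam4 z))"
  "derives W Y lam5 (\<lambda>z. - (real 1 * e 0 1 z * lam5 z))"
  "derives W Y lam6 (\<lambda>z. - (real 2 * e 0 1 z * lam6 z))"
  "derives W Y lam7 (\<lambda>z. - (real 2 * e 0 1 z * lam7 z))"
  "derives W Y lam8 (\<lambda>z. - (real 2 * e 0 1 z * lam8 z))"
  "derives W Y lam9 (\<lambda>z. - (real 2 * e 0 1 z * lam9 z))"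
  "derives W Y lam10 (\<lambda>z. - (real 2 * e 0 1 z * lam10 z))"
  "derives W Y lam11 (\<lambda>z. - (real 2 * e 0 1 z * lam11 z))"
  "derives W Y lam12 (\<lambda>z. - (real 0 * e 0 1 z * lam12 z))"
  "derives W Y lam13 (\<lambda>z. - (real 0 * e 0 1 z * lam13 z))"
  "derives W Y lam14 (\<lambda>z. - (real 1 * e 0 1 z * lam14 z))"
  "derives W Y lam15 (\<lambda>z. - (real 1 * e 0 1 z * lam15 z))"
  "derives W Y lam16 (\<lambda>z. - (real 1 * e 0 1 z * lam16 z))"
  "derives W Y lam17 (\<lambda>z. - (real 1 * e 0 1 z * lam17 z))"
  "derives W Y lam18 (\<lambda>z. - (real 1 * e 0 1 z * lam18 z))"
  "derives W Y lam19 (\<lambda>z. - (real 0 * e 0 1 z * lam19 z))"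
  "derives W Y lam20 (\<lambda>z. - (real 0 * e 0 1 z * lam20 z))"
  unfolding lam_defs
  by (rule derives_cong, (rule derives_Y_intros)+, simp add: field_simps numeral_2_eq_2 numeral_3_eq_3)+

end

section \<open>Invariants and invariant differentiation operators\<close>

lemma local_function_cdivide: "local_function C U F \<Longrightarrow> local_function C U (\<lambda>z. F z / a)"
  using local_function_mult[OF _ local_function_const[OF local_function_cylinder], of C U F F "inverse a"]
  by (simp add: divide_inverse)

lemma jet_coords_mono: "s \<le> t \<Longrightarrow> jet_coords s \<subseteq> jet_coords t"
  unfolding jet_coords_def by auto

lemma Indep_in_jet_coords [simp]: "Indep i \<in> jet_coords s"
  and Dep_in_jet_coords [simp]: "Dep J \<in> jet_coords s \<longleftrightarrow> size J \<le> s"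
  by (auto simp: jet_coords_def)

lemma local_function_total_deriv:
  assumes F: "local_function (jet_coords s) U F"
  shows "local_function (jet_coords (Suc s)) U (total_deriv k F)"
proof -
  have sub: "jet_coords s \<subseteq> jet_coords (Suc s)" by (simp add: jet_coords_mono)
  note cyl = cylinder_mono[OF local_function_cylinder[OF F] sub]
  have "local_function (jet_coords (Suc s)) U (tfield k c)" if "c \<in> jet_coords s" for c
    using that by (cases c)
      (auto intro!: local_function_const[OF cyl] local_function_coord[OF cyl])
  then have "local_function (jet_coords (Suc s)) U (\<lambda>z. \<Sum>c\<in>jet_coords s. tfield k c z * pd c F z)"
    by (intro local_function_sum[OF cyl] local_function_mult local_function_mono[OF local_function_pd[OF F] sub])
  then show ?thesis
    by (rule local_function_cong)
      (simp add: total_deriv_vfield[OF finitary_onI[OF finite_jet_coords F]] vfield_eq_sum[OF F finite_jet_coords])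
qed

lemma local_function_Dx:
  assumes F: "local_function (jet_coords s) U F"
  shows "local_function (jet_coords (Suc s)) U (Dx F)"
proof -
  have "cylinder (jet_coords (Suc s)) U"
    using cylinder_mono[OF local_function_cylinder[OF F] jet_coords_mono] by simp
  note coord = local_function_coord[OF this]
  show ?thesis
    unfolding Dx_def[abs_def]
    by (intro local_function_add local_function_mult local_function_total_deriv[OF F] coord)
      (auto simp: jet_coords_def)
qed

lemma local_function_fder:
  "cylinder (jet_coords s) U \<Longrightarrow> length ks \<le> s \<Longrightarrow> local_function (jet_coords s) U (fder ks)"
  using local_function_coord[of "jet_coords s" U "Dep (mset ks)"]
  by (simp add: fder_def[abs_def] jet_coords_def)

lemma local_function_Dx_fder:
  "cylinder (jet_coords 2) U \<Longrightarrow> length ks \<le> 2 \<Longrightarrow> local_function (jet_coords 3) U (Dx (fder ks))"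
  using local_function_Dx[OF local_function_fder, of 2 U ks] by (simp add: eval_nat_numeral)

lemma local_function_Dx_Dx_fder:
  "cylinder (jet_coords 1) U \<Longrightarrow> length ks \<le> 1 \<Longrightarrow> local_function (jet_coords 3) U (Dx (Dx (fder ks)))"
  using local_function_Dx[OF local_function_Dx[OF local_function_fder], of 1 U ks] by (simp add: eval_nat_numeral)

lemmas local_function_intros = local_function_cdivide local_function_const local_function_add
  local_function_diff local_function_minus local_function_mult local_function_power
  local_function_fder local_function_Dx_fder local_function_Dx_Dx_fder

lemma prolongation_generator:
  assumes "generator V \<eta>" "cylinder C U" "finite C"
  shows "prolongation (U \<inter> V) \<eta>"
proof
  let ?C = "C \<union> {Indep Vx, Indep Vy}"
  have \<eta>: "local_function {Indep Vx, Indep Vy} V \<eta>" using assms(1) by (simp add: generator_def)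
  have "cylinder ?C (U \<inter> V)"
    using cylinder_mono[OF assms(2), of ?C] cylinder_mono[OF local_function_cylinder[OF \<eta>], of ?C]
    by (intro cylinder_Int) auto
  then have "local_function ?C (U \<inter> V) \<eta>"
    using local_function_restrict[OF local_function_mono[OF \<eta>]] by auto
  then show "finitary_on (U \<inter> V) \<eta>" by (rule finitary_onI[rotated]) (simp add: assms(3))
  show "pd c \<eta> z = 0" if "z \<in> U \<inter> V" "c \<noteq> Indep Vx" "c \<noteq> Indep Vy" for z c
    using local_function_pd_eq_0[OF \<eta>] that by auto
qed

lemma (in prolongation) e_0_1: "z \<in> W \<Longrightarrow> e 0 1 z = pd (Indep Vy) \<eta> z"
  by (simp add: eta_deriv_def total_deriv_def pd_eta)

text \<open>Infinitesimal form of multiplication by the power \<open>- w\<close> of the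
  \<open>y\<close>-derivative of the transformation \<open>\<psi>\<close>: the factor
  \<open>eta_deriv \<eta> 0 1\<close> is the \<open>y\<close>-derivative of
  \<open>\<eta>\<close>.\<close>

definition has_weight :: "nat \<Rightarrow> (jet \<Rightarrow> real) \<Rightarrow> bool" where
  "has_weight w F \<longleftrightarrow> local_function (jet_coords 3) UNIV F \<and>
     (\<forall>W \<eta>. prolongation W \<eta> \<longrightarrow>
        derives W (vfield (gfield \<eta>)) F (\<lambda>z. - (real w * eta_deriv \<eta> 0 1 z * F z)))"

lemma relative_invariant_weight:
  assumes "has_weight w F"
  shows "relative_invariant 3 UNIV F"
  unfolding relative_invariant_def differential_function_def
proof (intro conjI allI impI)
  show F: "local_function (jet_coords 3) UNIV F" using assms by (simp add: has_weight_def)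
  fix V \<eta> assume gen: "generator V \<eta>"
  then have \<eta>: "local_function {Indep Vx, Indep Vy} V \<eta>" by (simp add: generator_def)
  interpret prolongation "UNIV \<inter> V" \<eta>
    by (rule prolongation_generator[OF gen cylinder_UNIV finite.emptyI])
  have "local_function (jet_coords 3) V (pd (Indep Vy) \<eta>)"
    by (rule local_function_mono[OF local_function_pd[OF \<eta>]]) (simp add: jet_coords_def)
  then have "local_function (jet_coords 3) V (\<lambda>z. - (real w * pd (Indep Vy) \<eta> z))"
    by (intro local_function_minus local_function_mult local_function_const) (auto intro: local_function_cylinder)
  moreover have "prolonged 3 \<eta> F z = - (real w * pd (Indep Vy) \<eta> z) * F z" if "z \<in> V" for z
  proof -
    have "derives (UNIV \<inter> V) Y F (\<lambda>z. - (real w * e 0 1 z * F z))"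
      using assms prolongation_axioms unfolding has_weight_def by blast
    from derivesD(3)[OF this, of z] show ?thesis
      using that prolonged_vfield[OF F, of z \<eta>] e_0_1[of z] by simp
  qed
  ultimately show "\<exists>\<mu>. local_function (jet_coords 3) (UNIV \<inter> V) \<mu> \<and>
      (\<forall>z\<in>UNIV \<inter> V. prolonged 3 \<eta> F z = \<mu> z * F z)"
    by auto
qed

lemma differential_invariantI:
  assumes F: "local_function (jet_coords s) U F"
    and Y: "\<And>W \<eta>. W \<subseteq> U \<Longrightarrow> prolongation W \<eta> \<Longrightarrow> derives W (vfield (gfield \<eta>)) F (\<lambda>_. 0)"
  shows "differential_invariant s U F"
  unfolding differential_invariant_def differential_function_def
proof (intro conjI allI impI ballI)
  fix V \<eta> z assume gen: "generator V \<eta>" and z: "z \<in> U \<inter> V"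
  interpret prolongation "U \<inter> V" \<eta>
    by (rule prolongation_generator[OF gen local_function_cylinder[OF F] finite_jet_coords])
  show "prolonged s \<eta> F z = 0"
    using derivesD(3)[OF Y[OF _ prolongation_axioms] z] z prolonged_vfield[OF F] by simp
qed (rule F)

text \<open>Weights are additive, so dividing by the \<open>w\<close>-th power of a function of
  weight one brings the weight down to 0, and weight 0 means invariance.\<close>

lemma differential_invariant_weight:
  assumes F: "has_weight w F" and G: "has_weight 1 G" and U: "cylinder (jet_coords 3) U" and nz: "\<And>z. z \<in> U \<Longrightarrow> G z \<noteq> 0"
  shows "differential_invariant 3 U (\<lambda>z. F z / G z ^ w)"
proof (rule differential_invariantI)
  show "local_function (jet_coords 3) U (\<lambda>z. F z / G z ^ w)"
    using F G nz
    by (intro local_function_divide local_function_power) (auto simp: has_weight_def intro: local_function_restrict[OF _ U])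
  fix W \<eta> assume W: "W \<subseteq> U" and p: "prolongation W \<eta>"
  have nz': "G z \<noteq> 0" if "z \<in> W" for z using that W nz by blast
  from F G p have F': "derives W (vfield (gfield \<eta>)) F (\<lambda>z. - (real w * eta_deriv \<eta> 0 1 z * F z))"
    and G': "derives W (vfield (gfield \<eta>)) G (\<lambda>z. - (real 1 * eta_deriv \<eta> 0 1 z * G z))"
    by (auto simp: has_weight_def)
  show "derives W (vfield (gfield \<eta>)) (\<lambda>z. F z / G z ^ w) (\<lambda>_. 0)"
    by (rule derives_cong[OF derives_divide[OF F' derives_power[OF G']]])
      (use nz' in simp, cases w, simp_all add: field_simps)
qed

section \<open>Weights of the given functions and invariance of their quotients\<close>

lemma local_function_lam:
  "local_function (jet_coords 3) UNIV lam4"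
  "local_function (jet_coords 3) UNIV lam5"
  "local_function (jet_coords 3) UNIV lam6"
  "local_function (jet_coords 3) UNIV lam7"
  "local_function (jet_coords 3) UNIV lam8"
  "local_function (jet_coords 3) UNIV lam9"
  "local_function (jet_coords 3) UNIV lam10"
  "local_function (jet_coords 3) UNIV lam11"
  "local_function (jet_coords 3) UNIV lam12"
  "local_function (jet_coords 3) UNIV lam13"
  "local_function (jet_coords 3) UNIV lam14"
  "local_function (jet_coords 3) UNIV lam15"
  "local_function (jet_coords 3) UNIV lam16"
  "local_function (jet_coords 3) UNIV lam17"
  "local_function (jet_coords 3) UNIV lam18"
  "local_function (jet_coords 3) UNIV lam19"
  "local_function (jet_coords 3) UNIV lam20"
  unfolding lam_defs
  by (rule local_function_intros | simp)+

lemma has_weightI: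
  assumes "local_function (jet_coords 3) UNIV F"
    and "\<And>W \<eta>. prolongation W \<eta> \<Longrightarrow>
      derives W (vfield (gfield \<eta>)) F (\<lambda>z. - (real w * eta_deriv \<eta> 0 1 z * F z))"
  shows "has_weight w F"
  using assms by (simp add: has_weight_def)

lemma has_weight_lam:
  "has_weight 1 lam4"
  "has_weight 1 lam5"
  "has_weight 2 lam6"
  "has_weight 2 lam7"
  "has_weight 2 lam8"
  "has_weight 2 lam9"
  "has_weight 2 lam10"
  "has_weight 2 lam11"
  "has_weight 0 lam12"
  "has_weight 0 lam13"
  "has_weight 1 lam14"
  "has_weight 1 lam15"
  "has_weight 1 lam16"
  "has_weight 1 lam17"
  "has_weight 1 lam18"
  "has_weight 0 lam19"
  "has_weight 0 lam20"
  by (rule has_weightI, rule local_function_lam, erule prolongation.Y_lam)+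

lemma relative_invariant_lambdas: "\<forall>l\<in>set lambdas. relative_invariant 3 UNIV l"
  unfolding lambdas_def by (auto intro: relative_invariant_weight has_weight_lam)

lemma cylinder_class_domain: "cylinder (jet_coords 3) class_domain"
  unfolding cylinder_def
proof (intro conjI ballI allI impI)
  have "open ({z :: jet. z c \<noteq> 0})" for c
    using open_vimage[OF open_Compl[OF closed_singleton[of "0::real"]] continuous_on_product_coordinates[of c]]
    by (simp add: vimage_def Compl_eq)
  then have "open ({z. f44 z \<noteq> 0} \<inter> {z. f444 z \<noteq> 0})"
    unfolding fder_def by (intro open_Int)
  then show "open class_domain" by (simp add: class_domain_def Collect_conj_eq)
qed (auto simp: class_domain_def fder_def jet_coords_def)

lemma differential_invariant_alphas: "\<forall>a\<in>set alphas. differential_invariant 3 class_domain a"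
proof -
  have nz: "lam4 z \<noteq> 0" if "z \<in> class_domain" for z using that by (simp add: class_domain_def lam4_def)
  note W = differential_invariant_weight[OF _ has_weight_lam(1) cylinder_class_domain nz]
  have "differential_invariant 3 class_domain (\<lambda>z. z (Indep Vx))"
  proof (rule differential_invariantI)
    fix W \<eta> assume "prolongation W \<eta>"
    then interpret prolongation W \<eta> .
    show "derives W Y (\<lambda>z. z (Indep Vx)) (\<lambda>_. 0)"
      using derives_coord[OF deriv_Y, of "Indep Vx"] by simp
  qed (simp add: local_function_coord[OF cylinder_class_domain])
  then show ?thesis
    unfolding alphas_def
    using W[OF has_weight_lam(2)] W[OF has_weight_lam(3)] W[OF has_weight_lam(4)] W[OF has_weight_lam(5)]
      W[OF has_weight_lam(6)] W[OF has_weight_lam(7)] W[OF has_weight_lam(8)] W[OF has_weight_lam(9)]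
      W[OF has_weight_lam(10)] W[OF has_weight_lam(11)] W[OF has_weight_lam(12)] W[OF has_weight_lam(13)]
      W[OF has_weight_lam(14)] W[OF has_weight_lam(15)] W[OF has_weight_lam(16)] W[OF has_weight_lam(17)]
    by simp
qed

text \<open>The hypothesis says that \<open>Y\<close> applied to a coefficient equals the operator
  applied to the corresponding component \<open>xi\<close>. This cancels the commutators of
  \<open>Y\<close> with the total derivatives, so the operator commutes with \<open>Y\<close> and
  preserves the equation \<open>Y I = 0\<close>.\<close>

lemma invariant_diff_opI:
  assumes D: "\<And>k. local_function (jet_coords r) U (D k)"
    and YD: "\<And>W \<eta> i. W \<subseteq> U \<Longrightarrow> prolongation W \<eta> \<Longrightarrow>
      derives W (vfield (gfield \<eta>)) (D i) (\<lambda>z. \<Sum>k\<in>UNIV. D k z * total_deriv k (xi \<eta> i) z)"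
  shows "invariant_diff_op r U D"
  unfolding invariant_diff_op_def differential_function_def
proof (intro conjI allI impI)
  fix s W I assume inv: "differential_invariant s W I"
  then have I: "local_function (jet_coords s) W I"
    by (simp add: differential_invariant_def differential_function_def)
  \<comment> \<open>A common order for the coefficients, of order \<open>r\<close>, and the total
    derivatives of \<open>I\<close>, of order \<open>s + 1\<close>.\<close>
  define t where "t = Suc (max r s)"
  have cyl: "cylinder (jet_coords t) (U \<inter> W)"
    using cylinder_mono[OF local_function_cylinder[OF D] jet_coords_mono[of r t]]
      cylinder_mono[OF local_function_cylinder[OF I] jet_coords_mono[of s t]]
    by (intro cylinder_Int) (auto simp: t_def)
  have "local_function (jet_coords t) (U \<inter> W) (D k)" for k
    by (rule local_function_restrict[OF local_function_mono[OF D] cyl]) (auto simp: t_def intro!: jet_coords_mono)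
  moreover have "local_function (jet_coords t) (U \<inter> W) (total_deriv k I)" for k
    by (rule local_function_restrict[OF local_function_mono[OF local_function_total_deriv[OF I]] cyl])
      (auto simp: t_def intro!: jet_coords_mono)
  ultimately have lf: "local_function (jet_coords t) (U \<inter> W) (apply_op D I)"
    unfolding apply_op_def[abs_def] by (intro local_function_sum[OF cyl] local_function_mult)
  have "prolonged t \<eta> (apply_op D I) z = 0" if gen: "generator V \<eta>" and z: "z \<in> U \<inter> W \<inter> V" for V \<eta> z
  proof -
    interpret prolongation "U \<inter> W \<inter> V" \<eta>
      by (rule prolongation_generator[OF gen cyl finite_jet_coords])
    have cyl': "cylinder (jet_coords t \<union> {Indep Vx, Indep Vy}) (U \<inter> W \<inter> V)"
      by (rule cylinder_Int[OF cylinder_mono[OF cyl]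
            cylinder_mono[OF local_function_cylinder[OF gen[unfolded generator_def]]]]) auto
    have fin: "finitary_on (U \<inter> W \<inter> V) I"
      by (rule finitary_onI[OF _ local_function_restrict[OF local_function_mono[OF I] cyl']])
        (use jet_coords_mono[of s t] in \<open>auto simp: t_def finite_jet_coords le_SucI\<close>)
    have YI: "Y I w = 0" if "w \<in> U \<inter> W \<inter> V" for w
      using inv gen that prolonged_vfield[OF I] by (auto simp: differential_invariant_def)
    note YD' = YD[OF _ prolongation_axioms]
    have "Y (total_deriv k I) z = - (\<Sum>i\<in>UNIV. total_deriv k (xi \<eta> i) z * total_deriv i I z)" for k
      using Y_total_deriv[OF fin z, of k]
        derivation_on_cong[OF deriv_TD derivation_on_finitary[OF deriv_Y fin] z, of "\<lambda>_. 0" k] YI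
      by (simp add: total_deriv_def[of _ "\<lambda>_. 0"] pd_const)
    note YI' = this
    have YDk: "derives (U \<inter> W \<inter> V) Y (D k) (\<lambda>z. \<Sum>j\<in>UNIV. D j z * total_deriv j (xi \<eta> k) z)" for k
      by (rule YD') auto
    have "Y (apply_op D I) z = (\<Sum>k\<in>UNIV. Y (\<lambda>z. D k z * total_deriv k I z) z)"
      unfolding apply_op_def[abs_def]
      by (rule vfield_sum[OF _ _ z]) (auto intro: finitary_on_mult finitary_TD fin derivesD(1)[OF YDk])
    also have "\<dots> = (\<Sum>k\<in>UNIV. (\<Sum>j\<in>UNIV. D j z * total_deriv j (xi \<eta> k) z) * total_deriv k I z
        + D k z * - (\<Sum>i\<in>UNIV. total_deriv k (xi \<eta> i) z * total_deriv i I z))"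
      using vfield_mult[OF derivesD(1)[OF YDk] finitary_TD[OF fin] z] derivesD(3)[OF YDk z] YI'
      by simp
    also have "\<dots> = 0"
      by (simp add: UNIV_var algebra_simps)
    finally show ?thesis using prolonged_vfield[OF lf] z by simp
  qed
  with lf show "\<exists>s'. differential_invariant s' (U \<inter> W) (apply_op D I)"
    unfolding differential_invariant_def differential_function_def by blast
qed (rule D)

lemma invariant_inv_ops: "\<forall>D\<in>set inv_ops. invariant_diff_op 3 class_domain D"
proof
  fix D assume D: "D \<in> set inv_ops"
  have nz: "f44 z \<noteq> 0" if "z \<in> class_domain" for z using that by (simp add: class_domain_def)
  show "invariant_diff_op 3 class_domain D"
  proof (rule invariant_diff_opI)
    note [intro!] = local_function_divide local_function_const local_function_add
      local_function_mult local_function_power local_function_fder[OF cylinder_class_domain]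
      local_function_coord[OF cylinder_class_domain] cylinder_class_domain nz
    show "local_function (jet_coords 3) class_domain (D k)" for k
      using D by (cases k) (auto simp: inv_ops_def)
    fix W \<eta> i assume W: "W \<subseteq> class_domain" and "prolongation W \<eta>"
    then interpret prolongation W \<eta> by simp
    have nz': "f44 z \<noteq> 0" if "z \<in> W" for z using that W nz by blast
    have TD0: "total_deriv k (\<lambda>z. 0) z = 0" for k z by (simp add: total_deriv_def pd_const)
    have xi_x: "xi \<eta> Vx = (\<lambda>z. 0)" by simp
    note TD = UNIV_var xi_e xi_x TD0 TD_e_0[THEN derivesD(3)]
      TD_e_1[THEN derivesD(3), unfolded One_nat_def] TD_e_2[THEN derivesD(3)]
    note Y_const = derives_const[OF deriv_Y]
    note Y_intros = derives_divide[OF _ Y_fqq nz'] Y_const derives_mult derives_add derives_power Y_fq Y_fp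
    from D consider (1) "D = inv_ops ! 0" | (2) "D = inv_ops ! 1" | (3) "D = inv_ops ! 2" | (4) "D = inv_ops ! 3"
      by (auto simp: inv_ops_def)
    then show "derives W Y (D i) (\<lambda>z. \<Sum>k\<in>UNIV. D k z * total_deriv k (xi \<eta> i) z)"
    proof cases
      case 4
      \<comment> \<open>This operator is \<open>Dx\<close>, with coefficients
        \<open>1, p, q, f\<close>. The criterion says that \<open>Y\<close> maps them to
        \<open>Dx\<close> of the components \<open>xi\<close>, which is
        \<open>Dx_xi\<close>.\<close>
      have "derives W Y (D i) (\<lambda>z. case i of Vx \<Rightarrow> 0 | Vy \<Rightarrow> xi \<eta> Vp z | Vp \<Rightarrow> xi \<eta> Vq z | Vq \<Rightarrow> zeta \<eta> [] z)"
        using Y_const[of 1] derives_coord[OF deriv_Y, of "Indep Vp"] derives_coord[OF deriv_Y, of "Indep Vq"]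
          derives_coord[OF deriv_Y, of "Dep {#}"]
        by (cases i) (simp_all add: 4 inv_ops_def index_list_def)
      then show ?thesis
        by (rule derives_cong) (simp add: 4 inv_ops_def UNIV_var Dx_xi[symmetric] Dx_def del: xi.simps)
    qed (cases i; simp add: inv_ops_def del: xi.simps of_nat_numeral; rule derives_cong, (rule Y_intros)+;
        simp add: TD nz' field_simps power2_eq_square del: xi.simps)+
  qed
qed

text \<open>Read in the order \<open>x, y, p, q\<close>, the coefficient matrix is triangular, with
  diagonal entries 1, \<open>9 / f44\<close>, \<open>3 / f44\<close> and
  \<open>1 / f44\<close>.\<close>

lemma independent_inv_ops: "independent_ops class_domain inv_ops"
  unfolding independent_ops_def
proof (intro ballI allI impI)
  fix z :: jet and c :: "nat \<Rightarrow> real" and i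
  assume z: "z \<in> class_domain" and c: "\<forall>k. (\<Sum>i<length inv_ops. c i * (inv_ops ! i) k z) = 0" and i: "i < length inv_ops"
  have nz: "f44 z \<noteq> 0" using z by (simp add: class_domain_def)
  have len: "{..<length inv_ops} = {0, 1, 2, 3}" by (auto simp: inv_ops_def)
  have c3: "c 3 = 0" using c[rule_format, of Vx] unfolding len by (simp add: inv_ops_def)
  have c2: "c 2 = 0" using c[rule_format, of Vy] c3 nz unfolding len by (simp add: inv_ops_def)
  have c1: "c 1 = 0" using c[rule_format, of Vp] c3 c2 nz unfolding len by (simp add: inv_ops_def)
  have c0: "c 0 = 0" using c[rule_format, of Vq] c3 c2 c1 nz unfolding len by (simp add: inv_ops_def)
  have "i \<in> {0, 1, 2, 3}" using i len by blast
  then show "c i = 0" using c0 c1 c2 c3 by auto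
qed

section \<open>Triangular changes of coordinates\<close>

text \<open>
  In \<open>(c, F) # T\<close> the function \<open>F\<close> becomes the new coordinate \<open>c\<close>. It may involve every old coordinate
  except those replaced later, so \<open>solve\<close> recovers the old coordinates from left to right.
\<close>

fun tri_ok :: "'i set \<Rightarrow> ('i \<Rightarrow> real) set \<Rightarrow> ('i \<times> (('i \<Rightarrow> real) \<Rightarrow> real)) list \<Rightarrow> bool" where
  "tri_ok C \<Omega> [] \<longleftrightarrow> True"
| "tri_ok C \<Omega> ((c, F) # T) \<longleftrightarrow> c \<in> C \<and> c \<notin> fst ` set T \<and> local_function (C - fst ` set T) \<Omega> F \<and>
     cylinder (C - insert c (fst ` set T)) \<Omega> \<and>
     (\<forall>z\<in>\<Omega>. \<exists>k. k \<noteq> 0 \<and> (\<forall>t. F (z(c := t)) = F z + k * (t - z c))) \<and> tri_ok C \<Omega> T"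

text \<open>As \<open>F\<close> is affine in \<open>c\<close>, its slope and intercept are read off its values at \<open>c = 0\<close> and \<open>c = 1\<close>.\<close>

fun solve :: "('i \<times> (('i \<Rightarrow> real) \<Rightarrow> real)) list \<Rightarrow> ('i \<Rightarrow> real) \<Rightarrow> ('i \<Rightarrow> real) \<Rightarrow> 'i \<Rightarrow> real" where
  "solve [] w z = z"
| "solve ((c, F) # T) w z =
     solve T w (z(c := (w c - F (z(c := 0))) / (F (z(c := 1)) - F (z(c := 0)))))"

definition straighten :: "('i \<times> (('i \<Rightarrow> real) \<Rightarrow> real)) list \<Rightarrow> ('i \<Rightarrow> real) \<Rightarrow> 'i \<Rightarrow> real" where
  "straighten T z c = (case map_of T c of Some F \<Rightarrow> F z | None \<Rightarrow> z c)"

lemma cylinder_agree: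
  "cylinder C U \<Longrightarrow> z \<in> U \<Longrightarrow> (\<And>c. c \<in> C \<Longrightarrow> z' c = z c) \<Longrightarrow> z' \<in> U"
  unfolding cylinder_def by blast

lemma tri_ok_local_function:
  "tri_ok C \<Omega> T \<Longrightarrow> (c, F) \<in> set T \<Longrightarrow> local_function C \<Omega> F"
proof (induction C \<Omega> T rule: tri_ok.induct)
  case (2 C \<Omega> c' F' T)
  from 2(2) have F': "local_function (C - fst ` set T) \<Omega> F'" and T: "tri_ok C \<Omega> T"
    unfolding tri_ok.simps by blast+
  from 2(3) consider "F = F'" | "(c, F) \<in> set T" by auto
  then show ?case
  proof cases
    case 1
    then show ?thesis using local_function_mono[OF F' Diff_subset] by (simp only:)
  qed (rule 2(1)[OF T])
qed simp

text \<open>The condition of \<open>tri_ok\<close> with the admissible coordinates accumulated from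
  the left instead of removed on the right. For a concrete list the obligations become memberships
  in an explicit finite set.\<close>

fun tri_chain :: "'i set \<Rightarrow> ('i \<Rightarrow> real) set \<Rightarrow> ('i \<times> (('i \<Rightarrow> real) \<Rightarrow> real)) list \<Rightarrow> bool" where
  "tri_chain D \<Omega> [] \<longleftrightarrow> True"
| "tri_chain D \<Omega> ((c, F) # T) \<longleftrightarrow> local_function (insert c D) \<Omega> F \<and> cylinder D \<Omega> \<and>
     (\<forall>z\<in>\<Omega>. \<exists>k. k \<noteq> 0 \<and> (\<forall>t. F (z(c := t)) = F z + k * (t - z c))) \<and> tri_chain (insert c D) \<Omega> T"

lemma tri_chain_imp_tri_ok:
  "tri_chain D \<Omega> T \<Longrightarrow> distinct (map fst T) \<Longrightarrow> D \<inter> fst ` set T = {} \<Longrightarrow> tri_ok (D \<union> fst ` set T) \<Omega> T"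
proof (induction D \<Omega> T rule: tri_chain.induct)
  case (2 D \<Omega> c F T)
  from 2(2) have F: "local_function (insert c D) \<Omega> F" and D: "cylinder D \<Omega>"
    and aff: "\<forall>z\<in>\<Omega>. \<exists>k. k \<noteq> 0 \<and> (\<forall>t. F (z(c := t)) = F z + k * (t - z c))" and T: "tri_chain (insert c D) \<Omega> T"
    unfolding tri_chain.simps by blast+
  from 2(3,4) have c: "c \<notin> fst ` set T" "insert c D \<inter> fst ` set T = {}" "distinct (map fst T)" by auto
  have set: "D \<union> fst ` set ((c, F) # T) = insert c D \<union> fst ` set T" by auto
  show ?case
    unfolding set tri_ok.simps
  proof (intro conjI)
    show "tri_ok (insert c D \<union> fst ` set T) \<Omega> T" by (rule 2(1)[OF T c(3,2)])
    show "local_function (insert c D \<union> fst ` set T - fst ` set T) \<Omega> F"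
      by (rule local_function_mono[OF F]) (use c in blast)
    show "cylinder (insert c D \<union> fst ` set T - insert c (fst ` set T)) \<Omega>"
      by (rule cylinder_mono[OF D]) (use 2(4) in auto)
  qed (use c aff in blast)+
qed simp

lemma tri_ok_distinct: "tri_ok C \<Omega> T \<Longrightarrow> distinct (map fst T)"
  by (induction T rule: tri_ok.induct) auto

lemma affine_solve:
  fixes F :: "('i \<Rightarrow> real) \<Rightarrow> real"
  assumes "k \<noteq> 0" "\<And>t. F (z(c := t)) = F z + k * (t - z c)"
  shows "F (z(c := (a - F (z(c := 0))) / (F (z(c := 1)) - F (z(c := 0))))) = a"
    and "(F z - F (z(c := 0))) / (F (z(c := 1)) - F (z(c := 0))) = z c"
    and "F (z(c := 1)) - F (z(c := 0)) \<noteq> 0"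
  unfolding assms(2) using assms(1) by (simp_all add: field_simps)

text \<open>The induction has to start from a vector \<open>z'\<close> that may be wrong in all
  coordinates still to be recovered. The first function sees only its own coordinate and correct
  ones, so dividing by the slope returns the true value.\<close>

lemma solve_straighten_aux:
  assumes "tri_ok C \<Omega> T" "z \<in> \<Omega>" "\<And>c F. (c, F) \<in> set T \<Longrightarrow> w c = F z"
    and "\<And>c. c \<notin> fst ` set T \<Longrightarrow> z' c = z c"
  shows "solve T w z' = z"
  using assms
proof (induction C \<Omega> T arbitrary: z' rule: tri_ok.induct)
  case (2 C \<Omega> c F T)
  then have F: "local_function (C - fst ` set T) \<Omega> F" "cylinder (C - insert c (fst ` set T)) \<Omega>" by auto
  obtain k where k: "k \<noteq> 0" "\<And>t. F (z(c := t)) = F z + k * (t - z c)" using 2(2,3) by auto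
  have eq: "F (z'(c := t)) = F (z(c := t))" for t
  proof (rule local_function_agree[OF F(1)])
    show "z(c := t) \<in> \<Omega>" by (rule cylinder_agree[OF F(2) 2(3)]) auto
  qed (use 2(5) in auto)
  have "w c = F z" using 2(4) by simp
  then have "solve ((c, F) # T) w z' = solve T w (z'(c := z c))"
    by (simp only: solve.simps eq affine_solve(2)[OF k])
  also have "\<dots> = z"
    using 2(2-5) by (intro 2(1)) auto
  finally show ?case .
qed auto

text \<open>Later steps change only coordinates on which the current function does not depend, so an
  equation once solved stays solved.\<close>

lemma solve_correct:
  assumes "tri_ok C \<Omega> T" "z \<in> \<Omega>"
  shows "solve T w z \<in> \<Omega>" "c \<notin> fst ` set T \<Longrightarrow> solve T w z c = z c"
    "(c, F) \<in> set T \<Longrightarrow> F (solve T w z) = w c"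
proof -
  have "solve T w z \<in> \<Omega> \<and> (\<forall>c. c \<notin> fst ` set T \<longrightarrow> solve T w z c = z c) \<and>
      (\<forall>(c, F)\<in>set T. F (solve T w z) = w c)"
    using assms
  proof (induction C \<Omega> T arbitrary: z rule: tri_ok.induct)
    case (2 C \<Omega> c F T)
    then have F: "local_function (C - fst ` set T) \<Omega> F" "cylinder (C - insert c (fst ` set T)) \<Omega>" by auto
    obtain k where k: "k \<noteq> 0" "\<And>t. F (z(c := t)) = F z + k * (t - z c)" using 2(2,3) by auto
    define z1 where "z1 = z(c := (w c - F (z(c := 0))) / (F (z(c := 1)) - F (z(c := 0))))"
    have z1: "z1 \<in> \<Omega>" unfolding z1_def by (rule cylinder_agree[OF F(2) 2(3)]) auto
    have IH: "solve T w z1 \<in> \<Omega>" "\<And>c. c \<notin> fst ` set T \<Longrightarrow> solve T w z1 c = z1 c"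
      "\<forall>(c, F)\<in>set T. F (solve T w z1) = w c"
      using 2(1)[of z1] 2(2) z1 by auto
    have "F (solve T w z1) = F z1"
      by (rule local_function_agree[OF F(1) z1]) (use IH(2) in auto)
    also have "\<dots> = w c" unfolding z1_def by (rule affine_solve(1)[OF k])
    finally have "F (solve T w z1) = w c" .
    moreover have "solve ((c, F) # T) w z = solve T w z1" by (simp add: z1_def)
    moreover have "solve T w z1 d = z d" if "d \<notin> insert c (fst ` set T)" for d
      using IH(2)[of d] that by (simp add: z1_def)
    ultimately show ?case using IH by auto
  qed auto
  then show "solve T w z \<in> \<Omega>" "c \<notin> fst ` set T \<Longrightarrow> solve T w z c = z c"
    "(c, F) \<in> set T \<Longrightarrow> F (solve T w z) = w c" by auto
qed

lemma straighten_solve: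
  assumes "tri_ok C \<Omega> T" "w \<in> \<Omega>"
  shows "straighten T (solve T w w) = w"
proof
  fix c
  show "straighten T (solve T w w) c = w c"
  proof (cases "map_of T c")
    case None
    then have "c \<notin> fst ` set T" by (simp add: map_of_eq_None_iff)
    then show ?thesis using solve_correct(2)[OF assms] None by (simp add: straighten_def)
  next
    case (Some F)
    then show ?thesis
      using solve_correct(3)[OF assms map_of_SomeD[OF Some]] by (simp add: straighten_def)
  qed
qed

lemma solve_straighten:
  assumes "tri_ok C \<Omega> T" "z \<in> \<Omega>"
  shows "solve T (straighten T z) (straighten T z) = z"
proof (rule solve_straighten_aux[OF assms])
  show "straighten T z c = F z" if "(c, F) \<in> set T" for c F
    using that map_of_is_SomeI[OF tri_ok_distinct[OF assms(1)]] by (simp add: straighten_def)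
  show "straighten T z c = z c" if "c \<notin> fst ` set T" for c
    using that by (simp add: straighten_def map_of_eq_None_iff[symmetric])
qed

lemma smooth_on_divide:
  "open V \<Longrightarrow> smooth_on V F \<Longrightarrow> smooth_on V G \<Longrightarrow> (\<And>z. z \<in> V \<Longrightarrow> G z \<noteq> 0) \<Longrightarrow> smooth_on V (\<lambda>z. F z / G z)"
  unfolding divide_inverse by (intro smooth_on_mult smooth_on_inverse)

lemma smooth_on_diff:
  "open V \<Longrightarrow> smooth_on V F \<Longrightarrow> smooth_on V G \<Longrightarrow> smooth_on V (\<lambda>z. F z - G z)"
  using smooth_on_add[of V F "\<lambda>z. - G z"] smooth_on_minus[of V G] by simp

lemma smooth_on_solve:
  assumes "tri_ok C \<Omega> T" "finite C" "open V"
    and "\<And>c. smooth_on V (\<lambda>x. w x c)" "\<And>c. smooth_on V (\<lambda>x. z x c)" "\<And>x. x \<in> V \<Longrightarrow> z x \<in> \<Omega>"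
  shows "smooth_on V (\<lambda>x. solve T (w x) (z x) d)"
  using assms
proof (induction C \<Omega> T arbitrary: z rule: tri_ok.induct)
  case (2 C \<Omega> c F T)
  then have F: "local_function (C - fst ` set T) \<Omega> F" "cylinder (C - insert c (fst ` set T)) \<Omega>" by auto
  define v where "v x = (w x c - F ((z x)(c := 0))) / (F ((z x)(c := 1)) - F ((z x)(c := 0)))" for x
  have upd: "(z x)(c := t) \<in> \<Omega>" if "x \<in> V" for x t
    by (rule cylinder_agree[OF F(2) 2(7)[OF that]]) auto
  have sub: "smooth_on V (\<lambda>x. F ((z x)(c := t)))" for t
  proof (rule smooth_on_comp[OF F(1) _ \<open>open V\<close>])
    show "smooth_on V (\<lambda>x. ((z x)(c := t)) d)" for d
      using 2(6) smooth_on_const[OF \<open>open V\<close>] by (cases "d = c") simp_all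
  qed (use 2(3) upd in auto)
  have nz: "F ((z x)(c := 1)) - F ((z x)(c := 0)) \<noteq> 0" if "x \<in> V" for x
  proof -
    from 2(2) 2(7)[OF that] obtain k where "k \<noteq> 0" "\<And>t. F ((z x)(c := t)) = F (z x) + k * (t - z x c)" by auto
    then show ?thesis by (rule affine_solve(3))
  qed
  have "smooth_on V v"
    unfolding v_def[abs_def] by (intro smooth_on_divide smooth_on_diff sub nz 2 \<open>open V\<close>)
  then have "smooth_on V (\<lambda>x. ((z x)(c := v x)) d)" for d
    using 2(6) by (cases "d = c") simp_all
  then have "smooth_on V (\<lambda>x. solve T (w x) ((z x)(c := v x)) d)"
    by (intro 2(1)[OF _ 2(3,4,5) _ upd]) (use 2(2) in auto)
  then show ?case by (simp add: v_def)
qed auto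

lemma solve_agree:
  assumes "tri_ok C \<Omega> T" "z \<in> \<Omega>" "\<And>c. c \<in> C \<Longrightarrow> w' c = w c" "\<And>c. c \<in> C \<Longrightarrow> z' c = z c" "d \<in> C"
  shows "solve T w' z' d = solve T w z d"
  using assms
proof (induction C \<Omega> T arbitrary: z z' rule: tri_ok.induct)
  case (2 C \<Omega> c F T)
  then have F: "local_function (C - fst ` set T) \<Omega> F" "cylinder (C - insert c (fst ` set T)) \<Omega>" by auto
  have upd: "z(c := t) \<in> \<Omega>" for t by (rule cylinder_agree[OF F(2) 2(3)]) auto
  have eq: "F (z'(c := t)) = F (z(c := t))" for t
    by (rule local_function_agree[OF F(1) upd]) (use 2(5) in auto)
  have "w' c = w c" using 2(2,4) by auto
  then have v: "(w' c - F (z'(c := 0))) / (F (z'(c := 1)) - F (z'(c := 0))) =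
      (w c - F (z(c := 0))) / (F (z(c := 1)) - F (z(c := 0)))"
    by (simp only: eq)
  show ?case
    unfolding solve.simps v
    by (rule 2(1)[OF _ upd 2(4) _ 2(6)]) (use 2(2,5) in auto)
qed auto

lemma vfield_comp:
  assumes F: "local_function C U F" "finite C"
    and G: "\<And>c. c \<in> C \<Longrightarrow> local_function D V (\<lambda>z. G z c)" "\<And>z. z \<in> V \<Longrightarrow> G z \<in> U" "finite D"
    and H: "local_function D V (\<lambda>z. F (G z))" and z: "z \<in> V"
  shows "vfield v (\<lambda>z. F (G z)) z = (\<Sum>c\<in>C. pd c F (G z) * vfield v (\<lambda>z. G z c) z)"
proof -
  have "vfield v (\<lambda>z. F (G z)) z = (\<Sum>d\<in>D. v d z * (\<Sum>c\<in>C. pd c F (G z) * pd d (\<lambda>z. G z c) z))"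
    by (simp add: vfield_eq_sum[OF H \<open>finite D\<close> z] pd_comp[OF F local_function_smooth[OF G(1)] G(2) z])
  also have "\<dots> = (\<Sum>c\<in>C. pd c F (G z) * (\<Sum>d\<in>D. v d z * pd d (\<lambda>z. G z c) z))"
    by (simp add: sum_distrib_left sum.swap[of _ C] algebra_simps)
  finally show ?thesis by (simp add: vfield_eq_sum[OF G(1) \<open>finite D\<close> z])
qed

section \<open>Generators with prescribed derivatives at a point\<close>

lemma finitary_on_UNIV_const: "finitary_on UNIV (\<lambda>_. a)"
  by (rule finitary_onI[OF finite.emptyI]) (simp add: local_function_const)

lemma derives_UNIV_eq: "derives UNIV X F G \<Longrightarrow> X F = G"
  by (auto simp: derives_def)

lemmas derivation_on_Dx_UNIV = derivation_on_Dx[OF finitary_on_UNIV_const]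
lemmas derivation_on_TD_UNIV = derivation_on_total_deriv[OF finitary_on_UNIV_const]

lemma Dx_add_UNIV:
  "finitary_on UNIV F \<Longrightarrow> finitary_on UNIV G \<Longrightarrow> Dx (\<lambda>z. F z + G z) = (\<lambda>z. Dx F z + Dx G z)"
  using derives_UNIV_eq[OF derives_add[OF derives_self[OF derivation_on_Dx_UNIV] derives_self[OF derivation_on_Dx_UNIV]]]
  by blast

lemma Dx_mult_UNIV:
  "finitary_on UNIV F \<Longrightarrow> finitary_on UNIV G \<Longrightarrow> Dx (\<lambda>z. F z * G z) = (\<lambda>z. Dx F z * G z + F z * Dx G z)"
  using derives_UNIV_eq[OF derives_mult[OF derives_self[OF derivation_on_Dx_UNIV] derives_self[OF derivation_on_Dx_UNIV]]]
  by blast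

lemma finitary_Dx_pow: "finitary_on UNIV F \<Longrightarrow> finitary_on UNIV ((Dx ^^ n) F)"
  by (induction n) (auto intro: derivation_on_finitary[OF derivation_on_Dx_UNIV])

lemma Dx_pow_add:
  "finitary_on UNIV F \<Longrightarrow> finitary_on UNIV G \<Longrightarrow>
    (Dx ^^ n) (\<lambda>z. F z + G z) = (\<lambda>z. (Dx ^^ n) F z + (Dx ^^ n) G z)"
  by (induction n) (simp_all add: Dx_add_UNIV finitary_Dx_pow)

text \<open>Functions vanishing at \<open>z\<close> to order \<open>n\<close> along
  \<open>Dx\<close> form an ideal. By Leibniz one step leaves two products, each with a factor that
  vanishes to one order less.\<close>

lemma Dx_pow_mult_vanish:
  assumes "finitary_on UNIV F" "finitary_on UNIV G" "\<And>i. i \<le> n \<Longrightarrow> (Dx ^^ i) F z = 0" "i \<le> n"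
  shows "(Dx ^^ i) (\<lambda>z. F z * G z) z = 0"
  using assms
proof (induction n arbitrary: F G i)
  case 0
  then show ?case using 0(3)[of 0] by simp
next
  case (Suc n)
  note fin = Suc.prems(1,2) derivation_on_finitary[OF derivation_on_Dx_UNIV Suc.prems(1)]
    derivation_on_finitary[OF derivation_on_Dx_UNIV Suc.prems(2)]
  show ?case
  proof (cases i)
    case 0
    then show ?thesis using Suc.prems(3)[of 0] by simp
  next
    case (Suc j)
    have "(Dx ^^ j) (\<lambda>z. Dx F z * G z) z = 0"
      using Suc.prems(3)[of "Suc i" for i] Suc.prems(4) Suc fin
      by (intro Suc.IH) (auto simp: funpow_swap1)
    moreover have "(Dx ^^ j) (\<lambda>z. F z * Dx G z) z = 0"
      using Suc.prems(3) Suc.prems(4) Suc fin by (intro Suc.IH) auto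
    ultimately show ?thesis
      using Suc fin
      by (simp add: funpow_Suc_right Dx_mult_UNIV Dx_pow_add finitary_on_mult del: funpow.simps)
  qed
qed

text \<open>Divided powers, so that \<open>Dx\<close> lowers the exponent with coefficient
  1.\<close>

definition mono_x :: "jet \<Rightarrow> nat \<Rightarrow> jet \<Rightarrow> real" where
  "mono_x z\<^sub>0 a z = (z (Indep Vx) - z\<^sub>0 (Indep Vx)) ^ a / fact a"

text \<open>On the solution curve through \<open>z\<^sub>0\<close>, the derivatives of \<open>y\<close> at \<open>z\<^sub>0\<close> are given by powers of \<^const>\<open>Dx\<close>.\<close>

definition taylor_defect :: "jet \<Rightarrow> nat \<Rightarrow> jet \<Rightarrow> real" where
  "taylor_defect z\<^sub>0 n z = z (Indep Vy)
     - (\<Sum>i\<le>n. (Dx ^^ i) (\<lambda>z. z (Indep Vy)) z\<^sub>0 * mono_x z\<^sub>0 i z)"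

lemma local_function_mono_x: "local_function {Indep Vx, Indep Vy} UNIV (mono_x z\<^sub>0 a)"
  unfolding mono_x_def[abs_def]
  by (intro local_function_cdivide local_function_power local_function_diff local_function_const local_function_coord) auto

lemma local_function_taylor_defect: "local_function {Indep Vx, Indep Vy} UNIV (taylor_defect z\<^sub>0 n)"
  unfolding taylor_defect_def[abs_def]
  by (intro local_function_diff local_function_sum local_function_mult local_function_const
      local_function_coord local_function_mono_x) auto

lemma finitary_xy: "local_function {Indep Vx, Indep Vy} U F \<Longrightarrow> finitary_on U F"
  by (rule finitary_onI[of "{Indep Vx, Indep Vy}"]) simp_all

lemmas finitary_mono_x = finitary_xy[OF local_function_mono_x]
lemmas finitary_taylor_defect = finitary_xy[OF local_function_taylor_defect]

lemma derives_mono_x: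
  assumes X: "derivation_on UNIV X v"
  shows "derives UNIV X (mono_x z\<^sub>0 0) (\<lambda>z. 0)"
    "derives UNIV X (mono_x z\<^sub>0 (Suc a)) (\<lambda>z. v (Indep Vx) z * mono_x z\<^sub>0 a z)"
proof -
  have *: "derives UNIV X (mono_x z\<^sub>0 a)
      (\<lambda>z. of_nat a * (z (Indep Vx) - z\<^sub>0 (Indep Vx)) ^ (a - 1) * (v (Indep Vx) z - 0) / fact a)" for a
    unfolding mono_x_def[abs_def]
    by (intro derives_cdivide derives_power derives_diff derives_const[OF X] derives_coord[OF X])
  show "derives UNIV X (mono_x z\<^sub>0 0) (\<lambda>z. 0)"
    by (rule derives_cong[OF *]) simp
  show "derives UNIV X (mono_x z\<^sub>0 (Suc a)) (\<lambda>z. v (Indep Vx) z * mono_x z\<^sub>0 a z)"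
    by (rule derives_cong[OF *]) (simp add: mono_x_def field_simps del: of_nat_Suc)
qed

lemma Dx_pow_0: "(Dx ^^ n) (\<lambda>_. 0) = (\<lambda>_. 0)"
  using derives_UNIV_eq[OF derives_const[OF derivation_on_Dx_UNIV], of 0] by (induction n) simp_all

lemma Dx_pow_mono_x: "(Dx ^^ j) (mono_x z\<^sub>0 a) = (if j \<le> a then mono_x z\<^sub>0 (a - j) else (\<lambda>_. 0))"
proof (induction j arbitrary: a)
  case (Suc j)
  have "Dx (mono_x z\<^sub>0 a) = (if a = 0 then (\<lambda>_. 0) else mono_x z\<^sub>0 (a - 1))"
    using derives_mono_x[OF derivation_on_Dx_UNIV, THEN derives_UNIV_eq]
    by (cases a) (simp_all add: dfield_def)
  then have "(Dx ^^ Suc j) (mono_x z\<^sub>0 a) = (Dx ^^ j) (if a = 0 then (\<lambda>_. 0) else mono_x z\<^sub>0 (a - 1))"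
    by (simp only: funpow_Suc_right o_def)
  then show ?case using Suc.IH by (cases a) (auto simp: Dx_pow_0)
qed simp

lemma Dx_pow_mono_x_at: "(Dx ^^ j) (mono_x z\<^sub>0 a) z\<^sub>0 = (if j = a then 1 else 0)"
  by (auto simp: Dx_pow_mono_x mono_x_def)

lemma Dx_pow_cmult:
  "finitary_on UNIV F \<Longrightarrow> (Dx ^^ n) (\<lambda>z. a * F z) = (\<lambda>z. a * (Dx ^^ n) F z)"
proof (induction n)
  case (Suc n)
  then show ?case
    using Dx_mult_UNIV[OF finitary_on_UNIV_const finitary_Dx_pow[OF Suc.prems], of a n]
      derives_UNIV_eq[OF derives_const[OF derivation_on_Dx_UNIV], of a] by simp
qed simp

lemma Dx_pow_sum:
  "finite A \<Longrightarrow> (\<And>a. a \<in> A \<Longrightarrow> finitary_on UNIV (F a)) \<Longrightarrow>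
    (Dx ^^ n) (\<lambda>z. \<Sum>a\<in>A. F a z) = (\<lambda>z. \<Sum>a\<in>A. (Dx ^^ n) (F a) z)"
proof (induction A rule: finite_induct)
  case (insert a A)
  then show ?case
    using Dx_pow_add[of "F a" "\<lambda>z. \<Sum>a\<in>A. F a z" n] finitary_on_sum[OF finitary_on_UNIV_const, of A F] by simp
qed (simp add: Dx_pow_0)

text \<open>At the base point \<open>Dx ^^ j\<close> picks from the Taylor polynomial the
  coefficient with index \<open>j\<close>, which by construction is that of \<open>y\<close>; the
  bound ensures that this coefficient is present.\<close>

lemma taylor_defect_vanishes:
  assumes "j \<le> n"
  shows "(Dx ^^ j) (taylor_defect z\<^sub>0 n) z\<^sub>0 = 0"
proof -
  let ?y = "\<lambda>z :: jet. z (Indep Vy)"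
  have y: "finitary_on UNIV ?y" by (rule finitary_on_coord[OF finitary_on_UNIV_const])
  let ?t = "\<lambda>i z. - (Dx ^^ i) ?y z\<^sub>0 * mono_x z\<^sub>0 i z"
  have t: "finitary_on UNIV (?t i)" for i
    by (intro finitary_on_mult finitary_on_UNIV_const finitary_mono_x)
  have "taylor_defect z\<^sub>0 n = (\<lambda>z. ?y z + (\<Sum>i\<le>n. ?t i z))"
    by (simp add: taylor_defect_def fun_eq_iff sum_negf)
  then have "(Dx ^^ j) (taylor_defect z\<^sub>0 n) z\<^sub>0 = (Dx ^^ j) ?y z\<^sub>0 + (\<Sum>i\<le>n. (Dx ^^ j) (?t i) z\<^sub>0)"
    using Dx_pow_add[OF y finitary_on_sum[where A = "{..n}", OF finitary_on_UNIV_const t], of j]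
      Dx_pow_sum[where A = "{..n}" and F = ?t and n = j] t by simp
  also have "(\<Sum>i\<le>n. (Dx ^^ j) (?t i) z\<^sub>0) = (\<Sum>i\<le>n. if i = j then - (Dx ^^ j) ?y z\<^sub>0 else 0)"
    by (intro sum.cong refl) (subst Dx_pow_cmult[OF finitary_mono_x], simp add: Dx_pow_mono_x_at)
  finally show ?thesis using assms by simp
qed

definition basis_generator :: "jet \<Rightarrow> nat \<Rightarrow> nat \<Rightarrow> nat \<Rightarrow> jet \<Rightarrow> real" where
  "basis_generator z\<^sub>0 n a b z = taylor_defect z\<^sub>0 n z ^ b / fact b * mono_x z\<^sub>0 a z"

lemma generator_basis: "generator UNIV (basis_generator z\<^sub>0 n a b)"
  unfolding generator_def basis_generator_def[abs_def]
  by (intro local_function_mult local_function_cdivide local_function_power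
      local_function_taylor_defect local_function_mono_x)

text \<open>The Taylor polynomial involves \<open>x\<close> only, so \<open>D_y\<close> of the
  defect is 1 and a divided power passes to the next lower one.\<close>

lemma TDy_pow_basis_generator:
  "(total_deriv Vy ^^ j) (basis_generator z\<^sub>0 n a b) =
    (if j \<le> b then basis_generator z\<^sub>0 n a (b - j) else (\<lambda>_. 0))"
proof (induction j arbitrary: b)
  case (Suc j)
  have z: "(total_deriv Vy ^^ j) (\<lambda>_. 0) = (\<lambda>_. 0)" for j
    using derives_UNIV_eq[OF derives_const[OF derivation_on_TD_UNIV], of Vy 0] by (induction j) simp_all
  have m: "derives UNIV (total_deriv Vy) (mono_x z\<^sub>0 i) (\<lambda>_. 0)" for i
    using derives_mono_x[OF derivation_on_TD_UNIV[of Vy], of z\<^sub>0] by (cases i) simp_all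
  have "derives UNIV (total_deriv Vy) (\<lambda>z. \<Sum>i\<le>n. (Dx ^^ i) (\<lambda>z. z (Indep Vy)) z\<^sub>0 * mono_x z\<^sub>0 i z) (\<lambda>_. 0)"
  proof (induction n)
    case 0
    show ?case
      using derives_mult[OF derives_const[OF derivation_on_TD_UNIV] m[of 0]] by simp
  next
    case (Suc n)
    show ?case
      using derives_add[OF Suc derives_mult[OF derives_const[OF derivation_on_TD_UNIV] m[of "Suc n"]]] by simp
  qed
  from derives_diff[OF derives_coord[OF derivation_on_TD_UNIV, of Vy "Indep Vy"] this]
  have "derives UNIV (total_deriv Vy) (taylor_defect z\<^sub>0 n) (\<lambda>_. 1)"
    by (simp add: taylor_defect_def[abs_def])
  from derives_mult[OF derives_cdivide[OF derives_power[OF this]] m]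
  have *: "derives UNIV (total_deriv Vy) (basis_generator z\<^sub>0 n a b)
      (\<lambda>z. of_nat b * taylor_defect z\<^sub>0 n z ^ (b - 1) / fact b * mono_x z\<^sub>0 a z)" for b
    by (simp add: basis_generator_def[abs_def])
  have "total_deriv Vy (basis_generator z\<^sub>0 n a b) = (if b = 0 then (\<lambda>_. 0) else basis_generator z\<^sub>0 n a (b - 1))"
  proof (cases b)
    case 0
    then show ?thesis by (simp add: derives_UNIV_eq[OF *])
  next
    case (Suc m)
    have "of_nat (Suc m) * w / fact (Suc m) = w / fact m" for w :: real
      by (simp add: field_simps del: of_nat_Suc)
    then show ?thesis by (simp add: derives_UNIV_eq[OF *] Suc basis_generator_def fun_eq_iff del: of_nat_Suc fact_Suc)
  qed
  then have "(total_deriv Vy ^^ Suc j) (basis_generator z\<^sub>0 n a b) =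
      (total_deriv Vy ^^ j) (if b = 0 then (\<lambda>_. 0) else basis_generator z\<^sub>0 n a (b - 1))"
    by (simp only: funpow_Suc_right o_def)
  then show ?case using Suc.IH by (cases b) (auto simp: z)
qed simp

text \<open>After the \<open>y\<close>-derivatives, a remaining positive power of the defect kills
  everything up to order \<open>n\<close> at the base point. Without one, a monomial in
  \<open>x\<close> is left, on which \<open>Dx ^^ j\<close> is nonzero at the base point only for
  \<open>j = a\<close>.\<close>

lemma eta_deriv_basis_generator:
  assumes "j \<le> n"
  shows "eta_deriv (basis_generator z\<^sub>0 n a b) j b' z\<^sub>0 = (if j = a \<and> b' = b then 1 else 0)"
proof -
  have b0: "basis_generator z\<^sub>0 n a 0 = mono_x z\<^sub>0 a"
    by (simp add: basis_generator_def fun_eq_iff)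
  have van: "(Dx ^^ j) (basis_generator z\<^sub>0 n a (Suc m)) z\<^sub>0 = 0" for m
  proof -
    have eq: "basis_generator z\<^sub>0 n a (Suc m) = (\<lambda>z. taylor_defect z\<^sub>0 n z * (taylor_defect z\<^sub>0 n z ^ m / fact (Suc m) * mono_x z\<^sub>0 a z))"
      by (simp add: basis_generator_def fun_eq_iff)
    have fin: "finitary_on UNIV (\<lambda>z. taylor_defect z\<^sub>0 n z ^ m / fact (Suc m) * mono_x z\<^sub>0 a z)"
      by (intro finitary_xy local_function_mult local_function_cdivide local_function_power
        local_function_taylor_defect local_function_mono_x)
    show ?thesis
      unfolding eq by (rule Dx_pow_mult_vanish[OF finitary_taylor_defect fin taylor_defect_vanishes assms])
  qed
  show ?thesis
  proof (cases "b' \<le> b")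
    case True
    then show ?thesis
      using van[of "b - b' - 1"] b0 Dx_pow_mono_x_at[of j z\<^sub>0 a]
      by (cases "b - b'") (auto simp: eta_deriv_def TDy_pow_basis_generator)
  qed (simp add: eta_deriv_def TDy_pow_basis_generator Dx_pow_0)
qed

section \<open>Adapted coordinates on third-order jets\<close>

abbreviation dc :: "var list \<Rightarrow> coord" where "dc ks \<equiv> Dep (mset ks)"

text \<open>The leading coordinates of the invariants, in the order of \<^const>\<open>alphas\<close>.\<close>

definition lead_coords :: "coord list" where
  "lead_coords = Indep Vx # map dc
   [[Vp, Vp], [Vq, Vq, Vq], [Vp, Vq, Vq], [Vp, Vp, Vq], [Vy, Vq, Vq], [Vy, Vp, Vq], [Vy, Vy, Vq],
    [Vx, Vq], [Vx, Vp], [Vx, Vq, Vq], [Vx, Vp, Vq], [Vx, Vp, Vp], [Vx, Vy, Vq], [Vx, Vy, Vp],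
    [Vx, Vx, Vq], [Vx, Vx, Vp]]"

text \<open>
  Here \<open>Vx\<^sup>j ks\<close> with \<open>j > 0\<close> is the leading coordinate of the new coordinate \<open>Dx\<^sup>j f\<^sub>k\<^sub>s\<close>; all others are kept.
\<close>

definition free_coords :: "coord list" where
  "free_coords = [Indep Vy, Indep Vp, Indep Vq] @ map dc
   [[], [Vx], [Vx, Vx], [Vx, Vx, Vx], [Vy], [Vx, Vy], [Vx, Vx, Vy], [Vy, Vy], [Vx, Vy, Vy], [Vp],
    [Vq], [Vy, Vp], [Vy, Vq], [Vp, Vq], [Vq, Vq], [Vy, Vy, Vy], [Vy, Vy, Vp], [Vy, Vp, Vp],
    [Vp, Vp, Vp]]"

text \<open>The order is essential: a function may involve leading coordinates of earlier entries
  but not of later ones. For instance \<open>Dx (Dx (fder []))\<close> contains the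
  \<open>xy\<close>, \<open>xp\<close> and \<open>xq\<close>-derivatives of \<open>f\<close> and
  must come after them.\<close>

definition entries :: "(coord \<times> (jet \<Rightarrow> real)) list" where
  "entries =
   [(dc [Vp, Vp], alphas ! 1), (dc [Vq, Vq, Vq], alphas ! 2), (dc [Vp, Vq, Vq], alphas ! 3),
    (dc [Vp, Vp, Vq], alphas ! 4), (dc [Vy, Vq, Vq], alphas ! 5), (dc [Vy, Vp, Vq], alphas ! 6),
    (dc [Vy, Vy, Vq], alphas ! 7), (dc [Vx], Dx (fder [])), (dc [Vx, Vy], Dx (fder [Vy])),
    (dc [Vx, Vq], alphas ! 8), (dc [Vx, Vp], alphas ! 9), (dc [Vx, Vx], Dx (Dx (fder []))),
    (dc [Vx, Vq, Vq], alphas ! 10), (dc [Vx, Vp, Vq], alphas ! 11), (dc [Vx, Vp, Vp], alphas ! 12),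
    (dc [Vx, Vy, Vq], alphas ! 13), (dc [Vx, Vy, Vp], alphas ! 14),
    (dc [Vx, Vy, Vy], Dx (fder [Vy, Vy])), (dc [Vx, Vx, Vq], alphas ! 15),
    (dc [Vx, Vx, Vp], alphas ! 16), (dc [Vx, Vx, Vy], Dx (Dx (fder [Vy]))),
    (dc [Vx, Vx, Vx], Dx (Dx (Dx (fder []))))]"

text \<open>A triangular change requires a domain that is a cylinder over coordinates that stay
  unchanged. This holds for \<open>f44\<close>, whereas \<open>f444\<close> is a leading coordinate
  and gets replaced.\<close>

definition normal_domain :: "jet set" where
  "normal_domain = {z. f44 z \<noteq> 0}"

lemma mset_var_eq:
  "mset ks = mset ls \<longleftrightarrow> count_list ks Vx = count_list ls Vx \<and> count_list ks Vy = count_list ls Vy \<and>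
     count_list ks Vp = count_list ls Vp \<and> count_list ks Vq = count_list ls Vq"
proof
  assume "count_list ks Vx = count_list ls Vx \<and> count_list ks Vy = count_list ls Vy \<and>
     count_list ks Vp = count_list ls Vp \<and> count_list ks Vq = count_list ls Vq"
  then have "count_list ks v = count_list ls v" for v by (cases v) auto
  then show "mset ks = mset ls" by (intro multiset_eqI) (simp add: count_mset)
qed (metis count_mset)

lemma jet_coords_3: "jet_coords 3 = set (lead_coords @ free_coords)"
proof (intro equalityI subsetI)
  fix c assume c: "c \<in> jet_coords 3"
  show "c \<in> set (lead_coords @ free_coords)"
  proof (cases c)
    case (Indep i)
    then show ?thesis by (cases i) (simp_all add: lead_coords_def free_coords_def)
  next
    case (Dep J)
    define ks where "ks = index_list J"
    have J: "c = dc ks" using Dep by (simp add: ks_def mset_index_list)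
    have "length ks \<le> 3" using c Dep by (metis Dep_in_jet_coords ks_def mset_index_list size_mset)
    then have le: "count J Vx + (count J Vy + (count J Vp + count J Vq)) \<le> 3"
      by (simp add: ks_def index_list_def)
    have ks: "ks = replicate (count J Vx) Vx @ replicate (count J Vy) Vy @ replicate (count J Vp) Vp @ replicate (count J Vq) Vq"
      by (simp add: ks_def index_list_def)
    \<comment> \<open>The nested ranges enumerate all exponent vectors of total degree at most
      three, so the claim is decided by evaluation.\<close>
    have "\<forall>a\<in>set [0..<4]. \<forall>b\<in>set [0..<4 - a]. \<forall>m\<in>set [0..<4 - a - b]. \<forall>n\<in>set [0..<4 - a - b - m].
        replicate a Vx @ replicate b Vy @ replicate m Vp @ replicate n Vq \<in> set
        ([[Vp, Vp], [Vq, Vq, Vq], [Vp, Vq, Vq], [Vp, Vp, Vq], [Vy, Vq, Vq], [Vy, Vp, Vq], [Vy, Vy, Vq],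
    [Vx, Vq], [Vx, Vp], [Vx, Vq, Vq], [Vx, Vp, Vq], [Vx, Vp, Vp], [Vx, Vy, Vq], [Vx, Vy, Vp],
    [Vx, Vx, Vq], [Vx, Vx, Vp]] @
         [[], [Vx], [Vx, Vx], [Vx, Vx, Vx], [Vy], [Vx, Vy], [Vx, Vx, Vy], [Vy, Vy], [Vx, Vy, Vy], [Vp],
    [Vq], [Vy, Vp], [Vy, Vq], [Vp, Vq], [Vq, Vq], [Vy, Vy, Vy], [Vy, Vy, Vp], [Vy, Vp, Vp],
    [Vp, Vp, Vp]])"
      (is "\<forall>a\<in>_. \<forall>b\<in>_. \<forall>m\<in>_. \<forall>n\<in>_. _ \<in> set ?indices")
      by code_simp
    then have "ks \<in> set ?indices"
      unfolding ks using le by simp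
    then show ?thesis unfolding J lead_coords_def free_coords_def by (auto simp del: mset.simps)
  qed
qed (auto simp: lead_coords_def free_coords_def)

text \<open>Base 4 suffices as the multi-indices in question have at most three entries.\<close>

definition coord_code :: "coord \<Rightarrow> nat" where
  "coord_code c = (case c of Indep i \<Rightarrow> (case i of Vx \<Rightarrow> 1000 | Vy \<Rightarrow> 1001 | Vp \<Rightarrow> 1002 | Vq \<Rightarrow> 1003)
    | Dep J \<Rightarrow> count J Vx + 4 * count J Vy + 16 * count J Vp + 64 * count J Vq)"

lemma distinct_coord_code: "distinct (map coord_code cs) \<Longrightarrow> distinct cs"
  by (simp add: distinct_map)

lemma distinct_coords: "distinct (lead_coords @ free_coords)"
  by (rule distinct_coord_code) (simp add: lead_coords_def free_coords_def coord_code_def)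

section \<open>Affine dependence on the leading coordinates\<close>

lemma Dx_fder: "Dx (fder ks) = (\<lambda>z. fder (Vx # ks) z + z (Indep Vp) * fder (Vy # ks) z
    + z (Indep Vq) * fder (Vp # ks) z + fder [] z * fder (Vq # ks) z)"
  using derives_total_deriv_fder[OF finitary_on_UNIV_const, THEN derives_UNIV_eq]
  by (simp add: Dx_def fun_eq_iff fder_def[of "[]"])

lemma derives_Dx_Indep:
  "derives UNIV Dx (\<lambda>z. z (Indep Vp)) (\<lambda>z. z (Indep Vq))"
  "derives UNIV Dx (\<lambda>z. z (Indep Vq)) (fder [])"
  using derives_coord[OF derivation_on_Dx_UNIV, of "Indep Vp"] derives_coord[OF derivation_on_Dx_UNIV, of "Indep Vq"]
  by (simp_all add: dfield_def[abs_def] fder_def[abs_def])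

lemma finitary_fder_UNIV: "finitary_on UNIV (fder ks)"
  using finitary_on_coord[OF finitary_on_UNIV_const] by (simp add: fder_def[abs_def])

lemma Dx_Dx_fder: "Dx (Dx (fder ks)) = (\<lambda>z. Dx (fder (Vx # ks)) z
    + (z (Indep Vq) * fder (Vy # ks) z + z (Indep Vp) * Dx (fder (Vy # ks)) z)
    + (fder [] z * fder (Vp # ks) z + z (Indep Vq) * Dx (fder (Vp # ks)) z)
    + (Dx (fder []) z * fder (Vq # ks) z + fder [] z * Dx (fder (Vq # ks)) z))"
proof -
  note f = derives_self[OF derivation_on_Dx_UNIV finitary_fder_UNIV]
  show ?thesis
    unfolding Dx_fder[of ks]
    by (rule derives_UNIV_eq[OF derives_add[OF derives_add[OF derives_add[OF f
        derives_mult[OF derives_Dx_Indep(1) f, simplified add.commute]] derives_mult[OF derives_Dx_Indep(2) f]] derives_mult[OF f f]]])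
qed

lemma Dx_Dx_Dx_f: "Dx (Dx (Dx (fder []))) = (\<lambda>z. Dx (Dx (fder [Vx])) z
    + ((fder [] z * fder [Vy] z + z (Indep Vq) * Dx (fder [Vy]) z)
      + (z (Indep Vq) * Dx (fder [Vy]) z + z (Indep Vp) * Dx (Dx (fder [Vy])) z))
    + ((Dx (fder []) z * fder [Vp] z + fder [] z * Dx (fder [Vp]) z)
      + (fder [] z * Dx (fder [Vp]) z + z (Indep Vq) * Dx (Dx (fder [Vp])) z))
    + ((Dx (Dx (fder [])) z * fder [Vq] z + Dx (fder []) z * Dx (fder [Vq]) z)
      + (Dx (fder []) z * Dx (fder [Vq]) z + fder [] z * Dx (Dx (fder [Vq])) z)))"
proof -
  note f = derives_self[OF derivation_on_Dx_UNIV finitary_fder_UNIV]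
  note Df = derives_self[OF derivation_on_Dx_UNIV derivation_on_finitary[OF derivation_on_Dx_UNIV finitary_fder_UNIV]]
  show ?thesis
    by (subst Dx_Dx_fder[of "[]"])
      (rule derives_UNIV_eq[OF derives_add[OF derives_add[OF derives_add[OF Df
          derives_add[OF derives_mult[OF derives_Dx_Indep(2) f] derives_mult[OF derives_Dx_Indep(1) Df]]]
          derives_add[OF derives_mult[OF f f] derives_mult[OF derives_Dx_Indep(2) Df]]]
          derives_add[OF derives_mult[OF Df f] derives_mult[OF f Df]]]])
qed

lemma fder_upd: "fder ks (z(dc ls := t)) = (if mset ks = mset ls then t else fder ks z)"
  by (simp add: fder_def)

text \<open>Among the coordinates in \<open>Dx (fder ks)\<close>, only that of \<open>Vx # ks\<close> has more indices \<open>Vx\<close> than \<open>ks\<close>.\<close>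

lemma Dx_fder_upd:
  assumes "count_list ks Vx < count_list ls Vx"
  shows "Dx (fder ks) (z(dc ls := t)) = Dx (fder ks) z + (if mset ls = mset (Vx # ks) then t - z (dc ls) else 0)"
proof -
  have "fder (k # ks) (z(dc ls := t)) = fder (k # ks) z" if "k \<noteq> Vx" for k
    using assms that by (simp add: fder_upd mset_var_eq del: mset.simps)
  moreover have "fder [] (z(dc ls := t)) = fder [] z"
    using assms by (simp add: fder_upd mset_var_eq del: mset.simps)
  ultimately show ?thesis
    unfolding Dx_fder by (auto simp: fder_def simp del: mset.simps)
qed

lemma Dx_Dx_fder_upd:
  assumes "Suc (count_list ks Vx) < count_list ls Vx"
  shows "Dx (Dx (fder ks)) (z(dc ls := t)) = Dx (Dx (fder ks)) z + (if mset ls = mset (Vx # Vx # ks) then t - z (dc ls) else 0)"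
  using assms unfolding Dx_Dx_fder
  by (simp add: fder_upd Dx_fder_upd mset_var_eq del: mset.simps)

lemmas alphas_expand = alphas_def lam_defs

text \<open>Each slope is the coefficient of the leading coordinate, divided by the normalising
  power of \<open>f44\<close> where there is one. The factor \<open>- 2\<close> comes from
  \<open>-54 / 27\<close> in \<open>lam11\<close>.\<close>

lemma entries_affine:
  assumes "z \<in> normal_domain"
  shows "(alphas ! 1) (z(dc [Vp, Vp] := t)) = (alphas ! 1) z + 1 / f44 z * (t - z (dc [Vp, Vp]))"
    and "(alphas ! 2) (z(dc [Vq, Vq, Vq] := t)) = (alphas ! 2) z + 1 / f44 z ^ 2 * (t - z (dc [Vq, Vq, Vq]))"
    and "(alphas ! 3) (z(dc [Vp, Vq, Vq] := t)) = (alphas ! 3) z + 1 / f44 z ^ 2 * (t - z (dc [Vp, Vq, Vq]))"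
    and "(alphas ! 4) (z(dc [Vp, Vp, Vq] := t)) = (alphas ! 4) z + 1 / f44 z ^ 2 * (t - z (dc [Vp, Vp, Vq]))"
    and "(alphas ! 5) (z(dc [Vy, Vq, Vq] := t)) = (alphas ! 5) z + 1 / f44 z ^ 2 * (t - z (dc [Vy, Vq, Vq]))"
    and "(alphas ! 6) (z(dc [Vy, Vp, Vq] := t)) = (alphas ! 6) z + 1 / f44 z ^ 2 * (t - z (dc [Vy, Vp, Vq]))"
    and "(alphas ! 7) (z(dc [Vy, Vy, Vq] := t)) = (alphas ! 7) z + - 2 / f44 z ^ 2 * (t - z (dc [Vy, Vy, Vq]))"
    and "(Dx (fder [])) (z(dc [Vx] := t)) = (Dx (fder [])) z + 1 * (t - z (dc [Vx]))"
    and "(Dx (fder [Vy])) (z(dc [Vx, Vy] := t)) = (Dx (fder [Vy])) z + 1 * (t - z (dc [Vx, Vy]))"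
    and "(alphas ! 8) (z(dc [Vx, Vq] := t)) = (alphas ! 8) z + 1 * (t - z (dc [Vx, Vq]))"
    and "(alphas ! 9) (z(dc [Vx, Vp] := t)) = (alphas ! 9) z + 1 * (t - z (dc [Vx, Vp]))"
    and "(Dx (Dx (fder []))) (z(dc [Vx, Vx] := t)) = (Dx (Dx (fder []))) z + 1 * (t - z (dc [Vx, Vx]))"
    and "(alphas ! 10) (z(dc [Vx, Vq, Vq] := t)) = (alphas ! 10) z + 1 / f44 z * (t - z (dc [Vx, Vq, Vq]))"
    and "(alphas ! 11) (z(dc [Vx, Vp, Vq] := t)) = (alphas ! 11) z + 1 / f44 z * (t - z (dc [Vx, Vp, Vq]))"
    and "(alphas ! 12) (z(dc [Vx, Vp, Vp] := t)) = (alphas ! 12) z + 1 / f44 z * (t - z (dc [Vx, Vp, Vp]))"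
    and "(alphas ! 13) (z(dc [Vx, Vy, Vq] := t)) = (alphas ! 13) z + 1 / f44 z * (t - z (dc [Vx, Vy, Vq]))"
    and "(alphas ! 14) (z(dc [Vx, Vy, Vp] := t)) = (alphas ! 14) z + 1 / f44 z * (t - z (dc [Vx, Vy, Vp]))"
    and "(Dx (fder [Vy, Vy])) (z(dc [Vx, Vy, Vy] := t)) = (Dx (fder [Vy, Vy])) z + 1 * (t - z (dc [Vx, Vy, Vy]))"
    and "(alphas ! 15) (z(dc [Vx, Vx, Vq] := t)) = (alphas ! 15) z + 1 * (t - z (dc [Vx, Vx, Vq]))"
    and "(alphas ! 16) (z(dc [Vx, Vx, Vp] := t)) = (alphas ! 16) z + 1 * (t - z (dc [Vx, Vx, Vp]))"
    and "(Dx (Dx (fder [Vy]))) (z(dc [Vx, Vx, Vy] := t)) = (Dx (Dx (fder [Vy]))) z + 1 * (t - z (dc [Vx, Vx, Vy]))"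
    and "(Dx (Dx (Dx (fder [])))) (z(dc [Vx, Vx, Vx] := t)) = (Dx (Dx (Dx (fder [])))) z + 1 * (t - z (dc [Vx, Vx, Vx]))"
  using assms
  by (simp_all add: normal_domain_def alphas_expand Dx_Dx_Dx_f Dx_Dx_fder_upd Dx_fder_upd fder_upd
      mset_var_eq fder_def[symmetric] field_simps del: mset.simps)

lemma tri_chain_ConsI:
  assumes "local_function (insert c D) \<Omega> F" "cylinder D \<Omega>"
    "\<And>z. z \<in> \<Omega> \<Longrightarrow> \<exists>k. k \<noteq> 0 \<and> (\<forall>t. F (z(c := t)) = F z + k * (t - z c))" "tri_chain (insert c D) \<Omega> T"
  shows "tri_chain D \<Omega> ((c, F) # T)"
  using assms by simp

lemma cylinder_normal_domain:
  assumes "dc [Vq, Vq] \<in> D" shows "cylinder D normal_domain"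
  unfolding cylinder_def
proof (intro conjI ballI allI impI)
  show "open normal_domain"
    using open_vimage[OF open_Compl[OF closed_singleton[of "0::real"]] continuous_on_product_coordinates[of "dc [Vq, Vq]"]]
    by (simp add: vimage_def Compl_eq normal_domain_def fder_def)
qed (use assms in \<open>auto simp: normal_domain_def fder_def\<close>)

lemma local_function_fder_mem: "cylinder D U \<Longrightarrow> dc ks \<in> D \<Longrightarrow> local_function D U (fder ks)"
  using local_function_coord[of D U "dc ks"] by (simp add: fder_def[abs_def])

lemma local_function_Dx_fder_mem:
  assumes "cylinder D U" "Indep Vp \<in> D" "Indep Vq \<in> D" "dc [] \<in> D" "\<forall>k. dc (k # ks) \<in> D"
  shows "local_function D U (Dx (fder ks))"
  unfolding Dx_fder
  by (intro local_function_add local_function_mult local_function_fder_mem local_function_coord assms assms(5)[rule_format])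

lemma local_function_Dx_Dx_fder_mem:
  assumes "cylinder D U" "Indep Vp \<in> D" "Indep Vq \<in> D" "dc [] \<in> D" "\<forall>k. dc (k # ks) \<in> D"
    "\<forall>k. dc [k] \<in> D" "\<forall>k l. dc (k # l # ks) \<in> D"
  shows "local_function D U (Dx (Dx (fder ks)))"
  unfolding Dx_Dx_fder
  by (intro local_function_add local_function_mult local_function_Dx_fder_mem local_function_fder_mem
      local_function_coord assms allI assms(5-7)[rule_format])

lemma all_var: "(\<forall>k. P k) \<longleftrightarrow> P Vx \<and> P Vy \<and> P Vp \<and> P Vq"
  by (metis var.exhaust)

lemmas local_function_mem_intros = local_function_cdivide local_function_divide local_function_const local_function_add
  local_function_diff local_function_minus local_function_mult local_function_power
  local_function_fder_mem local_function_coord[where c = "Indep i" for i]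

lemma alphas_nth:
  "alphas ! 1 = (\<lambda>z. lam5 z / lam4 z)"
  "alphas ! 2 = (\<lambda>z. lam6 z / lam4 z ^ 2)"
  "alphas ! 3 = (\<lambda>z. lam7 z / lam4 z ^ 2)"
  "alphas ! 4 = (\<lambda>z. lam8 z / lam4 z ^ 2)"
  "alphas ! 5 = (\<lambda>z. lam9 z / lam4 z ^ 2)"
  "alphas ! 6 = (\<lambda>z. lam10 z / lam4 z ^ 2)"
  "alphas ! 7 = (\<lambda>z. lam11 z / lam4 z ^ 2)"
  "alphas ! 8 = (lam12)"
  "alphas ! 9 = (lam13)"
  "alphas ! 10 = (\<lambda>z. lam14 z / lam4 z)"
  "alphas ! 11 = (\<lambda>z. lam15 z / lam4 z)"
  "alphas ! 12 = (\<lambda>z. lam16 z / lam4 z)"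
  "alphas ! 13 = (\<lambda>z. lam17 z / lam4 z)"
  "alphas ! 14 = (\<lambda>z. lam18 z / lam4 z)"
  "alphas ! 15 = (lam19)"
  "alphas ! 16 = (lam20)"
  by (simp_all add: alphas_def)

lemmas alphas_fun = alphas_nth[unfolded lam_defs]

lemma local_function_subst: "G = F \<Longrightarrow> local_function D U F \<Longrightarrow> local_function D U G"
  by simp

lemma dc_sort:
  "dc (Vy # Vx # ks) = dc (Vx # Vy # ks)" "dc (Vp # Vx # ks) = dc (Vx # Vp # ks)"
  "dc (Vq # Vx # ks) = dc (Vx # Vq # ks)" "dc (Vp # Vy # ks) = dc (Vy # Vp # ks)"
  "dc (Vq # Vy # ks) = dc (Vy # Vq # ks)" "dc (Vq # Vp # ks) = dc (Vp # Vq # ks)"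
  "dc (k # Vy # Vx # ks) = dc (k # Vx # Vy # ks)" "dc (k # Vp # Vx # ks) = dc (k # Vx # Vp # ks)"
  "dc (k # Vq # Vx # ks) = dc (k # Vx # Vq # ks)" "dc (k # Vp # Vy # ks) = dc (k # Vy # Vp # ks)"
  "dc (k # Vq # Vy # ks) = dc (k # Vy # Vq # ks)" "dc (k # Vq # Vp # ks) = dc (k # Vp # Vq # ks)"
  by (simp_all add: add_mset_commute)

text \<open>The coordinates left unchanged. They do not coincide with \<open>free_coords\<close>:
  \<open>x\<close> is unchanged although it is an invariant, and six replaced coordinates are free,
  namely those turned into images of \<open>f\<close>, \<open>f2\<close> and \<open>f22\<close>
  under powers of \<open>Dx\<close>.\<close>

definition base_coords :: "coord list" where
  "base_coords =
   [Indep Vx, Indep Vy, Indep Vp, Indep Vq, dc [], dc [Vy], dc [Vy, Vy], dc [Vp], dc [Vq],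
    dc [Vy, Vp], dc [Vy, Vq], dc [Vp, Vq], dc [Vq, Vq], dc [Vy, Vy, Vy], dc [Vy, Vy, Vp],
    dc [Vy, Vp, Vp], dc [Vp, Vp, Vp]]"

text \<open>One pattern serves all 22 entries: the function involves only coordinates available so
  far, the domain is cut out by \<open>f44\<close>, and the slope is supplied by
  \<open>entries_affine\<close>.\<close>

lemma tri_chain_entries: "tri_chain (set base_coords) normal_domain entries"
  unfolding base_coords_def list.set
  unfolding entries_def
  by ((rule tri_chain_ConsI,
      ((rule alphas_fun[THEN local_function_subst] Dx_Dx_Dx_f[THEN local_function_subst])?,
       (rule local_function_mem_intros local_function_Dx_fder_mem local_function_Dx_Dx_fder_mem cylinder_normal_domain
        | (simp only: all_var dc_sort insert_iff simp_thms; fail) | (simp add: normal_domain_def; fail))+)[1],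
      (rule cylinder_normal_domain, simp only: insert_iff simp_thms),
      (rule exI, rule conjI[rotated], rule allI, rule entries_affine, assumption, simp add: normal_domain_def))+) simp

lemma distinct_base_entries: "distinct (base_coords @ map fst entries)"
  by (rule distinct_coord_code) (simp add: base_coords_def entries_def coord_code_def)

lemma base_entries_coords: "set base_coords \<union> fst ` set entries = jet_coords 3"
  unfolding jet_coords_3 lead_coords_def free_coords_def base_coords_def entries_def
  by (simp del: mset.simps) blast

lemma tri_ok_entries: "tri_ok (jet_coords 3) normal_domain entries"
  using tri_chain_imp_tri_ok[OF tri_chain_entries] distinct_base_entries
  by (simp add: base_entries_coords)

lemma straighten_base: "c \<in> set base_coords \<Longrightarrow> straighten entries z c = z c"
  using distinct_base_entries map_of_eq_None_iff[of entries c]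
  by (auto simp: straighten_def)

lemma straighten_entry: "(c, F) \<in> set entries \<Longrightarrow> straighten entries z c = F z"
  using distinct_base_entries map_of_is_SomeI[of entries c F]
  by (simp add: straighten_def)

lemma straighten_lead:
  assumes "i < 17" shows "straighten entries z (lead_coords ! i) = (alphas ! i) z"
proof (cases "i = 0")
  case True
  have "straighten entries z (Indep Vx) = z (Indep Vx)"
    by (rule straighten_base) (simp add: base_coords_def)
  then show ?thesis using True by (simp add: lead_coords_def alphas_def)
next
  case False
  with assms have "i = 1 \<or> i = 2 \<or> i = 3 \<or> i = 4 \<or> i = 5 \<or> i = 6 \<or> i = 7 \<or> i = 8 \<or> i = 9 \<or>
      i = 10 \<or> i = 11 \<or> i = 12 \<or> i = 13 \<or> i = 14 \<or> i = 15 \<or> i = 16" by presburger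
  then have "(lead_coords ! i, alphas ! i) \<in> set entries"
    by (elim disjE) (simp_all add: lead_coords_def entries_def del: mset.simps)
  then show ?thesis by (rule straighten_entry)
qed

lemma straighten_free:
  "(\<lambda>z. straighten entries z (dc [Vx])) = Dx (fder [])"
  "(\<lambda>z. straighten entries z (dc [Vx, Vx])) = Dx (Dx (fder []))"
  "(\<lambda>z. straighten entries z (dc [Vx, Vx, Vx])) = Dx (Dx (Dx (fder [])))"
  "(\<lambda>z. straighten entries z (dc [Vx, Vy])) = Dx (fder [Vy])"
  "(\<lambda>z. straighten entries z (dc [Vx, Vx, Vy])) = Dx (Dx (fder [Vy]))"
  "(\<lambda>z. straighten entries z (dc [Vx, Vy, Vy])) = Dx (fder [Vy, Vy])"
  "(\<lambda>z. straighten entries z (Indep Vy)) = (\<lambda>z. z (Indep Vy))"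
  "(\<lambda>z. straighten entries z (Indep Vp)) = (\<lambda>z. z (Indep Vp))"
  "(\<lambda>z. straighten entries z (Indep Vq)) = (\<lambda>z. z (Indep Vq))"
  "(\<lambda>z. straighten entries z (dc [])) = fder []"
  "(\<lambda>z. straighten entries z (dc [Vy])) = fder [Vy]"
  "(\<lambda>z. straighten entries z (dc [Vy, Vy])) = fder [Vy, Vy]"
  "(\<lambda>z. straighten entries z (dc [Vp])) = fder [Vp]"
  "(\<lambda>z. straighten entries z (dc [Vq])) = fder [Vq]"
  "(\<lambda>z. straighten entries z (dc [Vy, Vp])) = fder [Vy, Vp]"
  "(\<lambda>z. straighten entries z (dc [Vy, Vq])) = fder [Vy, Vq]"
  "(\<lambda>z. straighten entries z (dc [Vp, Vq])) = fder [Vp, Vq]"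
  "(\<lambda>z. straighten entries z (dc [Vq, Vq])) = fder [Vq, Vq]"
  "(\<lambda>z. straighten entries z (dc [Vy, Vy, Vy])) = fder [Vy, Vy, Vy]"
  "(\<lambda>z. straighten entries z (dc [Vy, Vy, Vp])) = fder [Vy, Vy, Vp]"
  "(\<lambda>z. straighten entries z (dc [Vy, Vp, Vp])) = fder [Vy, Vp, Vp]"
  "(\<lambda>z. straighten entries z (dc [Vp, Vp, Vp])) = fder [Vp, Vp, Vp]"
  by (rule ext, rule straighten_entry, (simp add: entries_def del: mset.simps; fail))+
    (simp_all add: straighten_base base_coords_def fder_def fun_eq_iff del: mset.simps)

section \<open>Components of the generator along the free coordinates\<close>

lemma (in prolongation) Y_D_fy: "derives W Y (Dx (fder [Vy]))
    (\<lambda>z. - e 1 1 z * Dx (fder [Vp]) z - e 2 1 z * fder [Vp] z - e 2 1 z * Dx (fder [Vq]) z - e 3 1 z * fder [Vq] z + e 4 1 z)"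
  by (rule derives_cong, (rule derives_Y_intros)+) (simp add: algebra_simps eval_nat_numeral)

lemma (in prolongation) Y_D_D_fy: "derives W Y (Dx (Dx (fder [Vy])))
    (\<lambda>z. - e 1 1 z * Dx (Dx (fder [Vp])) z - 2 * e 2 1 z * Dx (fder [Vp]) z - e 2 1 z * Dx (Dx (fder [Vq])) z - e 3 1 z * fder [Vp] z - 2 * e 3 1 z * Dx (fder [Vq]) z - e 4 1 z * fder [Vq] z + e 5 1 z)"
  by (rule derives_cong, (rule derives_Y_intros)+) (simp add: algebra_simps eval_nat_numeral)

lemma (in prolongation) Y_D_fyy: "derives W Y (Dx (fder [Vy, Vy]))
    (\<lambda>z. - e 0 1 z * Dx (fder [Vy, Vy]) z + e 0 2 z * Dx (fder [Vy]) z - 2 * e 1 1 z * Dx (fder [Vy, Vp]) z - e 1 1 z * fder [Vy, Vy] z - e 1 2 z * Dx (fder [Vp]) z + e 1 2 z * fder [Vy] z - 2 * e 2 1 z * fder [Vy, Vp] z - 2 * e 2 1 z * Dx (fder [Vy, Vq]) z - e 2 2 z * fder [Vp] z - e 2 2 z * Dx (fder [Vq]) z - 2 * e 3 1 z * fder [Vy, Vq] z - e 3 2 z * fder [Vq] z + e 4 2 z)"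
  by (rule derives_cong, (rule derives_Y_intros)+) (simp add: algebra_simps eval_nat_numeral)

lemma (in prolongation) Y_D_f:
  "derives W Y (Dx (fder [])) (e 4 0)"
  "derives W Y (Dx (Dx (fder []))) (e 5 0)"
  "derives W Y (Dx (Dx (Dx (fder [])))) (e 6 0)"
  using Y_Dx[OF Y_f Dx_e] Y_Dx[OF Y_Dx[OF Y_f Dx_e] Dx_e] Y_Dx[OF Y_Dx[OF Y_Dx[OF Y_f Dx_e] Dx_e] Dx_e]
  by simp_all

lemma (in prolongation) Y_indep:
  "derives W Y (\<lambda>z. z (Indep Vy)) (e 0 0)" "derives W Y (\<lambda>z. z (Indep Vp)) (e 1 0)"
  "derives W Y (\<lambda>z. z (Indep Vq)) (e 2 0)"
  using derives_coord[OF deriv_Y, of "Indep Vy"] derives_coord[OF deriv_Y, of "Indep Vp"]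
    derives_coord[OF deriv_Y, of "Indep Vq"]
  by (simp_all only: gfield.simps xi_e)

text \<open>The pairing of an arbitrary covector \<open>g\<close> in the free directions with the
  generator. It is linear in the values \<open>e j b\<close>, so generators realising one such value
  at a time extract the equations on \<open>g\<close>.\<close>

lemma (in prolongation) sum_Y_free:
  assumes z: "z \<in> W"
  shows "(\<Sum>c\<in>set free_coords. g c * Y (\<lambda>z. straighten entries z c) z) =
    g (Indep Vy) * (e 0 0 z) +
    g (Indep Vp) * (e 1 0 z) +
    g (Indep Vq) * (e 2 0 z) +
    g (dc []) * (e 3 0 z) +
    g (dc [Vx]) * (e 4 0 z) +
    g (dc [Vx, Vx]) * (e 5 0 z) +
    g (dc [Vx, Vx, Vx]) * (e 6 0 z) +
    g (dc [Vy]) * (- e 1 1 z * fder [Vp] z - e 2 1 z * fder [Vq] z + e 3 1 z) +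
    g (dc [Vx, Vy]) * (- e 1 1 z * Dx (fder [Vp]) z - e 2 1 z * fder [Vp] z - e 2 1 z * Dx (fder [Vq]) z - e 3 1 z * fder [Vq] z + e 4 1 z) +
    g (dc [Vx, Vx, Vy]) * (- e 1 1 z * Dx (Dx (fder [Vp])) z - 2 * e 2 1 z * Dx (fder [Vp]) z - e 2 1 z * Dx (Dx (fder [Vq])) z - e 3 1 z * fder [Vp] z - 2 * e 3 1 z * Dx (fder [Vq]) z - e 4 1 z * fder [Vq] z + e 5 1 z) +
    g (dc [Vy, Vy]) * (- e 0 1 z * fder [Vy, Vy] z + e 0 2 z * fder [Vy] z - 2 * e 1 1 z * fder [Vy, Vp] z - e 1 2 z * fder [Vp] z - 2 * e 2 1 z * fder [Vy, Vq] z - e 2 2 z * fder [Vq] z + e 3 2 z) +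
    g (dc [Vx, Vy, Vy]) * (- e 0 1 z * Dx (fder [Vy, Vy]) z + e 0 2 z * Dx (fder [Vy]) z - 2 * e 1 1 z * Dx (fder [Vy, Vp]) z - e 1 1 z * fder [Vy, Vy] z - e 1 2 z * Dx (fder [Vp]) z + e 1 2 z * fder [Vy] z - 2 * e 2 1 z * fder [Vy, Vp] z - 2 * e 2 1 z * Dx (fder [Vy, Vq]) z - e 2 2 z * fder [Vp] z - e 2 2 z * Dx (fder [Vq]) z - 2 * e 3 1 z * fder [Vy, Vq] z - e 3 2 z * fder [Vq] z + e 4 2 z) +
    g (dc [Vp]) * (- 2 * e 1 1 z * fder [Vq] z + 3 * e 2 1 z) +
    g (dc [Vq]) * (3 * e 1 1 z) +
    g (dc [Vy, Vp]) * (- e 0 1 z * fder [Vy, Vp] z - e 1 1 z * fder [Vp, Vp] z - 2 * e 1 1 z * fder [Vy, Vq] z - 2 * e 1 2 z * fder [Vq] z - e 2 1 z * fder [Vp, Vq] z + 3 * e 2 2 z) +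
    g (dc [Vy, Vq]) * (- e 0 1 z * fder [Vy, Vq] z - e 1 1 z * fder [Vp, Vq] z + 3 * e 1 2 z - e 2 1 z * fder [Vq, Vq] z) +
    g (dc [Vp, Vq]) * (- e 0 1 z * fder [Vp, Vq] z + 3 * e 0 2 z - 2 * e 1 1 z * fder [Vq, Vq] z) +
    g (dc [Vq, Vq]) * (- e 0 1 z * fder [Vq, Vq] z) +
    g (dc [Vy, Vy, Vy]) * (- 2 * e 0 1 z * fder [Vy, Vy, Vy] z + 2 * e 0 3 z * fder [Vy] z - 3 * e 1 1 z * fder [Vy, Vy, Vp] z - 3 * e 1 2 z * fder [Vy, Vp] z - e 1 3 z * fder [Vp] z - 3 * e 2 1 z * fder [Vy, Vy, Vq] z - 3 * e 2 2 z * fder [Vy, Vq] z - e 2 3 z * fder [Vq] z + e 3 3 z) +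
    g (dc [Vy, Vy, Vp]) * (- 2 * e 0 1 z * fder [Vy, Vy, Vp] z - e 0 2 z * fder [Vy, Vp] z - 2 * e 1 1 z * fder [Vy, Vp, Vp] z - 2 * e 1 1 z * fder [Vy, Vy, Vq] z - e 1 2 z * fder [Vp, Vp] z - 4 * e 1 2 z * fder [Vy, Vq] z - 2 * e 1 3 z * fder [Vq] z - 2 * e 2 1 z * fder [Vy, Vp, Vq] z - e 2 2 z * fder [Vp, Vq] z + 3 * e 2 3 z) +
    g (dc [Vy, Vp, Vp]) * (- 2 * e 0 1 z * fder [Vy, Vp, Vp] z - e 0 2 z * fder [Vp, Vp] z - 2 * e 0 2 z * fder [Vy, Vq] z - 2 * e 0 3 z * fder [Vq] z - e 1 1 z * fder [Vp, Vp, Vp] z - 4 * e 1 1 z * fder [Vy, Vp, Vq] z - 4 * e 1 2 z * fder [Vp, Vq] z + 6 * e 1 3 z - e 2 1 z * fder [Vp, Vp, Vq] z) +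
    g (dc [Vp, Vp, Vp]) * (- 2 * e 0 1 z * fder [Vp, Vp, Vp] z - 6 * e 0 2 z * fder [Vp, Vq] z + 6 * e 0 3 z - 6 * e 1 1 z * fder [Vp, Vp, Vq] z)"
  (is "_ = ?rows")
proof -
  note rows = Y_indep Y_f Y_D_f Y_D_fy Y_D_D_fy Y_D_fyy Y_fder_rules
  have "distinct free_coords" using distinct_coords by simp
  then have "(\<Sum>c\<in>set free_coords. g c * Y (\<lambda>z. straighten entries z c) z) =
      sum_list (map (\<lambda>c. g c * Y (\<lambda>z. straighten entries z c) z) free_coords)"
    by (simp only: sum.distinct_set_conv_list)
  also have "\<dots> = ?rows"
    by (simp only: free_coords_def append.simps list.map sum_list.Cons sum_list.Nil straighten_free
        rows[THEN derivesD(3), OF z] add.assoc add_0_right)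
  finally show ?thesis .
qed

lemma cylinder_jet_coords_normal: "cylinder (jet_coords 3) normal_domain"
  by (rule cylinder_normal_domain) simp

lemma open_normal_domain: "open normal_domain"
  by (rule cylinder_open[OF cylinder_jet_coords_normal])

lemma class_domain_subset: "class_domain \<subseteq> normal_domain"
  by (auto simp: class_domain_def normal_domain_def)

lemma local_function_straighten:
  assumes "c \<in> jet_coords 3"
  shows "local_function (jet_coords 3) normal_domain (\<lambda>z. straighten entries z c)"
proof (cases "map_of entries c")
  case None
  then show ?thesis
    using local_function_coord[OF cylinder_jet_coords_normal assms] by (simp add: straighten_def)
next
  case (Some F)
  then show ?thesis
    using tri_ok_local_function[OF tri_ok_entries map_of_SomeD[OF Some]] by (simp add: straighten_def)
qed

lemma length_lead_coords: "length lead_coords = 17"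
  by (simp add: lead_coords_def)

lemma lead_coords_mem: "i < 17 \<Longrightarrow> lead_coords ! i \<in> jet_coords 3"
  unfolding jet_coords_3 set_append by (intro UnI1 nth_mem) (simp add: length_lead_coords)

lemma local_function_alpha:
  assumes "i < 17"
  shows "local_function (jet_coords 3) normal_domain (alphas ! i)"
  using local_function_straighten[OF lead_coords_mem[OF assms]] by (simp only: straighten_lead[OF assms])

section \<open>Independence and completeness\<close>

text \<open>The inverse of straightening on \<open>normal_domain\<close>. The same \<open>w\<close>
  is used as prescribed values and as start vector, because unchanged coordinates are already
  correct.\<close>

definition section_map :: "jet \<Rightarrow> jet" where
  "section_map w = solve entries w w"

lemma smooth_on_section: "smooth_on normal_domain (\<lambda>w. section_map w d)"
  unfolding section_map_def
  by (rule smooth_on_solve[OF tri_ok_entries finite_jet_coords open_normal_domain])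
    (auto intro: smooth_on_coord open_normal_domain)

lemma section_agree:
  assumes "w \<in> normal_domain" "\<And>c. c \<in> jet_coords 3 \<Longrightarrow> w' c = w c" "d \<in> jet_coords 3"
  shows "section_map w' d = section_map w d"
  unfolding section_map_def using assms by (intro solve_agree[OF tri_ok_entries]) auto

lemma section_straighten: "z \<in> normal_domain \<Longrightarrow> section_map (straighten entries z) = z"
  unfolding section_map_def by (rule solve_straighten[OF tri_ok_entries])

lemma straighten_section: "w \<in> normal_domain \<Longrightarrow> straighten entries (section_map w) = w"
  unfolding section_map_def by (rule straighten_solve[OF tri_ok_entries])

lemma section_normal: "w \<in> normal_domain \<Longrightarrow> section_map w \<in> normal_domain"
  unfolding section_map_def by (rule solve_correct(1)[OF tri_ok_entries])

lemma straighten_normal: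
  assumes "z \<in> normal_domain" shows "straighten entries z \<in> normal_domain"
proof -
  have "straighten entries z (dc [Vq, Vq]) = z (dc [Vq, Vq])"
    by (rule straighten_base) (simp add: base_coords_def)
  then show ?thesis using assms by (simp add: normal_domain_def fder_def)
qed

lemma length_alphas: "length alphas = 17"
  by (simp add: alphas_def)

text \<open>Composed with \<open>section_map\<close>, each invariant becomes a coordinate. Hence the
  derivatives of \<open>section_map\<close> in the leading directions are vectors dual to the
  differentials of the invariants, and pairing with them isolates one coefficient.\<close>

lemma functionally_independent_alphas: "functionally_independent class_domain alphas"
  unfolding functionally_independent_def
proof (intro ballI allI impI)
  fix z :: jet and a :: "nat \<Rightarrow> real" and j
  assume z: "z \<in> class_domain" and a: "\<forall>k. (\<Sum>i<length alphas. a i * pd k (alphas ! i) z) = 0"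
    and j: "j < length alphas"
  have z': "z \<in> normal_domain" using z class_domain_subset by blast
  define w where "w = straighten entries z"
  have w: "w \<in> normal_domain" "section_map w = z"
    by (simp_all add: w_def straighten_normal section_straighten z')
  have delta: "(\<Sum>k\<in>jet_coords 3. pd k (alphas ! i) z * pd (lead_coords ! j) (\<lambda>w. section_map w k) w) = (if i = j then 1 else 0)"
    if i: "i < 17" for i
  proof -
    have "(\<Sum>k\<in>jet_coords 3. pd k (alphas ! i) z * pd (lead_coords ! j) (\<lambda>w. section_map w k) w)
        = pd (lead_coords ! j) (\<lambda>w. (alphas ! i) (section_map w)) w"
      using pd_comp[OF local_function_alpha[OF i] finite_jet_coords smooth_on_section section_normal w(1), of "lead_coords ! j"]
      by (simp add: w(2))
    also have "\<dots> = pd (lead_coords ! j) (\<lambda>w. w (lead_coords ! i)) w"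
      by (rule pd_cong[OF open_normal_domain w(1)])
        (simp add: straighten_lead[OF i, symmetric] straighten_section)
    also have "\<dots> = (if i = j then 1 else 0)"
      using distinct_coords i j nth_eq_iff_index_eq[of lead_coords j i]
      by (auto simp: pd_coord length_lead_coords length_alphas)
    finally show ?thesis .
  qed
  have "0 = (\<Sum>k\<in>jet_coords 3. (\<Sum>i<17. a i * pd k (alphas ! i) z) * pd (lead_coords ! j) (\<lambda>w. section_map w k) w)"
    using a by (simp add: length_alphas)
  also have "\<dots> = (\<Sum>i<17. a i * (\<Sum>k\<in>jet_coords 3. pd k (alphas ! i) z * pd (lead_coords ! j) (\<lambda>w. section_map w k) w))"
    by (simp only: sum_distrib_left sum_distrib_right mult.assoc) (rule sum.swap)
  also have "\<dots> = a j"
    using j by (simp add: delta length_alphas if_distrib[of "\<lambda>x. _ * x"] cong: if_cong)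
  finally show "a j = 0" by simp
qed

text \<open>
  The generators are taken in an order in which each involves exactly one coefficient not yet known to vanish.
\<close>

lemma free_coefficients_vanish:
  assumes nz: "f44 z \<noteq> 0"
    and eq: "\<And>\<eta>. generator UNIV \<eta> \<Longrightarrow>
      (\<Sum>c\<in>set free_coords. g c * vfield (gfield \<eta>) (\<lambda>z. straighten entries z c) z) = 0"
  shows "c \<in> set free_coords \<Longrightarrow> g c = 0"
proof -
  \<comment> \<open>Order 6 is dictated by \<open>e 6 0\<close>, the component along the third
    \<open>Dx\<close> image of \<open>f\<close>: no more than six applications of \<open>Dx\<close>
    to \<open>\<eta>\<close> occur.\<close>
  have "prolongation UNIV (basis_generator z 6 a b)" for a b
    using prolongation_generator[OF generator_basis cylinder_UNIV finite.emptyI] by simp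
  note eq = trans[OF prolongation.sum_Y_free[OF this UNIV_I, symmetric] eq[OF generator_basis]]
  note [simp] = eta_deriv_basis_generator
  note [simp del] = mset.simps
  have g0 [simp]: "g (dc [Vx, Vx, Vx]) = 0"
    using eq[of 6 0] nz by simp
  have g1 [simp]: "g (dc [Vx, Vx, Vy]) = 0"
    using eq[of 5 1] nz by simp
  have g2 [simp]: "g (dc [Vx, Vy, Vy]) = 0"
    using eq[of 4 2] nz by simp
  have g3 [simp]: "g (dc [Vy, Vy, Vy]) = 0"
    using eq[of 3 3] nz by simp
  have g4 [simp]: "g (dc [Vx, Vx]) = 0"
    using eq[of 5 0] nz by simp
  have g5 [simp]: "g (dc [Vx, Vy]) = 0"
    using eq[of 4 1] nz by simp
  have g6 [simp]: "g (dc [Vy, Vy, Vp]) = 0"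
    using eq[of 2 3] nz by simp
  have g7 [simp]: "g (dc [Vy, Vy]) = 0"
    using eq[of 3 2] nz by simp
  have g8 [simp]: "g (dc [Vx]) = 0"
    using eq[of 4 0] nz by simp
  have g9 [simp]: "g (dc [Vy, Vp, Vp]) = 0"
    using eq[of 1 3] nz by simp
  have g10 [simp]: "g (dc [Vy, Vp]) = 0"
    using eq[of 2 2] nz by simp
  have g11 [simp]: "g (dc [Vy]) = 0"
    using eq[of 3 1] nz by simp
  have g12 [simp]: "g (dc []) = 0"
    using eq[of 3 0] nz by simp
  have g13 [simp]: "g (dc [Vp, Vp, Vp]) = 0"
    using eq[of 0 3] nz by simp
  have g14 [simp]: "g (dc [Vy, Vq]) = 0"
    using eq[of 1 2] nz by simp
  have g15 [simp]: "g (dc [Vp]) = 0"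
    using eq[of 2 1] nz by simp
  have g16 [simp]: "g (Indep Vq) = 0"
    using eq[of 2 0] nz by simp
  have g17 [simp]: "g (dc [Vp, Vq]) = 0"
    using eq[of 0 2] nz by simp
  have g18 [simp]: "g (dc [Vq]) = 0"
    using eq[of 1 1] nz by simp
  have g19 [simp]: "g (Indep Vp) = 0"
    using eq[of 1 0] nz by simp
  \<comment> \<open>Here the surviving coefficient is \<open>- f44 z\<close>, which is where
    \<open>nz\<close> enters; in the other equations it is a nonzero number.\<close>
  have g20 [simp]: "g (dc [Vq, Vq]) = 0"
    using eq[of 0 1] nz by simp
  have g21 [simp]: "g (Indep Vy) = 0"
    using eq[of 0 0] nz by simp
  show "c \<in> set free_coords \<Longrightarrow> g c = 0"
    by (auto simp: free_coords_def)
qed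

section \<open>Completeness\<close>

lemma open_ball_coords:
  assumes "finite C"
  shows "open {w :: 'i \<Rightarrow> real. \<forall>c\<in>C. \<bar>w c - w\<^sub>0 c\<bar> < r}"
proof -
  have "open ((\<lambda>w :: 'i \<Rightarrow> real. w c) -` ball (w\<^sub>0 c) r)" for c
    by (rule open_vimage[OF open_ball continuous_on_product_coordinates])
  then have "open (\<Inter>c\<in>C. (\<lambda>w :: 'i \<Rightarrow> real. w c) -` ball (w\<^sub>0 c) r)"
    using assms by (intro open_INT) auto
  also have "(\<Inter>c\<in>C. (\<lambda>w :: 'i \<Rightarrow> real. w c) -` ball (w\<^sub>0 c) r) = {w. \<forall>c\<in>C. \<bar>w c - w\<^sub>0 c\<bar> < r}"
    by (auto simp: dist_real_def abs_minus_commute)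
  finally show ?thesis .
qed

text \<open>The coordinates in \<open>A\<close> are moved one at a time to the centre. Each segment
  stays in the box, hence in \<open>U\<close>, so the mean value theorem applies to it.\<close>

lemma constant_along_coordinates:
  assumes H: "smooth_on U H" and box: "\<And>w. (\<And>c. c \<in> C \<Longrightarrow> \<bar>w c - w\<^sub>0 c\<bar> < r) \<Longrightarrow> w \<in> U"
    and zero: "\<And>w c. w \<in> U \<Longrightarrow> c \<in> A \<Longrightarrow> pd c H w = 0"
    and "finite A" "A \<subseteq> C" "\<And>c. c \<in> C \<Longrightarrow> \<bar>w c - w\<^sub>0 c\<bar> < r"
  shows "H w = H (\<lambda>c. if c \<in> A then w\<^sub>0 c else w c)"
  using \<open>finite A\<close> \<open>A \<subseteq> C\<close> zero
proof (induction A)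
  case (insert a A)
  define v where "v = (\<lambda>c. if c \<in> A then w\<^sub>0 c else w c)"
  have a: "a \<in> C" "a \<notin> A" using insert by auto
  have v: "\<bar>v c - w\<^sub>0 c\<bar> < r" if "c \<in> C" for c
    using assms(6)[OF that] by (auto simp: v_def)
  have "((\<lambda>t. H (v(a := t))) has_real_derivative 0) (at t)" if "\<bar>t - w\<^sub>0 a\<bar> \<le> \<bar>v a - w\<^sub>0 a\<bar>" for t
  proof -
    have U: "v(a := t) \<in> U"
      using v a that by (intro box) (auto intro: le_less_trans)
    show ?thesis
      using smooth_on_has_derivative[OF H U, of a] insert.prems(2)[OF U, of a] by simp
  qed
  then obtain t where "H (v(a := v a)) - H (v(a := w\<^sub>0 a)) = (v a - w\<^sub>0 a) * 0"
    using mean_value_abs[of "w\<^sub>0 a" "v a" "\<lambda>t. H (v(a := t))" "\<lambda>_. 0"] by blast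
  then have "H v = H (v(a := w\<^sub>0 a))" by simp
  moreover have "v(a := w\<^sub>0 a) = (\<lambda>c. if c \<in> insert a A then w\<^sub>0 c else w c)"
    by (auto simp: v_def)
  ultimately show ?case using insert by (simp add: v_def)
qed simp

lemma locally_function_of_alphas:
  assumes U: "U \<subseteq> class_domain" and inv: "differential_invariant 3 U J"
  shows "locally_function_of U alphas J"
proof -
  let ?C = "jet_coords 3" and ?\<Psi> = "straighten entries"
  have J: "local_function ?C U J"
    using inv by (simp add: differential_invariant_def differential_function_def)
  have UN: "U \<subseteq> normal_domain" using U class_domain_subset by blast
  \<comment> \<open>The image of \<open>U\<close> under straightening, described through the inverse
    so that it is open as a preimage.\<close>
  define V where "V = {w \<in> normal_domain. section_map w \<in> U}"
  define H where "H w = J (section_map w)" for w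
  have cont: "continuous_on normal_domain section_map"
    by (rule continuous_on_coordinatewise_then_product) (rule smooth_on_continuous[OF smooth_on_section])
  have "V = normal_domain \<inter> section_map -` U" by (auto simp: V_def)
  then have "open V"
    using continuous_open_preimage[OF cont open_normal_domain local_function_open[OF J]] by (simp only:)
  have agree: "section_map w' c = section_map w c" if "w \<in> V" "\<forall>c\<in>?C. w' c = w c" "c \<in> ?C" for w w' c
    using that by (intro section_agree) (auto simp: V_def)
  have V: "cylinder ?C V"
    unfolding cylinder_def
  proof (intro conjI ballI allI impI)
    fix w w' assume w: "w \<in> V" "\<forall>c\<in>?C. w' c = w c"
    have wN: "w \<in> normal_domain" and wU: "section_map w \<in> U" using w(1) by (simp_all add: V_def)
    have "w' \<in> normal_domain"
      by (rule cylinder_agree[OF cylinder_jet_coords_normal wN]) (use w(2) in blast)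
    moreover have "section_map w' \<in> U"
      by (rule cylinder_agree[OF local_function_cylinder[OF J] wU agree[OF w]])
    ultimately show "w' \<in> V" by (simp add: V_def)
  qed fact
  have smooth_section: "smooth_on V (\<lambda>w. section_map w c)" for c
    by (rule smooth_on_subset[OF smooth_on_section]) (auto simp: V_def)
  have H: "local_function ?C V H"
  proof (rule local_functionI[OF V])
    show "smooth_on V H"
      unfolding H_def[abs_def]
      by (rule smooth_on_comp[OF J finite_jet_coords \<open>open V\<close> smooth_section]) (simp add: V_def)
    show "H w' = H w" if "w \<in> V" "\<And>c. c \<in> ?C \<Longrightarrow> w' c = w c" for w w'
    proof -
      have wU: "section_map w \<in> U" using that(1) by (simp add: V_def)
      show ?thesis
        unfolding H_def by (rule local_function_agree[OF J wU agree[OF that(1)]]) (use that(2) in blast)+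
    qed
  qed
  have \<Psi>V: "?\<Psi> z \<in> V" and J_eq: "J z = H (?\<Psi> z)" if "z \<in> U" for z
    using that UN by (auto simp: V_def H_def section_straighten straighten_normal)
  have \<Psi>: "local_function ?C U (\<lambda>z. ?\<Psi> z c)" if "c \<in> ?C" for c
    by (rule local_function_restrict[OF local_function_straighten[OF that] local_function_cylinder[OF J] UN])
  have zero: "pd c H w = 0" if w: "w \<in> V" and c: "c \<in> set free_coords" for w c
  proof -
    define z where "z = section_map w"
    have z: "z \<in> U" "?\<Psi> z = w" using w by (auto simp: V_def z_def straighten_section)
    have "f44 z \<noteq> 0" using z UN by (auto simp: normal_domain_def)
    moreover have "(\<Sum>c\<in>set free_coords. pd c H w * vfield (gfield \<eta>) (\<lambda>z. ?\<Psi> z c) z) = 0"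
      if gen: "generator UNIV \<eta>" for \<eta>
    proof -
      let ?Y = "vfield (gfield \<eta>)"
      have "?Y J z = 0"
        using inv gen z(1) prolonged_vfield[OF J] by (auto simp: differential_invariant_def)
      moreover have "?Y J z = ?Y (\<lambda>z. H (?\<Psi> z)) z"
        by (rule vfield_cong[OF local_function_open[OF J] z(1) J_eq])
      moreover have "?Y (\<lambda>z. H (?\<Psi> z)) z = (\<Sum>c\<in>?C. pd c H w * ?Y (\<lambda>z. ?\<Psi> z c) z)"
        using vfield_comp[OF H finite_jet_coords \<Psi> \<Psi>V finite_jet_coords local_function_cong[OF J J_eq] z(1)] z(2)
        by simp
      \<comment> \<open>In the leading directions the straightened coordinates are invariants, so
        only the free directions survive in the chain rule.\<close>
      moreover have "?Y (\<lambda>z. ?\<Psi> z c) z = 0" if "c \<in> set lead_coords" for c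
      proof -
        from that obtain i where i: "i < 17" "c = lead_coords ! i"
          by (metis in_set_conv_nth length_lead_coords)
        then have "alphas ! i \<in> set alphas" by (simp add: length_alphas)
        then have inv\<alpha>: "differential_invariant 3 class_domain (alphas ! i)"
          using differential_invariant_alphas by blast
        then have "local_function ?C class_domain (alphas ! i)"
          by (simp add: differential_invariant_def differential_function_def)
        moreover have "z \<in> class_domain" using z U by blast
        ultimately have "?Y (alphas ! i) z = 0"
          using inv\<alpha> gen prolonged_vfield by (fastforce simp: differential_invariant_def)
        then show ?thesis using i by (simp add: straighten_lead)
      qed
      ultimately show ?thesis
        using distinct_coords unfolding jet_coords_3 by (simp add: sum.union_disjoint)
    qed
    ultimately show ?thesis using c by (rule free_coefficients_vanish)
  qed
  show ?thesis
    unfolding locally_function_of_def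
  proof
    fix z\<^sub>0 assume z\<^sub>0: "z\<^sub>0 \<in> U"
    define w\<^sub>0 where "w\<^sub>0 = ?\<Psi> z\<^sub>0"
    have w\<^sub>0: "w\<^sub>0 \<in> V" using \<Psi>V[OF z\<^sub>0] by (simp add: w\<^sub>0_def)
    obtain K r where K: "r > 0" "\<And>w. (\<And>c. c \<in> K \<Longrightarrow> \<bar>w c - w\<^sub>0 c\<bar> < r) \<Longrightarrow> w \<in> V"
      using open_contains_box[OF \<open>open V\<close> w\<^sub>0] by metis
    \<comment> \<open>The set \<open>K\<close> is unrelated to third-order jets. As \<open>V\<close>
      is a cylinder over their coordinates, the box can be described by these alone.\<close>
    have box: "w \<in> V" if "\<And>c. c \<in> ?C \<Longrightarrow> \<bar>w c - w\<^sub>0 c\<bar> < r" for w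
    proof -
      have "(\<lambda>c. if c \<in> ?C then w c else w\<^sub>0 c) \<in> V" using that K by (intro K(2)) auto
      then show ?thesis by (rule cylinder_agree[OF V]) simp
    qed
    define W where "W = {z \<in> U. \<forall>c\<in>?C. \<bar>?\<Psi> z c - w\<^sub>0 c\<bar> < r}"
    define N where "N = {a :: nat \<Rightarrow> real. \<forall>i\<in>{..<17}. \<bar>a i - w\<^sub>0 (lead_coords ! i)\<bar> < r}"
    \<comment> \<open>Values of the invariants go into the leading slots, and all other coordinates
      are frozen at the centre; \<open>H\<close> composed with \<open>G\<close> is the function of
      the invariants sought.\<close>
    define G where "G a c = (case map_of (zip lead_coords [0..<17]) c of Some i \<Rightarrow> a i | None \<Rightarrow> w\<^sub>0 c)"
      for a :: "nat \<Rightarrow> real" and c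
    have G_lead: "G a (lead_coords ! i) = a i" if "i < 17" for a i
      using that distinct_coords by (simp add: G_def map_of_zip_nth length_lead_coords)
    have G_free: "G a c = w\<^sub>0 c" if "c \<notin> set lead_coords" for a c
    proof -
      have "map_of (zip lead_coords [0..<17]) c = None"
        using that by (simp add: length_lead_coords)
      then show ?thesis by (simp add: G_def)
    qed
    have lead: "\<exists>i<17. c = lead_coords ! i" if "c \<in> set lead_coords" for c
      using that by (metis in_set_conv_nth length_lead_coords)
    have "open N"
      unfolding N_def using open_ball_coords[of "{..<17::nat}" "\<lambda>i. w\<^sub>0 (lead_coords ! i)" r] by simp
    have GV: "G a \<in> V" if "a \<in> N" for a
    proof (rule box)
      show "\<bar>G a c - w\<^sub>0 c\<bar> < r" if "c \<in> ?C" for c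
        using \<open>a \<in> N\<close> K(1) lead[of c] G_lead G_free[of c a]
        by (cases "c \<in> set lead_coords") (auto simp: N_def)
    qed
    have smooth_G: "smooth_on N (\<lambda>a. G a c)" for c
    proof (cases "c \<in> set lead_coords")
      case True
      then obtain i where "i < 17" "c = lead_coords ! i" using lead by blast
      then show ?thesis using smooth_on_coord[OF \<open>open N\<close>, of i] by (simp add: G_lead)
    next
      case False
      then show ?thesis using smooth_on_const[OF \<open>open N\<close>] by (simp add: G_free)
    qed
    have "local_function {..<17} N (\<lambda>a. H (G a))"
    proof (rule local_functionI)
      show "cylinder {..<17} N" using \<open>open N\<close> by (auto simp: cylinder_def N_def)
      show "smooth_on N (\<lambda>a. H (G a))"
        by (rule smooth_on_comp[OF H finite_jet_coords \<open>open N\<close> smooth_G GV])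
      show "H (G a') = H (G a)" if "a \<in> N" "\<And>i. i \<in> {..<17} \<Longrightarrow> a' i = a i" for a a'
      proof -
        have "G a' c = G a c" for c
          using lead[of c] that(2) G_lead G_free[of c] by (cases "c \<in> set lead_coords") auto
        then have "G a' = G a" by blast
        then show ?thesis by simp
      qed
    qed
    moreover have "open W"
    proof -
      \<comment> \<open>The box constrains third-order coordinates only, so setting the others to 0
        leaves the preimage unchanged and reduces continuity to those coordinates.\<close>
      have "continuous_on U (\<lambda>z. (\<lambda>c. if c \<in> ?C then ?\<Psi> z c else 0))"
      proof (rule continuous_on_coordinatewise_then_product)
        show "continuous_on U (\<lambda>z. if c \<in> ?C then ?\<Psi> z c else 0)" for c
          using smooth_on_continuous[OF local_function_smooth[OF \<Psi>]] by (cases "c \<in> ?C") auto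
      qed
      note preimage = continuous_open_preimage[OF this local_function_open[OF J] open_ball_coords[OF finite_jet_coords, of 3 w\<^sub>0 r]]
      have "W = U \<inter> (\<lambda>z. (\<lambda>c. if c \<in> ?C then ?\<Psi> z c else 0)) -` {w. \<forall>c\<in>?C. \<bar>w c - w\<^sub>0 c\<bar> < r}"
        by (auto simp: W_def)
      with preimage show ?thesis by (simp only:)
    qed
    moreover have "z\<^sub>0 \<in> W" using z\<^sub>0 K(1) by (simp add: W_def w\<^sub>0_def)
    moreover have "(\<lambda>i. (alphas ! i) z) \<in> N \<and> J z = H (G (\<lambda>i. (alphas ! i) z))" if z: "z \<in> W" for z
    proof
      have *: "\<bar>?\<Psi> z c - w\<^sub>0 c\<bar> < r" if "c \<in> ?C" for c using z that by (simp add: W_def)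
      have "lead_coords ! i \<in> ?C" if "i < 17" for i
        using that by (simp add: jet_coords_3 length_lead_coords)
      then show "(\<lambda>i. (alphas ! i) z) \<in> N"
        using * by (simp add: N_def straighten_lead[symmetric])
      have "J z = H (?\<Psi> z)" using z by (intro J_eq) (simp add: W_def)
      also have "\<dots> = H (\<lambda>c. if c \<in> set free_coords then w\<^sub>0 c else ?\<Psi> z c)"
        by (rule constant_along_coordinates[where C = ?C, OF local_function_smooth[OF H] box zero _ _ *])
          (auto simp: jet_coords_3)
      also have "\<dots> = H (G (\<lambda>i. (alphas ! i) z))"
      proof (rule local_function_agree[OF H, symmetric])
        show "(\<lambda>c. if c \<in> set free_coords then w\<^sub>0 c else ?\<Psi> z c) \<in> V"
          using * K(1) by (intro box) auto
        show "G (\<lambda>i. (alphas ! i) z) c = (if c \<in> set free_coords then w\<^sub>0 c else ?\<Psi> z c)" if "c \<in> ?C" for c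
          using that distinct_coords lead[of c] G_lead G_free[of c]
          by (auto simp: jet_coords_3 straighten_lead)
      qed
      finally show "J z = H (G (\<lambda>i. (alphas ! i) z))" .
    qed
    moreover have "W \<subseteq> U" by (auto simp: W_def)
    ultimately show "\<exists>W V \<Phi>. open W \<and> z\<^sub>0 \<in> W \<and> W \<subseteq> U \<and> local_function {..<length alphas} V \<Phi> \<and>
        (\<forall>z\<in>W. (\<lambda>i. (alphas ! i) z) \<in> V \<and> J z = \<Phi> (\<lambda>i. (alphas ! i) z))"
      unfolding length_alphas by blast
  qed
qed

theorem theorem3p1:
  shows "(\<forall>l\<in>set lambdas. relative_invariant 3 UNIV l)
    \<and> (\<forall>a\<in>set alphas. differential_invariant 3 class_domain a)
    \<and> functionally_independent class_domain alphas
    \<and> (\<forall>U J. U \<subseteq> class_domain \<longrightarrow> differential_invariant 3 U J \<longrightarrow> locally_function_of U alphas J)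
    \<and> (\<forall>D\<in>set inv_ops. invariant_diff_op 3 class_domain D)
    \<and> independent_ops class_domain inv_ops"
  using relative_invariant_lambdas differential_invariant_alphas functionally_independent_alphas
    locally_function_of_alphas invariant_inv_ops independent_inv_ops
  by blast

end
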